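(* Let $n\ge 1$, let $\{u_1,\dots,u_n\}\subset H^2$ be orthonormal and let $\{v_1,\dots,v_n\}\subset H^2$ be an orthogonal set of nonzero vectors. Suppose $g=\theta$ is an inner function, and let $R_n:H^2\to H^2$ be given by $R_n h=T_\theta h+\sum_{i=1}^n\langle h,u_i\rangle v_i$. Then the subspace $\ker R_n$ is nearly $S^*$-invariant with defect at most $n$ and defect space $F=\operatorname{span}\{T_{\overline{\theta}}(S^*v_i) : i=1,\dots,n\}$.
   Context: $H^2$ is the Hardy space of the unit disc $\mathbb{D}$, identified via boundary values with a closed subspace of $L^2(\mathbb{T})$; $P:L^2(\mathbb{T})\to H^2$ is the orthogonal projection; for $g\in L^\infty(\mathbb{T})$ the Toeplitz operator is $T_g f=P(gf)$ for $f\in H^2$. The backward shift is $S^*f(z)=(f(z)-f(0))/z$. An inner function is a bounded analytic function on $\mathbb{D}$ with unimodular boundary values a.e. on $\mathbb{T}$. A subspace $M\subset H^2$ is nearly $S^*$-invariant with defect $m$ if there is an $m$-dimensional subspace $F$ such that $S^*f\in M+F$ whenever $f\in M$ and $f(0)=0$; $F$ is called the defect space. "Defect at most $n$ and defect space $F$" means that this inclusion holds with the given $F$ and $\dim F\le n$. *)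

theory Defs
  imports "HOL-Complex_Analysis.Complex_Analysis" "HOL-Library.Function_Algebras"
begin

text \<open>
  Complex vector space of all functions \<open>complex \<Rightarrow> complex\<close>, with the pointwise addition of
  \<^theory>\<open>HOL-Library.Function_Algebras\<close>; it supplies subspaces, spans and dimensions over the
  complex scalars.
\<close>

definition cscale :: "complex \<Rightarrow> (complex \<Rightarrow> complex) \<Rightarrow> complex \<Rightarrow> complex" where
  "cscale c f = (\<lambda>z. c * f z)"

interpretation cfun: vector_space cscale
  by unfold_locales (auto simp: cscale_def fun_eq_iff algebra_simps)

text \<open>
  Normalised arc length on the unit circle, as a Borel measure on the plane. Elements of
  $L^2(\mathbb{T})$ are represented by functions on the plane, of which only the values on the
  circle matter, up to equality almost everywhere.
\<close>

definition circle_measure :: "complex measure" where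
  "circle_measure = distr (uniform_measure lborel {0..<2 * pi}) borel cis"

definition circle_inner :: "(complex \<Rightarrow> complex) \<Rightarrow> (complex \<Rightarrow> complex) \<Rightarrow> complex" where
  "circle_inner F G = (\<integral>\<zeta>. F \<zeta> * cnj (G \<zeta>) \<partial>circle_measure)"

text \<open>
  Functions on the open unit disc are represented by their extension by 0, so that equality of
  elements of $H^2$ is equality of HOL functions.
\<close>

definition H2 :: "(complex \<Rightarrow> complex) set" where
  "H2 = {f. f holomorphic_on ball 0 1 \<and> (\<forall>z. z \<notin> ball 0 1 \<longrightarrow> f z = 0) \<and>
            bdd_above ((\<lambda>r::real. \<integral>\<zeta>. (cmod (f (of_real r * \<zeta>)))\<^sup>2 \<partial>circle_measure) ` {0..<1})}"

text \<open>
  Boundary values are radial limits. Where the radial limit does not exist the value is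
  unspecified; for functions in $H^2$ this happens only on a null set (Fatou).
\<close>

definition boundary :: "(complex \<Rightarrow> complex) \<Rightarrow> complex \<Rightarrow> complex" where
  "boundary f \<zeta> = Lim (at_left (1::real)) (\<lambda>r. f (of_real r * \<zeta>))"

definition H2_inner :: "(complex \<Rightarrow> complex) \<Rightarrow> (complex \<Rightarrow> complex) \<Rightarrow> complex" where
  "H2_inner f g = circle_inner (boundary f) (boundary g)"

text \<open>
  Orthogonal projection $P : L^2(\mathbb{T}) \to H^2$: the unique $k \in H^2$ with
  $h - k \perp H^2$ on the circle. It is meant for square integrable \<open>h\<close> only.
\<close>

definition riesz_projection :: "(complex \<Rightarrow> complex) \<Rightarrow> complex \<Rightarrow> complex" where
  "riesz_projection h =
     (THE k. k \<in> H2 \<and> (\<forall>w\<in>H2. circle_inner (\<lambda>\<zeta>. h \<zeta> - boundary k \<zeta>) (boundary w) = 0))"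

text \<open>The symbol \<open>g\<close> is a (bounded) function on the circle.\<close>

definition toeplitz :: "(complex \<Rightarrow> complex) \<Rightarrow> (complex \<Rightarrow> complex) \<Rightarrow> complex \<Rightarrow> complex" where
  "toeplitz g f = riesz_projection (\<lambda>\<zeta>. g \<zeta> * boundary f \<zeta>)"

text \<open>At the origin, $(f(z) - f(0))/z$ is continued by its limit $f'(0)$.\<close>

definition backward_shift :: "(complex \<Rightarrow> complex) \<Rightarrow> complex \<Rightarrow> complex" where
  "backward_shift f z =
     (if z = 0 then deriv f 0 else if z \<in> ball 0 1 then (f z - f 0) / z else 0)"

text \<open>
  The existence of the radial limit is required explicitly, because \<^const>\<open>Lim\<close> is unspecified
  where there is no limit.
\<close>

definition inner_function :: "(complex \<Rightarrow> complex) \<Rightarrow> bool" where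
  "inner_function \<theta> \<longleftrightarrow>
     \<theta> holomorphic_on ball 0 1 \<and> bounded (\<theta> ` ball 0 1) \<and>
     (AE \<zeta> in circle_measure.
        \<exists>L. ((\<lambda>r. \<theta> (of_real r * \<zeta>)) \<longlongrightarrow> L) (at_left (1::real)) \<and> cmod L = 1)"

text \<open>
  Near invariance of \<open>M\<close> under the backward shift with defect at most \<open>n\<close> and defect space \<open>F\<close>.
  Finite dimensionality of \<open>F\<close> is stated separately since \<^const>\<open>cfun.dim\<close> is 0 for
  infinite-dimensional spaces.
\<close>

definition nearly_backward_shift_invariant ::
  "(complex \<Rightarrow> complex) set \<Rightarrow> nat \<Rightarrow> (complex \<Rightarrow> complex) set \<Rightarrow> bool" where
  "nearly_backward_shift_invariant M n F \<longleftrightarrow>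
     M \<subseteq> H2 \<and> cfun.subspace M \<and>
     F \<subseteq> H2 \<and> cfun.subspace F \<and> (\<exists>B. finite B \<and> F = cfun.span B) \<and> cfun.dim F \<le> n \<and>
     (\<forall>f\<in>M. f 0 = 0 \<longrightarrow> (\<exists>p\<in>M. \<exists>q\<in>F. backward_shift f = p + q))"

end

theory Submission
  imports Defs
begin

text \<open>
  The algebra behind the theorem is short. If h lies in the kernel of the perturbed operator, then
  \<theta> h is a linear combination of the functions v i. If moreover h 0 = 0, then the backward shift of
  \<theta> h is \<theta> times the backward shift of h, and the Toeplitz operator whose symbol is the conjugate of
  \<theta> removes the factor \<theta>, because \<theta> is unimodular on the circle. Applying both operators, which are
  linear, to the combination of the v i shows that the backward shift of h is a combination of the
  images of the v i, that is, an element of the defect space; the summand from the kernel is 0. The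
  steps are \<open>toeplitz_inner\<close>, \<open>backward_shift_mult\<close> and \<open>conjugate_toeplitz_left_inverse\<close>.

  The work lies in the boundary theory of the Hardy space that gives these operators their meaning.
  Parseval's identity on circles of radius r < 1 identifies the Hardy space with the square summable
  power series (\<open>H2_disc_series\<close>, \<open>disc_series_in_H2\<close>). Boundary functions are radial limits, so
  Fatou's theorem is needed: the radial limits of f exist almost everywhere, are square integrable,
  and have the Taylor coefficients of f as Fourier coefficients (\<open>fatou_riesz_fischer\<close>,
  \<open>fourier_coeff_boundary\<close>). A subsequence of the partial sums of the series has a limit \<phi> in the mean
  (\<open>riesz_fischer_circle\<close>). The antiderivative G of f is continuous on the closed disc, and on the
  circle it is an indefinite integral of \<open>\<i> * \<zeta> * \<phi> \<zeta>\<close>, hence differentiable along the circle almost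
  everywhere by Lebesgue differentiation. At such a point the values of f on the radius are
  recovered from G by integration against the tangential derivative of the Poisson kernel. After the
  tangent polynomial of G is subtracted, this integral is controlled by the Poisson kernel itself,
  so it tends to 0 (\<open>antiderivative_small_imp_radial_limit\<close>).

  Once boundary functions are understood, the Riesz projection of a square integrable function is
  the power series of its nonnegative Fourier coefficients (\<open>riesz_projection_eq\<close>), from which
  linearity, membership in the Hardy space and the action on boundary functions follow.
\<close>

section \<open>Arc length and monomials on the circle\<close>

lemma measurable_cis [measurable]: "cis \<in> borel_measurable borel"
  by (intro borel_measurable_continuous_onI continuous_intros)

lemma measurable_cnj [measurable]: "cnj \<in> borel_measurable borel"
  by (intro borel_measurable_continuous_onI continuous_intros)

lemma sets_circle_measure [simp, measurable_cong]: "sets circle_measure = sets borel"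
  and space_circle_measure [simp]: "space circle_measure = UNIV"
  by (simp_all add: circle_measure_def)

text \<open>
  The density form turns circle integrals into Lebesgue integrals over one period, where the
  fundamental theorem of calculus and Lebesgue differentiation are available.
\<close>

lemma uniform_measure_arc:
  "uniform_measure lborel {0..<2 * pi} = density lborel (\<lambda>t. ennreal (inverse (2*pi) * indicator {0..<2*pi} t))"
proof -
  have e: "emeasure lborel {0..<2*pi} = ennreal (2*pi)" by simp
  show ?thesis
    unfolding uniform_measure_def e
    by (intro arg_cong2[of _ _ _ _ density] refl ext)
       (auto simp: indicator_def divide_ennreal_def inverse_ennreal)
qed

lemma
  fixes F :: "complex \<Rightarrow> 'b::{banach, second_countable_topology}"
  assumes [measurable]: "F \<in> borel_measurable borel"
  shows integral_circle_measure:
      "integral\<^sup>L circle_measure F = inverse (2*pi) *\<^sub>R (\<integral>t. indicator {0..<2*pi} t *\<^sub>R F (cis t) \<partial>lborel)"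
    and integrable_circle_measure_iff:
      "integrable circle_measure F \<longleftrightarrow> integrable lborel (\<lambda>t. indicator {0..<2*pi} t *\<^sub>R F (cis t))"
proof -
  define c where "c = inverse (2*pi)"
  have c: "c = inverse (2*pi)" "c > 0" by (simp_all add: c_def)
  have d: "uniform_measure lborel {0..<2 * pi} = density lborel (\<lambda>t. ennreal (c * indicator {0..<2*pi} t))"
    unfolding uniform_measure_arc c ..
  have "integral\<^sup>L circle_measure F = (\<integral>t. F (cis t) \<partial>uniform_measure lborel {0..<2*pi})"
    unfolding circle_measure_def by (rule integral_distr) simp_all
  also have "\<dots> = (\<integral>t. (c * indicator {0..<2*pi} t) *\<^sub>R F (cis t) \<partial>lborel)"
    unfolding d using c by (intro integral_density) auto
  also have "\<dots> = c *\<^sub>R (\<integral>t. indicator {0..<2*pi} t *\<^sub>R F (cis t) \<partial>lborel)"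
    by (simp only: scaleR_scaleR[symmetric] integral_scaleR_right)
  finally show "integral\<^sup>L circle_measure F = inverse (2*pi) *\<^sub>R (\<integral>t. indicator {0..<2*pi} t *\<^sub>R F (cis t) \<partial>lborel)"
    unfolding c .
  have "integrable circle_measure F \<longleftrightarrow> integrable (uniform_measure lborel {0..<2*pi}) (\<lambda>t. F (cis t))"
    unfolding circle_measure_def by (rule integrable_distr_eq) simp_all
  also have "\<dots> \<longleftrightarrow> integrable lborel (\<lambda>t. (c * indicator {0..<2*pi} t) *\<^sub>R F (cis t))"
    unfolding d using c by (intro integrable_density) auto
  also have "\<dots> \<longleftrightarrow> integrable lborel (\<lambda>t. indicator {0..<2*pi} t *\<^sub>R F (cis t))"
  proof
    assume "integrable lborel (\<lambda>t. (c * indicator {0..<2*pi} t) *\<^sub>R F (cis t))"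
    then have "integrable lborel (\<lambda>t. inverse c *\<^sub>R ((c * indicator {0..<2*pi} t) *\<^sub>R F (cis t)))"
      by (rule integrable_scaleR_right)
    then show "integrable lborel (\<lambda>t. indicator {0..<2*pi} t *\<^sub>R F (cis t))"
      using c(2) by (simp add: mult.assoc[symmetric])
  next
    assume "integrable lborel (\<lambda>t. indicator {0..<2*pi} t *\<^sub>R F (cis t))"
    then show "integrable lborel (\<lambda>t. (c * indicator {0..<2*pi} t) *\<^sub>R F (cis t))"
      unfolding scaleR_scaleR[symmetric] by (rule integrable_scaleR_right)
  qed
  finally show "integrable circle_measure F \<longleftrightarrow> integrable lborel (\<lambda>t. indicator {0..<2*pi} t *\<^sub>R F (cis t))" .
qed

text \<open>
  The circle measure lives on the Borel sets and is not complete, so transferring null sets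
  along the parametrisation requires a Borel exceptional set.
\<close>

lemma AE_circle_measure_iff:
  assumes "{z. P z} \<in> sets borel"
  shows "(AE \<zeta> in circle_measure. P \<zeta>) \<longleftrightarrow> (AE t in lborel. t \<in> {0..<2*pi} \<longrightarrow> P (cis t))"
  using assms unfolding circle_measure_def
  by (subst AE_distr_iff) (simp_all add: AE_uniform_measure)

lemma AE_circle_norm: "AE \<zeta> in circle_measure. cmod \<zeta> = 1"
  by (subst AE_circle_measure_iff) auto

lemma emeasure_circle_measure_UNIV: "emeasure circle_measure UNIV = 1"
proof -
  have "emeasure circle_measure UNIV = emeasure (uniform_measure lborel {0..<2 * pi}) UNIV"
    unfolding circle_measure_def by (subst emeasure_distr) auto
  also have "\<dots> = 1"
    by (subst emeasure_uniform_measure)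
       (auto simp: ennreal_mult[symmetric] divide_ennreal_def inverse_ennreal)
  finally show ?thesis .
qed

interpretation circle: finite_measure circle_measure
  by (rule finite_measureI) (simp add: emeasure_circle_measure_UNIV)

lemma measure_circle_measure_UNIV: "measure circle_measure UNIV = 1"
  by (simp add: measure_def emeasure_circle_measure_UNIV)

lemma integral_cis_period:
  assumes "m \<noteq> 0"
  shows "(\<integral>t. indicator {0..<2*pi} t *\<^sub>R cis (of_int m * t) \<partial>lborel) = 0"
proof -
  have "(\<integral>t. indicator {0..<2*pi} t *\<^sub>R cis (of_int m * t) \<partial>lborel)
      = (\<integral>t. indicator {0..2*pi} t *\<^sub>R cis (of_int m * t) \<partial>lborel)"
    by (rule integral_cong_AE) (use AE_lborel_singleton[of "2*pi"] in \<open>auto simp: indicator_def\<close>)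
  also have "\<dots> = cis (of_int m * (2*pi)) / (\<i> * of_int m) - cis (of_int m * 0) / (\<i> * of_int m)"
  proof (rule integral_FTC_atLeastAtMost)
    fix t
    have "((\<lambda>z. exp (\<i> * of_int m * z) / (\<i> * of_int m)) has_field_derivative
        exp (\<i> * of_int m * of_real t)) (at (of_real t))"
      using assms by (auto intro!: derivative_eq_intros)
    from has_vector_derivative_real_field[OF this, of "{0..2*pi}"]
    show "((\<lambda>t. cis (of_int m * t) / (\<i> * of_int m)) has_vector_derivative
        cis (of_int m * t)) (at t within {0..2*pi})"
      by (simp add: cis_conv_exp mult.assoc)
  qed (auto intro!: continuous_intros)
  also have "\<dots> = 0"
    using cis_multiple_2pi[of "of_int m"] by (simp add: mult_ac)
  finally show ?thesis .
qed

lemma integral_circle_monomials: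
  "(\<integral>\<zeta>. \<zeta> ^ n * cnj (\<zeta> ^ m) \<partial>circle_measure) = (if n = m then 1 else 0)"
proof -
  have "(\<integral>\<zeta>. \<zeta> ^ n * cnj (\<zeta> ^ m) \<partial>circle_measure) =
    inverse (2*pi) *\<^sub>R (\<integral>t. indicator {0..<2*pi} t *\<^sub>R cis (of_int (int n - int m) * t) \<partial>lborel)"
    by (subst integral_circle_measure)
       (auto simp: Complex.DeMoivre cis_cnj cis_mult algebra_simps intro!: Bochner_Integration.integral_cong)
  also have "\<dots> = (if n = m then 1 else 0)"
  proof (cases "n = m")
    case True
    then show ?thesis by (simp add: scaleR_conv_of_real)
  next
    case False
    then show ?thesis using integral_cis_period[of "int n - int m"] by simp
  qed
  finally show ?thesis .
qed

section \<open>Absolutely convergent series on the circle\<close>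

lemma norm_monomial_on_circle: "cmod \<zeta> = 1 \<Longrightarrow> cmod (b * \<zeta> ^ n) = cmod b"
  by (simp add: norm_mult norm_power)

lemma AE_circle_series_bound:
  assumes "summable (\<lambda>n. cmod (b n))"
  shows "AE \<zeta> in circle_measure. cmod (\<Sum>n. b n * \<zeta> ^ n) \<le> (\<Sum>n. cmod (b n))"
  using AE_circle_norm
proof eventually_elim
  case (elim \<zeta>)
  then show ?case
    using summable_norm[of "\<lambda>n. b n * \<zeta> ^ n"] assms by (simp add: norm_monomial_on_circle)
qed

text \<open>
  On the circle the series is dominated by the sum of the moduli of its coefficients, so it may
  be integrated term by term against a bounded function. The identities of Parseval type below
  are instances.
\<close>

lemma circle_series_integral:
  assumes b: "summable (\<lambda>n. cmod (b n))" and [measurable]: "F \<in> borel_measurable borel"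
    and F: "AE \<zeta> in circle_measure. cmod (F \<zeta>) \<le> M"
  shows "(\<lambda>n. b n * (\<integral>\<zeta>. \<zeta> ^ n * F \<zeta> \<partial>circle_measure)) sums
         (\<integral>\<zeta>. (\<Sum>n. b n * \<zeta> ^ n) * F \<zeta> \<partial>circle_measure)"
proof -
  define f where "f n \<zeta> = b n * (\<zeta> ^ n * F \<zeta>)" for n \<zeta>
  have M0: "AE \<zeta> in circle_measure. cmod (F \<zeta>) \<le> max M 0" using F by eventually_elim simp
  have bd: "AE \<zeta> in circle_measure. cmod (f n \<zeta>) \<le> cmod (b n) * max M 0" for n
    using AE_circle_norm M0 by eventually_elim (simp add: f_def norm_mult norm_power mult_left_mono)
  have fm [measurable]: "f n \<in> borel_measurable circle_measure" for n
    unfolding f_def by measurable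
  have int: "integrable circle_measure (f n)" for n
    by (rule circle.integrable_const_bound[OF bd fm])
  have ae: "AE \<zeta> in circle_measure. \<forall>n. cmod (f n \<zeta>) \<le> cmod (b n) * max M 0"
    using bd by (simp add: AE_all_countable)
  have s: "AE \<zeta> in circle_measure. summable (\<lambda>n. cmod (f n \<zeta>))"
    using ae
  proof eventually_elim
    case (elim \<zeta>)
    show ?case
      by (rule summable_comparison_test'[of "\<lambda>n. cmod (b n) * max M 0" 0])
         (use elim b in \<open>auto intro: summable_mult2\<close>)
  qed
  have "summable (\<lambda>n. \<integral>\<zeta>. cmod (f n \<zeta>) \<partial>circle_measure)"
  proof (rule summable_comparison_test'[of "\<lambda>n. cmod (b n) * max M 0" 0])
    fix n
    have "(\<integral>\<zeta>. cmod (f n \<zeta>) \<partial>circle_measure) \<le> (\<integral>\<zeta>. cmod (b n) * max M 0 \<partial>circle_measure)"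
      by (rule integral_mono_AE) (use bd int in auto)
    then show "norm (\<integral>\<zeta>. cmod (f n \<zeta>) \<partial>circle_measure) \<le> cmod (b n) * max M 0"
      by (simp add: measure_circle_measure_UNIV)
  qed (use b in \<open>auto intro: summable_mult2\<close>)
  note * = sums_integral[OF int s this]
  have "(\<integral>\<zeta>. (\<Sum>n. f n \<zeta>) \<partial>circle_measure) = (\<integral>\<zeta>. (\<Sum>n. b n * \<zeta> ^ n) * F \<zeta> \<partial>circle_measure)"
  proof (rule integral_cong_AE)
    show "AE \<zeta> in circle_measure. (\<Sum>n. f n \<zeta>) = (\<Sum>n. b n * \<zeta> ^ n) * F \<zeta>"
      using AE_circle_norm
    proof eventually_elim
      case (elim \<zeta>)
      have "summable (\<lambda>n. b n * \<zeta> ^ n)"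
        by (rule summable_norm_cancel) (use b elim in \<open>simp add: norm_monomial_on_circle\<close>)
      from suminf_mult2[OF this, of "F \<zeta>"] show ?case
        by (simp add: f_def mult.assoc)
    qed
  qed measurable
  then show ?thesis using * by (simp add: f_def)
qed

lemma circle_series_coefficient:
  assumes "summable (\<lambda>n. cmod (b n))"
  shows "(\<integral>\<zeta>. (\<Sum>n. b n * \<zeta> ^ n) * cnj (\<zeta> ^ m) \<partial>circle_measure) = b m"
proof -
  have "(\<lambda>n. b n * (\<integral>\<zeta>. \<zeta> ^ n * cnj (\<zeta> ^ m) \<partial>circle_measure)) sums
         (\<integral>\<zeta>. (\<Sum>n. b n * \<zeta> ^ n) * cnj (\<zeta> ^ m) \<partial>circle_measure)"
    by (rule circle_series_integral[OF assms, where M = 1])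
       (use AE_circle_norm in \<open>auto simp: norm_power\<close>)
  moreover have "(\<lambda>n. b n * (\<integral>\<zeta>. \<zeta> ^ n * cnj (\<zeta> ^ m) \<partial>circle_measure)) sums b m"
    using sums_single[of m b]
    by (rule back_subst[of "\<lambda>f. f sums _"]) (simp add: fun_eq_iff integral_circle_monomials del: complex_cnj_power)
  ultimately show ?thesis by (rule sums_unique2)
qed

lemma circle_parseval:
  assumes b: "summable (\<lambda>n. cmod (b n))" and c: "summable (\<lambda>n. cmod (c n))"
  shows "(\<lambda>n. b n * cnj (c n)) sums
    (\<integral>\<zeta>. (\<Sum>n. b n * \<zeta> ^ n) * cnj (\<Sum>n. c n * \<zeta> ^ n) \<partial>circle_measure)"
proof -
  have "(\<integral>\<zeta>. \<zeta> ^ n * cnj (\<Sum>n. c n * \<zeta> ^ n) \<partial>circle_measure) = cnj (c n)" for n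
  proof -
    have "(\<integral>\<zeta>. \<zeta> ^ n * cnj (\<Sum>n. c n * \<zeta> ^ n) \<partial>circle_measure)
        = (\<integral>\<zeta>. cnj ((\<Sum>n. c n * \<zeta> ^ n) * cnj (\<zeta> ^ n)) \<partial>circle_measure)"
      by (simp add: mult.commute)
    also have "\<dots> = cnj (c n)"
      using circle_series_coefficient[OF c, of n] by (simp only: Bochner_Integration.integral_cnj)
    finally show ?thesis .
  qed
  moreover have "(\<lambda>n. b n * (\<integral>\<zeta>. \<zeta> ^ n * cnj (\<Sum>n. c n * \<zeta> ^ n) \<partial>circle_measure)) sums
    (\<integral>\<zeta>. (\<Sum>n. b n * \<zeta> ^ n) * cnj (\<Sum>n. c n * \<zeta> ^ n) \<partial>circle_measure)"
    by (rule circle_series_integral[OF b, where M = "\<Sum>n. cmod (c n)"])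
       (use AE_circle_series_bound[OF c] in auto)
  ultimately show ?thesis by simp
qed

lemma circle_parseval_norm:
  assumes b: "summable (\<lambda>n. cmod (b n))"
  shows "(\<lambda>n. (cmod (b n))\<^sup>2) sums (\<integral>\<zeta>. (cmod (\<Sum>n. b n * \<zeta> ^ n))\<^sup>2 \<partial>circle_measure)"
proof -
  have "(\<lambda>n. of_real ((cmod (b n))\<^sup>2)) sums
     (\<integral>\<zeta>. complex_of_real ((cmod (\<Sum>n. b n * \<zeta> ^ n))\<^sup>2) \<partial>circle_measure)"
    using circle_parseval[OF b b] unfolding complex_norm_square .
  also have "(\<integral>\<zeta>. complex_of_real ((cmod (\<Sum>n. b n * \<zeta> ^ n))\<^sup>2) \<partial>circle_measure)
     = of_real (\<integral>\<zeta>. (cmod (\<Sum>n. b n * \<zeta> ^ n))\<^sup>2 \<partial>circle_measure)"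
    by (rule integral_complex_of_real)
  finally show ?thesis by (simp only: sums_of_real_iff)
qed

text \<open>
  A product of two analytic series has no terms of negative frequency, and its mean is its
  constant term. This makes it possible to replace the Cauchy kernel by a kernel of Poisson
  type.
\<close>

lemma circle_analytic_product:
  assumes b: "summable (\<lambda>n. cmod (b n))" and c: "summable (\<lambda>n. cmod (c n))"
  shows "(\<integral>\<zeta>. (\<Sum>n. b n * \<zeta> ^ n) * (\<Sum>n. c n * \<zeta> ^ n) \<partial>circle_measure) = b 0 * c 0"
proof -
  have m: "(\<integral>\<zeta>. \<zeta> ^ k * \<zeta> ^ n \<partial>circle_measure) = (if k = 0 \<and> n = 0 then 1 else 0)" for k n
    using integral_circle_monomials[of "k+n" 0] by (simp add: power_add)
  have e: "(\<integral>\<zeta>. \<zeta> ^ n * (\<Sum>n. c n * \<zeta> ^ n) \<partial>circle_measure) = (if n = 0 then c 0 else 0)" for n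
  proof -
    have "(\<lambda>k. c k * (\<integral>\<zeta>. \<zeta> ^ k * \<zeta> ^ n \<partial>circle_measure)) sums
       (\<integral>\<zeta>. (\<Sum>n. c n * \<zeta> ^ n) * \<zeta> ^ n \<partial>circle_measure)"
      by (rule circle_series_integral[OF c, where M = 1])
         (use AE_circle_norm in \<open>auto simp: norm_power\<close>)
    moreover have "(\<lambda>k. c k * (\<integral>\<zeta>. \<zeta> ^ k * \<zeta> ^ n \<partial>circle_measure)) sums (if n = 0 then c 0 else 0)"
      using sums_single[of 0 "\<lambda>k. if n = 0 then c k else 0"]
      by (rule back_subst[of "\<lambda>f. f sums _"]) (auto simp add: fun_eq_iff m)
    ultimately show ?thesis by (auto simp: mult.commute dest: sums_unique2)
  qed
  have "(\<lambda>n. b n * (\<integral>\<zeta>. \<zeta> ^ n * (\<Sum>n. c n * \<zeta> ^ n) \<partial>circle_measure)) sums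
    (\<integral>\<zeta>. (\<Sum>n. b n * \<zeta> ^ n) * (\<Sum>n. c n * \<zeta> ^ n) \<partial>circle_measure)"
    by (rule circle_series_integral[OF b, where M = "\<Sum>n. cmod (c n)"])
       (use AE_circle_series_bound[OF c] in auto)
  moreover have "(\<lambda>n. b n * (\<integral>\<zeta>. \<zeta> ^ n * (\<Sum>n. c n * \<zeta> ^ n) \<partial>circle_measure)) sums (b 0 * c 0)"
    using sums_single[of 0 "\<lambda>n. b n * c n"]
    by (rule back_subst[of "\<lambda>f. f sums _"]) (auto simp add: fun_eq_iff e)
  ultimately show ?thesis by (rule sums_unique2)
qed

section \<open>The Hardy space as square summable power series\<close>

text \<open>
  The cut-off outside the disc matches the convention for elements of
  \<^const>\<open>H2\<close>, so that a function in the Hardy space equals its series as a HOL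
  function.
\<close>

definition disc_series :: "(nat \<Rightarrow> complex) \<Rightarrow> complex \<Rightarrow> complex" where
  "disc_series a z = (if cmod z < 1 then \<Sum>n. a n * z ^ n else 0)"

abbreviation square_summable :: "(nat \<Rightarrow> complex) \<Rightarrow> bool" where
  "square_summable a \<equiv> summable (\<lambda>n. (cmod (a n))\<^sup>2)"

text \<open>
  The elementary form xy \<le> x^2 + y^2 of the Cauchy-Schwarz inequality.
\<close>

lemma square_summable_mult_abs:
  assumes "summable (\<lambda>n. (x n)\<^sup>2)" "summable (\<lambda>n. (y n :: real)\<^sup>2)"
  shows "summable (\<lambda>n. \<bar>x n * y n\<bar>)"
proof (rule summable_comparison_test'[of "\<lambda>n. (x n)\<^sup>2 + (y n)\<^sup>2" 0])
  fix n
  have "0 \<le> (\<bar>x n\<bar> - \<bar>y n\<bar>)\<^sup>2 + \<bar>x n\<bar> * \<bar>y n\<bar>" by simp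
  then show "norm \<bar>x n * y n\<bar> \<le> (x n)\<^sup>2 + (y n)\<^sup>2"
    by (simp add: power2_eq_square abs_mult algebra_simps)
qed (intro summable_add assms)

lemma square_summable_powser_abs:
  assumes "square_summable a" "cmod z < 1"
  shows "summable (\<lambda>n. cmod (a n * z ^ n))"
proof -
  have "summable (\<lambda>n. ((cmod z)\<^sup>2) ^ n)"
    using assms(2) by (intro summable_geometric) (simp add: abs_square_less_1)
  then have "summable (\<lambda>n. (cmod z ^ n)\<^sup>2)" by (simp add: power_mult[symmetric] mult.commute)
  from square_summable_mult_abs[OF assms(1) this] show ?thesis
    by (simp add: norm_mult norm_power)
qed

lemma disc_series_sums:
  assumes "square_summable a" "cmod z < 1"
  shows "(\<lambda>n. a n * z ^ n) sums disc_series a z"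
  using summable_sums[OF summable_norm_cancel[OF square_summable_powser_abs[OF assms]]] assms(2)
  by (simp add: disc_series_def)

lemma disc_series_holomorphic:
  assumes "square_summable a"
  shows "disc_series a holomorphic_on ball 0 1"
  by (rule power_series_holomorphic[where a = a]) (use disc_series_sums[OF assms] in simp)

text \<open>
  Parseval on the circle of radius r: the dilated series converges absolutely.
\<close>

lemma disc_series_radius_mean:
  assumes "\<And>z. cmod z < 1 \<Longrightarrow> summable (\<lambda>n. cmod (a n * z ^ n))" "0 \<le> r" "r < 1"
  shows "(\<lambda>n. (cmod (a n))\<^sup>2 * (r\<^sup>2) ^ n) sums
           (\<integral>\<zeta>. (cmod (\<Sum>n. a n * (of_real r * \<zeta>) ^ n))\<^sup>2 \<partial>circle_measure)"
proof -
  have "summable (\<lambda>n. cmod (a n * of_real r ^ n))"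
    using assms by (intro assms(1)) simp
  from circle_parseval_norm[OF this] show ?thesis
    using assms(2)
    by (simp add: norm_mult norm_power power_mult_distrib power_mult[symmetric] mult_ac)
qed

lemma disc_series_circle:
  assumes "\<bar>r\<bar> < 1" "cmod \<zeta> = 1"
  shows "disc_series a (of_real r * \<zeta>) = (\<Sum>n. a n * (of_real r * \<zeta>) ^ n)"
  using assms by (simp add: disc_series_def norm_mult)

lemma disc_function_measurable:
  assumes "f holomorphic_on ball 0 1" "\<And>z. z \<notin> ball 0 1 \<Longrightarrow> f z = 0"
  shows "f \<in> borel_measurable borel"
proof -
  have "(\<lambda>x. indicator (ball 0 1) x *\<^sub>R f x) \<in> borel_measurable borel"
    using assms(1) by (intro borel_measurable_continuous_on_indicator)
      (auto intro: holomorphic_on_imp_continuous_on)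
  also have "(\<lambda>x. indicator (ball 0 1) x *\<^sub>R f x) = f"
    using assms(2) by (auto simp: fun_eq_iff indicator_def)
  finally show ?thesis .
qed

lemma disc_series_outside: "z \<notin> ball 0 1 \<Longrightarrow> disc_series a z = 0"
  by (simp add: disc_series_def)

lemma disc_series_in_H2:
  assumes a: "square_summable a"
  shows "disc_series a \<in> H2"
  unfolding H2_def mem_Collect_eq
proof (intro conjI allI impI bdd_aboveI2[where M = "\<Sum>n. (cmod (a n))\<^sup>2"])
  note [measurable] = disc_function_measurable[OF disc_series_holomorphic[OF a] disc_series_outside]
  fix r :: real assume r: "r \<in> {0..<1}"
  have "(\<integral>\<zeta>. (cmod (disc_series a (of_real r * \<zeta>)))\<^sup>2 \<partial>circle_measure)
      = (\<integral>\<zeta>. (cmod (\<Sum>n. a n * (of_real r * \<zeta>) ^ n))\<^sup>2 \<partial>circle_measure)"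
    by (rule integral_cong_AE)
       (use AE_circle_norm r in \<open>auto simp: disc_series_circle\<close>)
  also have "\<dots> = (\<Sum>n. (cmod (a n))\<^sup>2 * (r\<^sup>2) ^ n)"
    using r by (intro sums_unique disc_series_radius_mean square_summable_powser_abs[OF a]) auto
  also have "\<dots> \<le> (\<Sum>n. (cmod (a n))\<^sup>2)"
  proof (rule suminf_le)
    show "summable (\<lambda>n. (cmod (a n))\<^sup>2 * (r\<^sup>2) ^ n)"
      using r by (intro sums_summable[OF disc_series_radius_mean] square_summable_powser_abs[OF a]) auto
    show "(cmod (a n))\<^sup>2 * (r\<^sup>2) ^ n \<le> (cmod (a n))\<^sup>2" for n
      using r by (intro mult_left_le power_le_one) (auto simp: abs_square_le_1)
  qed (rule a)
  finally show "(\<integral>\<zeta>. (cmod (disc_series a (of_real r * \<zeta>)))\<^sup>2 \<partial>circle_measure) \<le> (\<Sum>n. (cmod (a n))\<^sup>2)" .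
qed (use disc_series_holomorphic[OF a] disc_series_outside in auto)

text \<open>
  By Parseval, bounded means over the circles of radius r bound every partial sum of the squared
  moduli of the Taylor coefficients, first with weights r^2n and then, as r tends to 1, without
  weights. Together with the converse above, the Hardy space is the space of square summable
  coefficient sequences.
\<close>

lemma H2_disc_series:
  assumes "f \<in> H2"
  obtains a where "square_summable a" "f = disc_series a"
proof -
  have hol: "f holomorphic_on ball 0 1" and out: "\<And>z. z \<notin> ball 0 1 \<Longrightarrow> f z = 0"
    and bdd: "bdd_above ((\<lambda>r::real. \<integral>\<zeta>. (cmod (f (of_real r * \<zeta>)))\<^sup>2 \<partial>circle_measure) ` {0..<1})"
    using assms by (auto simp: H2_def)
  note [measurable] = disc_function_measurable[OF hol out]
  define a where "a n = (deriv ^^ n) f 0 / fact n" for n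
  have sums: "(\<lambda>n. a n * z ^ n) sums f z" if "cmod z < 1" for z
    using holomorphic_power_series[OF hol, of z] that by (simp add: a_def)
  have f: "f = disc_series a"
  proof
    show "f z = disc_series a z" for z
      using sums[of z] out[of z] by (cases "cmod z < 1") (auto simp: disc_series_def sums_iff)
  qed
  have abs: "summable (\<lambda>n. cmod (a n * z ^ n))" if z: "cmod z < 1" for z
  proof -
    obtain r where r: "cmod z < r" "r < 1" using dense[OF z] by auto
    moreover have "0 < r" using norm_ge_zero[of z] r(1) by linarith
    ultimately show ?thesis
      by (intro powser_insidea[of _ "of_real r"] sums_summable[OF sums]) auto
  qed
  obtain C where "\<And>r. r \<in> {0..<1} \<Longrightarrow> (\<integral>\<zeta>. (cmod (f (of_real r * \<zeta>)))\<^sup>2 \<partial>circle_measure) \<le> C"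
    using bdd unfolding bdd_above_def by blast
  then have C: "\<And>r. 0 \<le> r \<Longrightarrow> r < 1 \<Longrightarrow> (\<integral>\<zeta>. (cmod (f (of_real r * \<zeta>)))\<^sup>2 \<partial>circle_measure) \<le> C"
    by simp
  have part: "(\<Sum>n<N. (cmod (a n))\<^sup>2 * (r\<^sup>2) ^ n) \<le> C" if r: "0 \<le> r" "r < 1" for N r
  proof -
    have "(\<Sum>n<N. (cmod (a n))\<^sup>2 * (r\<^sup>2) ^ n) \<le> (\<integral>\<zeta>. (cmod (\<Sum>n. a n * (of_real r * \<zeta>) ^ n))\<^sup>2 \<partial>circle_measure)"
      using disc_series_radius_mean[OF abs r] by (metis (no_types, lifting) sum_le_suminf sums_iff finite_lessThan mult_nonneg_nonneg zero_le_power zero_le_power2)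
    also have "\<dots> = (\<integral>\<zeta>. (cmod (f (of_real r * \<zeta>)))\<^sup>2 \<partial>circle_measure)"
    proof (rule integral_cong_AE)
      show "AE \<zeta> in circle_measure. (cmod (\<Sum>n. a n * (of_real r * \<zeta>) ^ n))\<^sup>2 = (cmod (f (of_real r * \<zeta>)))\<^sup>2"
        using AE_circle_norm r by (auto simp: disc_series_circle f)
    qed measurable
    finally show ?thesis using C[OF r] by linarith
  qed
  have "(\<Sum>n<N. (cmod (a n))\<^sup>2) \<le> C" for N
  proof (rule tendsto_upperbound)
    show "((\<lambda>r. \<Sum>n<N. (cmod (a n))\<^sup>2 * (r\<^sup>2) ^ n) \<longlongrightarrow> (\<Sum>n<N. (cmod (a n))\<^sup>2)) (at_left 1)"
      by (auto intro!: tendsto_eq_intros)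
    show "\<forall>\<^sub>F r in at_left 1. (\<Sum>n<N. (cmod (a n))\<^sup>2 * (r\<^sup>2) ^ n) \<le> C"
      by (rule eventually_mono[OF eventually_at_left_real[of 0 1]]) (use part in auto)
  qed simp
  then have "square_summable a"
    by (intro bounded_imp_summable[of _ C]) (auto simp: lessThan_Suc_atMost[symmetric] simp del: sum.lessThan_Suc)
  with f that show ?thesis by blast
qed

lemma square_summable_add:
  assumes "square_summable a" "square_summable b"
  shows "square_summable (\<lambda>n. a n + b n)"
proof (rule summable_comparison_test'[of "\<lambda>n. 2 * (cmod (a n))\<^sup>2 + 2 * (cmod (b n))\<^sup>2" 0])
  fix n
  have "(cmod (a n + b n))\<^sup>2 \<le> (cmod (a n) + cmod (b n))\<^sup>2"
    by (intro power_mono norm_triangle_ineq) simp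
  also have "\<dots> \<le> (cmod (a n) + cmod (b n))\<^sup>2 + (cmod (a n) - cmod (b n))\<^sup>2" by simp
  also have "\<dots> = 2 * (cmod (a n))\<^sup>2 + 2 * (cmod (b n))\<^sup>2"
    by (simp add: power2_eq_square algebra_simps)
  finally show "norm ((cmod (a n + b n))\<^sup>2) \<le> 2 * (cmod (a n))\<^sup>2 + 2 * (cmod (b n))\<^sup>2" by simp
qed (intro summable_add summable_mult assms)

lemma square_summable_scale:
  assumes "square_summable a"
  shows "square_summable (\<lambda>n. c * a n)"
  using summable_mult[OF assms, of "(cmod c)\<^sup>2"] by (simp add: norm_mult power_mult_distrib)

lemma disc_series_add:
  assumes "square_summable a" "square_summable b"
  shows "disc_series (\<lambda>n. a n + b n) = disc_series a + disc_series b"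
proof
  fix z
  show "disc_series (\<lambda>n. a n + b n) z = (disc_series a + disc_series b) z"
  proof (cases "cmod z < 1")
    case True
    from sums_unique2[OF disc_series_sums[OF square_summable_add[OF assms] True]]
      sums_add[OF disc_series_sums[OF assms(1) True] disc_series_sums[OF assms(2) True]]
    show ?thesis by (simp add: algebra_simps)
  qed (simp add: disc_series_def)
qed

lemma disc_series_scale:
  assumes "square_summable a"
  shows "disc_series (\<lambda>n. c * a n) = cscale c (disc_series a)"
proof
  fix z
  show "disc_series (\<lambda>n. c * a n) z = cscale c (disc_series a) z"
  proof (cases "cmod z < 1")
    case True
    from sums_unique2[OF disc_series_sums[OF square_summable_scale[OF assms] True]]
      sums_mult[OF disc_series_sums[OF assms True], of c]
    show ?thesis by (simp add: algebra_simps cscale_def)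
  qed (simp add: disc_series_def cscale_def)
qed

lemma disc_series_zero: "disc_series (\<lambda>_. 0) = 0"
  by (auto simp: disc_series_def fun_eq_iff)

lemma H2_subspace: "cfun.subspace H2"
proof (rule cfun.subspaceI)
  show "0 \<in> H2" using disc_series_in_H2[of "\<lambda>_. 0"] by (simp add: disc_series_zero)
  show "f + g \<in> H2" if "f \<in> H2" "g \<in> H2" for f g
  proof -
    obtain a where "square_summable a" "f = disc_series a"
      using \<open>f \<in> H2\<close> by (rule H2_disc_series)
    moreover obtain b where "square_summable b" "g = disc_series b"
      using \<open>g \<in> H2\<close> by (rule H2_disc_series)
    ultimately show ?thesis
      using disc_series_in_H2[OF square_summable_add] by (simp add: disc_series_add)
  qed
  show "cscale c f \<in> H2" if "f \<in> H2" for c f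
  proof -
    obtain a where "square_summable a" "f = disc_series a"
      using \<open>f \<in> H2\<close> by (rule H2_disc_series)
    then show ?thesis
      using disc_series_in_H2[OF square_summable_scale] by (simp add: disc_series_scale)
  qed
qed

section \<open>The Riesz-Fischer theorem\<close>

lemma circle_norm_trig_poly:
  assumes "finite A"
  shows "(\<integral>\<zeta>. (cmod (\<Sum>n\<in>A. a n * \<zeta> ^ n))\<^sup>2 \<partial>circle_measure) = (\<Sum>n\<in>A. (cmod (a n))\<^sup>2)"
proof -
  define b where "b n = (if n \<in> A then a n else 0)" for n
  have "(\<lambda>n. (cmod (b n))\<^sup>2) sums (\<Sum>n\<in>A. (cmod (b n))\<^sup>2)"
    using assms by (intro sums_finite) (auto simp: b_def)
  moreover have "(\<lambda>n. (cmod (b n))\<^sup>2) sums (\<integral>\<zeta>. (cmod (\<Sum>n. b n * \<zeta> ^ n))\<^sup>2 \<partial>circle_measure)"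
    by (intro circle_parseval_norm summable_finite[OF assms]) (auto simp: b_def)
  moreover have "(\<Sum>n. b n * \<zeta> ^ n) = (\<Sum>n\<in>A. a n * \<zeta> ^ n)" for \<zeta>
    using assms by (subst suminf_finite[of A]) (auto simp: b_def)
  moreover have "(\<Sum>n\<in>A. (cmod (b n))\<^sup>2) = (\<Sum>n\<in>A. (cmod (a n))\<^sup>2)" by (simp add: b_def)
  ultimately show ?thesis using sums_unique2 by force
qed

lemma integrable_trig_poly:
  fixes a :: "nat \<Rightarrow> complex"
  shows "integrable circle_measure (\<lambda>\<zeta>. (cmod (\<Sum>n\<in>A. a n * \<zeta> ^ n)) ^ p)"
proof (rule circle.integrable_const_bound[where B = "(\<Sum>n\<in>A. cmod (a n)) ^ p"])
  show "AE \<zeta> in circle_measure. norm ((cmod (\<Sum>n\<in>A. a n * \<zeta> ^ n)) ^ p) \<le> (\<Sum>n\<in>A. cmod (a n)) ^ p"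
    using AE_circle_norm
  proof eventually_elim
    case (elim \<zeta>)
    have "cmod (\<Sum>n\<in>A. a n * \<zeta> ^ n) \<le> (\<Sum>n\<in>A. cmod (a n * \<zeta> ^ n))" by (rule norm_sum)
    also have "\<dots> = (\<Sum>n\<in>A. cmod (a n))" using elim by (simp add: norm_monomial_on_circle)
    finally show ?case by (simp add: power_mono norm_power)
  qed
qed measurable

text \<open>
  A subsequence of the partial sums whose tails decay at a prescribed rate; with geometric decay
  this gives almost everywhere convergence of the subsequence.
\<close>

lemma summable_tail_choice:
  fixes x :: "nat \<Rightarrow> real"
  assumes "summable x" "\<And>n. 0 \<le> x n" "\<And>k. 0 < e k"
  obtains N where "strict_mono (N :: nat \<Rightarrow> nat)" "\<And>k m. (\<Sum>n\<in>{N k..<m}. x n) \<le> e k"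
proof -
  have "\<exists>M. \<forall>m\<ge>M. \<forall>n. norm (sum x {m..<n}) < e k" for k
    using assms(1,3) unfolding summable_Cauchy by blast
  then have "\<exists>M. \<forall>k. \<forall>m\<ge>M k. \<forall>n. norm (sum x {m..<n}) < e k" by (intro choice allI)
  then obtain M where M: "\<And>k m n. m \<ge> M k \<Longrightarrow> norm (sum x {m..<n}) < e k" by blast
  define N where "N k = k + (\<Sum>j\<le>k. M j)" for k
  have "strict_mono N" by (rule strict_mono_Suc_iff[THEN iffD2]) (simp add: N_def)
  moreover have "(\<Sum>n\<in>{N k..<m}. x n) \<le> e k" for k m
  proof -
    have "M k \<le> N k" unfolding N_def using member_le_sum[of k "{..k}" M] by simp
    from M[OF this, of m] show ?thesis by simp
  qed
  ultimately show ?thesis by (rule that)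
qed

text \<open>
  The monotone convergence theorem applied to the series of moduli.
\<close>

lemma AE_summable_norm:
  fixes f :: "nat \<Rightarrow> 'a \<Rightarrow> complex"
  assumes int: "\<And>k. integrable M (f k)" and le: "\<And>k. (\<integral>x. cmod (f k x) \<partial>M) \<le> B k" and B: "summable B"
  shows "AE x in M. summable (\<lambda>k. cmod (f k x))"
    and "summable (\<lambda>k. \<integral>x. cmod (f k x) \<partial>M)"
proof -
  have [measurable]: "f k \<in> borel_measurable M" for k
    using int by (rule borel_measurable_integrable)
  show s: "summable (\<lambda>k. \<integral>x. cmod (f k x) \<partial>M)"
    by (rule summable_comparison_test'[OF B, of 0]) (simp add: le)
  have "(\<integral>\<^sup>+x. (\<Sum>k. ennreal (cmod (f k x))) \<partial>M) = (\<Sum>k. \<integral>\<^sup>+x. ennreal (cmod (f k x)) \<partial>M)"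
    by (rule nn_integral_suminf) auto
  also have "\<dots> = (\<Sum>k. ennreal (\<integral>x. cmod (f k x) \<partial>M))"
    by (intro suminf_cong nn_integral_eq_integral integrable_norm int) auto
  also have "\<dots> = ennreal (\<Sum>k. \<integral>x. cmod (f k x) \<partial>M)"
    by (rule suminf_ennreal2[OF _ s]) simp
  also have "\<dots> \<noteq> \<infinity>" by (rule ennreal_neq_top[folded infinity_ennreal_def])
  finally have "(\<integral>\<^sup>+x. (\<Sum>k. ennreal (cmod (f k x))) \<partial>M) \<noteq> \<infinity>" .
  moreover have "(\<lambda>x. \<Sum>k. ennreal (cmod (f k x))) \<in> borel_measurable M" by measurable
  ultimately have "AE x in M. (\<Sum>k. ennreal (cmod (f k x))) \<noteq> \<infinity>" by (intro nn_integral_PInf_AE)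
  then show "AE x in M. summable (\<lambda>k. cmod (f k x))"
  proof eventually_elim
    case (elim x)
    show ?case by (rule summable_suminf_not_top) (use elim in simp_all)
  qed
qed

text \<open>
  Along a subsequence N k whose tails are at most 4^-k, consecutive partial sums differ in the
  mean by at most 2^-k. Hence the differences are almost everywhere absolutely summable, and
  they sum to the limit \<phi> of these partial sums, both almost everywhere and in the mean.
  The bound on the square norm is Fatou's lemma.
\<close>

lemma riesz_fischer_circle:
  assumes a: "square_summable a"
  obtains \<phi> :: "complex \<Rightarrow> complex" and N :: "nat \<Rightarrow> nat"
  where "\<phi> \<in> borel_measurable borel" "integrable circle_measure \<phi>"
    "integrable circle_measure (\<lambda>\<zeta>. (cmod (\<phi> \<zeta>))\<^sup>2)"
    "(\<integral>\<zeta>. (cmod (\<phi> \<zeta>))\<^sup>2 \<partial>circle_measure) \<le> (\<Sum>n. (cmod (a n))\<^sup>2)"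
    "strict_mono N"
    "(\<lambda>k. \<integral>\<zeta>. cmod ((\<Sum>n<N k. a n * \<zeta> ^ n) - \<phi> \<zeta>) \<partial>circle_measure) \<longlonglongrightarrow> 0"
proof -
  obtain N where N: "strict_mono N" "\<And>k m. (\<Sum>n\<in>{N k..<m}. (cmod (a n))\<^sup>2) \<le> (1/4)^k"
    using summable_tail_choice[OF a, of "\<lambda>k. (1/4)^k"] by auto
  define s where "s k \<zeta> = (\<Sum>n<N k. a n * \<zeta> ^ n)" for k \<zeta>
  define D where "D k \<zeta> = (\<Sum>n\<in>{N k..<N (Suc k)}. a n * \<zeta> ^ n)" for k \<zeta>
  have [measurable]: "s k \<in> borel_measurable borel" "D k \<in> borel_measurable borel" for k
    unfolding s_def D_def by measurable
  have sD: "s (Suc k) \<zeta> - s k \<zeta> = D k \<zeta>" for k \<zeta>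
    using strict_mono_leD[OF N(1), of k "Suc k"]
    by (simp add: s_def D_def lessThan_atLeast0 sum_diff_nat_ivl)
  have D1: "(\<integral>\<zeta>. cmod (D k \<zeta>) \<partial>circle_measure) \<le> (1/2)^k" for k
  proof -
    \<comment> \<open>The weights q = 2^-k and p = 2^k in \<open>p * (d - q)\<^sup>2 \<ge> 0\<close> turn the square norm bound 4^-k into a mean bound 2^-k.\<close>
    obtain p q :: real where q: "p > 0" "p * q = 1" "q = (1/2)^k" "q * q = (1/4)^k"
    proof
      show "(2::real)^k > 0" "(2::real)^k * (1/2)^k = 1" "(1/2::real)^k * (1/2)^k = (1/4)^k"
        by (simp_all only: power_mult_distrib[symmetric]) auto
    qed auto
    have pt: "cmod (D k \<zeta>) \<le> (p * (cmod (D k \<zeta>))\<^sup>2 + q) / 2" for \<zeta>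
    proof -
      have "p * (d - q)\<^sup>2 = p * d\<^sup>2 + (p * q) * q - 2 * (p * q) * d" for d
        by (simp add: power2_eq_square algebra_simps)
      moreover have "0 \<le> p * (cmod (D k \<zeta>) - q)\<^sup>2" using q(1) by simp
      ultimately show ?thesis unfolding q(2) by simp
    qed
    have i1: "integrable circle_measure (\<lambda>\<zeta>. (cmod (D k \<zeta>))\<^sup>2)" and i2: "integrable circle_measure (\<lambda>\<zeta>. cmod (D k \<zeta>))"
      using integrable_trig_poly[of a "{N k..<N (Suc k)}" 2] integrable_trig_poly[of a "{N k..<N (Suc k)}" 1]
      by (simp_all add: D_def)
    have le: "(\<integral>\<zeta>. (cmod (D k \<zeta>))\<^sup>2 \<partial>circle_measure) \<le> q * q"
      unfolding D_def q(4) by (subst circle_norm_trig_poly) (auto intro: N(2))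
    have "(\<integral>\<zeta>. cmod (D k \<zeta>) \<partial>circle_measure) \<le> (\<integral>\<zeta>. (p * (cmod (D k \<zeta>))\<^sup>2 + q) / 2 \<partial>circle_measure)"
      by (rule integral_mono) (use i1 i2 pt in auto)
    also have "\<dots> = (p * (\<integral>\<zeta>. (cmod (D k \<zeta>))\<^sup>2 \<partial>circle_measure) + q) / 2"
      using i1 by (simp add: measure_circle_measure_UNIV)
    also have "\<dots> \<le> (p * (q * q) + q) / 2"
      using le q(1) by (intro divide_right_mono add_right_mono mult_left_mono) auto
    also have "\<dots> = q" using q(2) by (simp add: mult.assoc[symmetric])
    finally show ?thesis unfolding q(3) .
  qed
  have Dint: "integrable circle_measure (D k)" for k
    by (rule integrable_norm_cancel)
       (use integrable_trig_poly[of a "{N k..<N (Suc k)}" 1] in \<open>simp_all add: D_def\<close>)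
  have sum2: "summable (\<lambda>k. (1/2::real)^k)" by (intro summable_geometric) simp
  note S = AE_summable_norm[OF Dint D1 sum2]
  define w where "w \<zeta> = (\<Sum>k. cmod (D k \<zeta>))" for \<zeta>
  define \<phi> where "\<phi> \<zeta> = s 0 \<zeta> + (\<Sum>k. D k \<zeta>)" for \<zeta>
  have [measurable]: "\<phi> \<in> borel_measurable borel" "w \<in> borel_measurable borel"
    unfolding \<phi>_def w_def by measurable
  have wint: "integrable circle_measure w"
    unfolding w_def by (rule integrable_suminf[OF integrable_norm[OF Dint]]) (use S in simp_all)
  have s0: "integrable circle_measure (s 0)"
    by (rule integrable_norm_cancel)
       (use integrable_trig_poly[of a "{..<N 0}" 1] in \<open>simp_all add: s_def\<close>)
  have \<phi>int: "integrable circle_measure \<phi>"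
    unfolding \<phi>_def by (rule Bochner_Integration.integrable_add[OF s0 integrable_suminf[OF Dint S]])
  have tele: "s k \<zeta> = s 0 \<zeta> + (\<Sum>j<k. D j \<zeta>)" for k \<zeta>
  proof (induction k)
    case (Suc k)
    then show ?case using sD[of k \<zeta>] by (simp add: algebra_simps)
  qed simp
  have lim: "AE \<zeta> in circle_measure. (\<lambda>k. s k \<zeta>) \<longlonglongrightarrow> \<phi> \<zeta>"
    using S(1)
  proof eventually_elim
    case (elim \<zeta>)
    then have "(\<lambda>k. \<Sum>j<k. D j \<zeta>) \<longlonglongrightarrow> (\<Sum>j. D j \<zeta>)"
      by (rule summable_LIMSEQ[OF summable_norm_cancel])
    then have "(\<lambda>k. s 0 \<zeta> + (\<Sum>j<k. D j \<zeta>)) \<longlonglongrightarrow> \<phi> \<zeta>"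
      unfolding \<phi>_def by (rule tendsto_add[OF tendsto_const])
    moreover have "(\<lambda>k. s k \<zeta>) = (\<lambda>k. s 0 \<zeta> + (\<Sum>j<k. D j \<zeta>))"
      by (rule ext) (rule tele)
    ultimately show ?case by simp
  qed
  have dom: "AE \<zeta> in circle_measure. cmod (s k \<zeta> - \<phi> \<zeta>) \<le> w \<zeta>" for k
    using S(1)
  proof eventually_elim
    case (elim \<zeta>)
    have "\<phi> \<zeta> - s k \<zeta> = (\<Sum>j. D (j + k) \<zeta>)"
      using suminf_split_initial_segment[OF summable_norm_cancel[OF elim], of k]
      by (simp add: tele[of k] \<phi>_def)
    also have "cmod \<dots> \<le> (\<Sum>j. cmod (D (j + k) \<zeta>))"
      using elim by (intro summable_norm) (simp add: summable_iff_shift[of "\<lambda>j. cmod (D j \<zeta>)"])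
    also have "\<dots> = w \<zeta> - (\<Sum>j<k. cmod (D j \<zeta>))"
      using suminf_split_initial_segment[OF elim, of k] by (simp add: w_def)
    also have "\<dots> \<le> w \<zeta>" by (simp add: sum_nonneg)
    finally show ?case by (simp add: norm_minus_commute)
  qed
  have "(\<lambda>k. \<integral>\<zeta>. cmod (s k \<zeta> - \<phi> \<zeta>) \<partial>circle_measure) \<longlonglongrightarrow> (\<integral>\<zeta>. 0 \<partial>circle_measure)"
  proof (rule integral_dominated_convergence[where w = w])
    show "AE \<zeta> in circle_measure. (\<lambda>k. cmod (s k \<zeta> - \<phi> \<zeta>)) \<longlonglongrightarrow> 0"
      using lim by eventually_elim (auto intro: tendsto_norm_zero simp: LIM_zero)
  qed (use dom wint in auto)
  then have L1: "(\<lambda>k. \<integral>\<zeta>. cmod ((\<Sum>n<N k. a n * \<zeta> ^ n) - \<phi> \<zeta>) \<partial>circle_measure) \<longlonglongrightarrow> 0"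
    by (simp add: s_def)
  have "(\<integral>\<^sup>+\<zeta>. ennreal ((cmod (\<phi> \<zeta>))\<^sup>2) \<partial>circle_measure)
      = (\<integral>\<^sup>+\<zeta>. liminf (\<lambda>k. ennreal ((cmod (s k \<zeta>))\<^sup>2)) \<partial>circle_measure)"
  proof (rule nn_integral_cong_AE)
    show "AE \<zeta> in circle_measure. ennreal ((cmod (\<phi> \<zeta>))\<^sup>2) = liminf (\<lambda>k. ennreal ((cmod (s k \<zeta>))\<^sup>2))"
      using lim
    proof eventually_elim
      case (elim \<zeta>)
      then have "(\<lambda>k. ennreal ((cmod (s k \<zeta>))\<^sup>2)) \<longlonglongrightarrow> ennreal ((cmod (\<phi> \<zeta>))\<^sup>2)"
        by (intro tendsto_intros) auto
      from lim_imp_Liminf[OF _ this] show ?case by simp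
    qed
  qed
  also have "\<dots> \<le> liminf (\<lambda>k. \<integral>\<^sup>+\<zeta>. ennreal ((cmod (s k \<zeta>))\<^sup>2) \<partial>circle_measure)"
    by (rule nn_integral_liminf) measurable
  also have "\<dots> \<le> liminf (\<lambda>k::nat. ennreal (\<Sum>n. (cmod (a n))\<^sup>2))"
  proof (intro Liminf_mono always_eventually allI)
    fix k
    have "(\<integral>\<^sup>+\<zeta>. ennreal ((cmod (s k \<zeta>))\<^sup>2) \<partial>circle_measure) = ennreal (\<integral>\<zeta>. (cmod (s k \<zeta>))\<^sup>2 \<partial>circle_measure)"
      unfolding s_def by (intro nn_integral_eq_integral integrable_trig_poly) auto
    also have "(\<integral>\<zeta>. (cmod (s k \<zeta>))\<^sup>2 \<partial>circle_measure) = (\<Sum>n<N k. (cmod (a n))\<^sup>2)"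
      unfolding s_def by (rule circle_norm_trig_poly) simp
    also have "ennreal \<dots> \<le> ennreal (\<Sum>n. (cmod (a n))\<^sup>2)"
      by (intro ennreal_leI sum_le_suminf a) auto
    finally show "(\<integral>\<^sup>+\<zeta>. ennreal ((cmod (s k \<zeta>))\<^sup>2) \<partial>circle_measure) \<le> ennreal (\<Sum>n. (cmod (a n))\<^sup>2)" .
  qed
  also have "\<dots> = ennreal (\<Sum>n. (cmod (a n))\<^sup>2)" by (rule Liminf_const) simp
  finally have nn: "(\<integral>\<^sup>+\<zeta>. ennreal ((cmod (\<phi> \<zeta>))\<^sup>2) \<partial>circle_measure) \<le> ennreal (\<Sum>n. (cmod (a n))\<^sup>2)" .
  have int2: "integrable circle_measure (\<lambda>\<zeta>. (cmod (\<phi> \<zeta>))\<^sup>2)"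
    by (rule integrableI_bounded) (use nn in \<open>auto simp: less_top[symmetric] top_unique\<close>)
  have "(\<integral>\<zeta>. (cmod (\<phi> \<zeta>))\<^sup>2 \<partial>circle_measure) \<le> (\<Sum>n. (cmod (a n))\<^sup>2)"
    using nn nn_integral_eq_integral[OF int2] by (simp add: suminf_nonneg[OF a])
  with L1 N(1) int2 \<phi>int that show ?thesis by simp
qed

section \<open>Differentiation of indefinite integrals\<close>

text \<open>
  The Lebesgue differentiation theorem gives the right derivative off a null set; applied to the
  reflected function it also gives the left derivative.
\<close>

lemma integral_has_vector_derivative_AE:
  fixes \<psi> :: "real \<Rightarrow> 'b::euclidean_space"
  assumes int: "integrable lborel \<psi>"
  obtains N where "negligible N"
    "\<And>x. x \<notin> N \<Longrightarrow> 0 < x \<Longrightarrow> ((\<lambda>t. integral {0..t} \<psi>) has_vector_derivative \<psi> x) (at x)"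
proof -
  have *: "integrable lborel (\<lambda>x. \<psi> (- x))"
    using lborel_integrable_real_affine[OF int, of "-1" 0] by simp
  have on: "f integrable_on cbox a b" if "integrable lborel f" for f :: "real \<Rightarrow> 'b" and a b
    using integrable_on_lborel[OF that] integrable_on_subcbox by blast
  obtain N1 where N1: "negligible N1"
    "\<And>x e. x \<notin> N1 \<Longrightarrow> 0 < e \<Longrightarrow> \<exists>d>0. \<forall>h. 0 < h \<and> h < d \<longrightarrow>
        norm (integral (cbox x (x + h *\<^sub>R One)) \<psi> /\<^sub>R h ^ DIM(real) - \<psi> x) < e"
    using integrable_ccontinuous_explicit[OF on[OF int]] by metis
  obtain N2 where N2: "negligible N2"
    "\<And>x e. x \<notin> N2 \<Longrightarrow> 0 < e \<Longrightarrow> \<exists>d>0. \<forall>h. 0 < h \<and> h < d \<longrightarrow>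
        norm (integral (cbox x (x + h *\<^sub>R One)) (\<lambda>x. \<psi> (-x)) /\<^sub>R h ^ DIM(real) - \<psi> (-x)) < e"
    using integrable_ccontinuous_explicit[OF on[OF *]] by metis
  have "negligible (N1 \<union> uminus ` N2)"
    using N1(1) N2(1)
    by (intro negligible_Un negligible_differentiable_image_negligible differentiable_on_minus differentiable_on_ident)
       auto
  moreover have "((\<lambda>t. integral {0..t} \<psi>) has_vector_derivative \<psi> x) (at x)"
    if x: "x \<notin> N1 \<union> uminus ` N2" "0 < x" for x
  proof -
    have "- x \<notin> N2" using x(1) by (metis UnI2 imageI minus_minus)
    have "((\<lambda>y. integral {0..y} \<psi>) has_derivative (\<lambda>h. h *\<^sub>R \<psi> x)) (at x)"
      unfolding has_derivative_at_alt
    proof (intro conjI allI impI)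
      show "bounded_linear (\<lambda>h. h *\<^sub>R \<psi> x)" by (rule bounded_linear_scaleR_left)
      fix e :: real assume e: "e > 0"
      obtain d1 where d1: "d1 > 0" "\<And>h. 0 < h \<Longrightarrow> h < d1 \<Longrightarrow> norm (integral {x..x+h} \<psi> /\<^sub>R h - \<psi> x) < e"
        using N1(2)[of x e] x(1) e by (auto simp: cbox_interval)
      obtain d2 where d2: "d2 > 0" "\<And>h. 0 < h \<Longrightarrow> h < d2 \<Longrightarrow>
          norm (integral {-x..-x+h} (\<lambda>x. \<psi> (-x)) /\<^sub>R h - \<psi> x) < e"
        using N2(2)[of "-x" e] \<open>- x \<notin> N2\<close> e by (auto simp: cbox_interval)
      have d2': "norm (integral {x-h..x} \<psi> /\<^sub>R h - \<psi> x) < e" if "0 < h" "h < d2" for h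
        using d2(2)[OF that] Henstock_Kurzweil_Integration.integral_reflect_real[of x "x - h" \<psi>] that by simp
      have est: "norm (I - h *\<^sub>R v) \<le> e * h" if "norm (I /\<^sub>R h - v) < e" "0 < h" for I v :: 'b and h :: real
      proof -
        have "I - h *\<^sub>R v = h *\<^sub>R (I /\<^sub>R h - v)" using that by (simp add: scaleR_diff_right)
        then have "norm (I - h *\<^sub>R v) = h * norm (I /\<^sub>R h - v)" using that by simp
        then show ?thesis using that by (simp add: mult.commute)
      qed
      show "\<exists>d>0. \<forall>y. norm (y - x) < d \<longrightarrow>
        norm (integral {0..y} \<psi> - integral {0..x} \<psi> - (y - x) *\<^sub>R \<psi> x) \<le> e * norm (y - x)"
      proof (intro exI[of _ "min x (min d1 d2)"] conjI allI impI)
        fix y assume y: "norm (y - x) < min x (min d1 d2)"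
        then have y0: "0 < y" by auto
        consider "y = x" | "y > x" | "y < x" by linarith
        then show "norm (integral {0..y} \<psi> - integral {0..x} \<psi> - (y - x) *\<^sub>R \<psi> x) \<le> e * norm (y - x)"
        proof cases
          case 2
          have "integral {0..x} \<psi> + integral {x..y} \<psi> = integral {0..y} \<psi>"
            using 2 x on[OF int, of 0 y] by (intro Henstock_Kurzweil_Integration.integral_combine) auto
          then have eq: "integral {0..y} \<psi> - integral {0..x} \<psi> = integral {x..y} \<psi>" by (simp add: algebra_simps)
          show ?thesis unfolding eq
            using est[where I = "integral {x..y} \<psi>" and h = "y - x" and v = "\<psi> x"] d1(2)[of "y - x"] 2 y by simp
        next
          case 3
          have "integral {0..y} \<psi> + integral {y..x} \<psi> = integral {0..x} \<psi>"
            using 3 y0 on[OF int, of 0 x] by (intro Henstock_Kurzweil_Integration.integral_combine) auto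
          then have eq: "integral {0..y} \<psi> - integral {0..x} \<psi> - (y - x) *\<^sub>R \<psi> x
              = - (integral {y..x} \<psi> - (x - y) *\<^sub>R \<psi> x)" by (simp add: algebra_simps)
          show ?thesis unfolding eq norm_minus_cancel
            using est[where I = "integral {y..x} \<psi>" and h = "x - y" and v = "\<psi> x"] d2'[of "x - y"] 3 y by simp
        qed simp
      qed (use x d1 d2 in auto)
    qed
    then show ?thesis by (simp add: has_vector_derivative_def)
  qed
  ultimately show ?thesis by (rule that)
qed

section \<open>The tangential derivative of the Poisson kernel\<close>

text \<open>
  The quotient x / (1 - x)^2 is the sum of n x^n. Up to a constant factor of modulus 1 the
  kernel is therefore the derivative of the Poisson kernel of z along the circle.
\<close>

definition poisson_derivative_kernel where
  "poisson_derivative_kernel z \<zeta> = cnj (cnj z * \<zeta> / (1 - cnj z * \<zeta>)\<^sup>2) - cnj z * \<zeta> / (1 - cnj z * \<zeta>)\<^sup>2"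

lemma nat_powser_sums:
  fixes x :: complex
  assumes "cmod x < 1"
  shows "(\<lambda>n. of_nat n * x ^ n) sums (x / (1 - x)\<^sup>2)" "summable (\<lambda>n. cmod (of_nat n * x ^ n))"
proof -
  have "(\<lambda>n. x * (of_nat (Suc n) * x ^ n)) sums (x * (1 / (1 - x)\<^sup>2))"
    by (intro sums_mult geometric_deriv_sums assms)
  then have "(\<lambda>n. of_nat (Suc n) * x ^ Suc n) sums (x / (1 - x)\<^sup>2)"
    by (simp add: mult_ac)
  then show "(\<lambda>n. of_nat n * x ^ n) sums (x / (1 - x)\<^sup>2)"
    by (subst (asm) sums_Suc_iff) simp
  have "(\<lambda>n. of_nat (Suc n) * (cmod x) ^ n) sums (1 / (1 - cmod x)\<^sup>2)"
    by (intro geometric_deriv_sums) (use assms in simp)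
  then have "summable (\<lambda>n. real (Suc n) * cmod x ^ n)" by (rule sums_summable)
  from summable_mult[OF this, of "cmod x"] have "summable (\<lambda>n. real (Suc n) * cmod x ^ Suc n)"
    by (simp add: mult_ac)
  then show "summable (\<lambda>n. cmod (of_nat n * x ^ n))"
    by (subst (asm) summable_Suc_iff) (simp add: norm_mult norm_power)
qed

text \<open>
  The conjugate of the kernel series picks the coefficients n b n z^n by Parseval, and
  subtracting the analytic part changes nothing because that part has no constant term. The
  subtraction is what makes the kernel small: weighted with |\<zeta> - \<omega>|, the mean
  modulus of either part alone grows logarithmically as z approaches the boundary point
  \<omega>.
\<close>

lemma poisson_derivative_kernel_reproduces:
  assumes b: "summable (\<lambda>n. cmod (b n))" and z: "cmod z < 1"
  shows "(\<lambda>n. of_nat n * b n * z ^ n) sums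
    (\<integral>\<zeta>. (\<Sum>n. b n * \<zeta> ^ n) * poisson_derivative_kernel z \<zeta> \<partial>circle_measure)"
proof -
  define c where "c n = of_nat n * cnj z ^ n" for n
  define B C where "B \<zeta> = (\<Sum>n. b n * \<zeta> ^ n)" and "C \<zeta> = (\<Sum>n. c n * \<zeta> ^ n)" for \<zeta>
  have [measurable]: "B \<in> borel_measurable borel" "C \<in> borel_measurable borel"
    "poisson_derivative_kernel z \<in> borel_measurable borel"
    unfolding B_def C_def poisson_derivative_kernel_def by measurable
  have c: "summable (\<lambda>n. cmod (c n))"
    using nat_powser_sums(2)[of "cnj z"] z by (simp add: c_def)
  have C: "C \<zeta> = cnj z * \<zeta> / (1 - cnj z * \<zeta>)\<^sup>2" if "cmod \<zeta> = 1" for \<zeta>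
    unfolding C_def c_def using nat_powser_sums(1)[of "cnj z * \<zeta>"] z that
    by (simp add: norm_mult power_mult_distrib mult.assoc sums_iff)
  have Bb: "AE \<zeta> in circle_measure. cmod (B \<zeta>) \<le> (\<Sum>n. cmod (b n))"
    and Cb: "AE \<zeta> in circle_measure. cmod (C \<zeta>) \<le> (\<Sum>n. cmod (c n))"
    unfolding B_def C_def by (intro AE_circle_series_bound b c)+
  have prod: "AE \<zeta> in circle_measure. cmod (B \<zeta> * C \<zeta>) \<le> (\<Sum>n. cmod (b n)) * (\<Sum>n. cmod (c n))"
    using Bb Cb by eventually_elim (auto simp: norm_mult intro!: mult_mono order_trans[OF norm_ge_zero])
  have i1: "integrable circle_measure (\<lambda>\<zeta>. B \<zeta> * cnj (C \<zeta>))" and i2: "integrable circle_measure (\<lambda>\<zeta>. B \<zeta> * C \<zeta>)"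
    using prod by (auto intro!: circle.integrable_const_bound simp: norm_mult)
  have "(\<lambda>n. b n * cnj (c n)) sums (\<integral>\<zeta>. B \<zeta> * cnj (C \<zeta>) \<partial>circle_measure)"
    unfolding B_def C_def by (rule circle_parseval[OF b c])
  also have "(\<integral>\<zeta>. B \<zeta> * cnj (C \<zeta>) \<partial>circle_measure)
      = (\<integral>\<zeta>. B \<zeta> * cnj (C \<zeta>) \<partial>circle_measure) - (\<integral>\<zeta>. B \<zeta> * C \<zeta> \<partial>circle_measure)"
    using circle_analytic_product[OF b c] by (simp add: B_def C_def c_def)
  also have "\<dots> = (\<integral>\<zeta>. B \<zeta> * cnj (C \<zeta>) - B \<zeta> * C \<zeta> \<partial>circle_measure)"
    using i1 i2 by simp
  also have "\<dots> = (\<integral>\<zeta>. B \<zeta> * poisson_derivative_kernel z \<zeta> \<partial>circle_measure)"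
  proof (rule integral_cong_AE)
    show "AE \<zeta> in circle_measure. B \<zeta> * cnj (C \<zeta>) - B \<zeta> * C \<zeta> = B \<zeta> * poisson_derivative_kernel z \<zeta>"
      using AE_circle_norm
      by eventually_elim (simp only: C poisson_derivative_kernel_def right_diff_distrib)
  qed measurable
  finally show ?thesis by (simp add: B_def c_def mult_ac)
qed

lemma poisson_integral_one:
  assumes z: "cmod z < 1"
  shows "(\<integral>\<zeta>. (1 - (cmod z)\<^sup>2) / (cmod (1 - cnj z * \<zeta>))\<^sup>2 \<partial>circle_measure) = 1"
    and "integrable circle_measure (\<lambda>\<zeta>. (1 - (cmod z)\<^sup>2) / (cmod (1 - cnj z * \<zeta>))\<^sup>2)"
proof -
  have geo: "(\<Sum>n. cnj z ^ n * \<zeta> ^ n) = 1 / (1 - cnj z * \<zeta>)" if "cmod \<zeta> = 1" for \<zeta>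
    using geometric_sums[of "cnj z * \<zeta>"] z that by (simp add: norm_mult power_mult_distrib sums_iff)
  have s: "summable (\<lambda>n. cmod (cnj z ^ n))" using z by (simp add: norm_power)
  have "(\<integral>\<zeta>. (1 - (cmod z)\<^sup>2) / (cmod (1 - cnj z * \<zeta>))\<^sup>2 \<partial>circle_measure)
      = (\<integral>\<zeta>. (1 - (cmod z)\<^sup>2) * (cmod (\<Sum>n. cnj z ^ n * \<zeta> ^ n))\<^sup>2 \<partial>circle_measure)"
  proof (rule integral_cong_AE)
    show "AE \<zeta> in circle_measure. (1 - (cmod z)\<^sup>2) / (cmod (1 - cnj z * \<zeta>))\<^sup>2
        = (1 - (cmod z)\<^sup>2) * (cmod (\<Sum>n. cnj z ^ n * \<zeta> ^ n))\<^sup>2"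
      using AE_circle_norm by eventually_elim (simp add: geo norm_divide power_divide)
  qed measurable
  also have "\<dots> = (1 - (cmod z)\<^sup>2) * (\<integral>\<zeta>. (cmod (\<Sum>n. cnj z ^ n * \<zeta> ^ n))\<^sup>2 \<partial>circle_measure)"
    by simp
  also have "(\<integral>\<zeta>. (cmod (\<Sum>n. cnj z ^ n * \<zeta> ^ n))\<^sup>2 \<partial>circle_measure) = 1 / (1 - (cmod z)\<^sup>2)"
  proof (rule sums_unique2[OF circle_parseval_norm[OF s]])
    have "(\<lambda>n. ((cmod z)\<^sup>2) ^ n) sums (1 / (1 - (cmod z)\<^sup>2))"
      using z by (intro geometric_sums) (simp add: abs_square_less_1)
    then show "(\<lambda>n. (cmod (cnj z ^ n))\<^sup>2) sums (1 / (1 - (cmod z)\<^sup>2))"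
      by (simp add: norm_power power_mult[symmetric] mult.commute)
  qed
  also have "(1 - (cmod z)\<^sup>2) * (1 / (1 - (cmod z)\<^sup>2)) = 1"
    using z abs_square_less_1[of "cmod z"] by simp
  finally show *: "(\<integral>\<zeta>. (1 - (cmod z)\<^sup>2) / (cmod (1 - cnj z * \<zeta>))\<^sup>2 \<partial>circle_measure) = 1" .
  then show "integrable circle_measure (\<lambda>\<zeta>. (1 - (cmod z)\<^sup>2) / (cmod (1 - cnj z * \<zeta>))\<^sup>2)"
    using not_integrable_integral_eq by fastforce
qed

text \<open>
  For x of modulus r, the difference of the conjugate and the value of x / (1 - x)^2 is (cnj x -
  x) (1 - r^2) / |1 - x|^4, and |cnj x - x| is at most twice the distance of \<zeta> from
  \<omega>. A further factor |\<zeta> - \<omega>|, which is at most 2 |1 - x|, thus turns the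
  kernel into a multiple of the Poisson kernel, whose mean is 1.
\<close>

lemma poisson_derivative_kernel_bound:
  assumes r: "0 \<le> r" "r < 1" and \<omega>: "cmod \<omega> = 1" and \<zeta>: "cmod \<zeta> = 1"
  shows "cmod (poisson_derivative_kernel (of_real r * \<omega>) \<zeta>)
           \<le> 2 * cmod (\<zeta> - \<omega>) * (1 - r\<^sup>2) / (cmod (1 - cnj (of_real r * \<omega>) * \<zeta>)) ^ 4"
    and "cmod (\<zeta> - \<omega>) \<le> 2 * cmod (1 - cnj (of_real r * \<omega>) * \<zeta>)"
proof -
  define \<eta> where "\<eta> = cnj \<omega> * \<zeta>"
  define x where "x = cnj (of_real r * \<omega>) * \<zeta>"
  have x: "x = of_real r * \<eta>" by (simp add: x_def \<eta>_def)
  have \<eta>1: "cmod \<eta> = 1" using \<omega> \<zeta> by (simp add: \<eta>_def norm_mult)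
  have "\<omega> * cnj \<omega> = 1" using \<omega> by (simp add: complex_norm_square[symmetric])
  then have "\<zeta> - \<omega> = \<omega> * (\<eta> - 1)" by (simp add: \<eta>_def algebra_simps)
  then have \<eta>d: "cmod (\<zeta> - \<omega>) = cmod (\<eta> - 1)" using \<omega> by (simp add: norm_mult)
  have xn: "cmod x = r" using r \<eta>1 by (simp add: x norm_mult)
  have x1: "x \<noteq> 1" using xn r by auto
  then have x2: "1 - x \<noteq> 0" "1 - cnj x \<noteq> 0" by (auto simp: complex_eq_iff)
  have eq: "cnj (x / (1 - x)\<^sup>2) - x / (1 - x)\<^sup>2 = (cnj x - x) * (1 - x * cnj x) / ((1 - x)\<^sup>2 * (1 - cnj x)\<^sup>2)"
  proof -
    have alg: "y / (1 - y)\<^sup>2 - x / (1 - x)\<^sup>2 = (y - x) * (1 - x * y) / ((1 - y)\<^sup>2 * (1 - x)\<^sup>2)"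
      if "1 - y \<noteq> 0" for y
    proof -
      have "y * (1 - x)\<^sup>2 - x * (1 - y)\<^sup>2 = (y - x) * (1 - x * y)"
        by (simp add: power2_eq_square algebra_simps)
      moreover have "y / (1 - y)\<^sup>2 - x / (1 - x)\<^sup>2
          = (y * (1 - x)\<^sup>2 - x * (1 - y)\<^sup>2) / ((1 - y)\<^sup>2 * (1 - x)\<^sup>2)"
        by (rule diff_frac_eq) (use that x2(1) in simp_all)
      ultimately show ?thesis by simp
    qed
    have "cnj (x / (1 - x)\<^sup>2) = cnj x / (1 - cnj x)\<^sup>2" by simp
    then show ?thesis by (simp only: alg[OF x2(2)] mult.commute)
  qed
  have "cmod (cnj x - x) = 2 * \<bar>Im x\<bar>"
  proof -
    have "cnj x - x = of_real (- 2 * Im x) * \<i>" by (simp add: complex_eq_iff)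
    also have "cmod \<dots> = 2 * \<bar>Im x\<bar>" by (simp add: norm_mult del: of_real_mult)
    finally show ?thesis .
  qed
  also have "\<dots> = 2 * (r * \<bar>Im (\<eta> - 1)\<bar>)" using r by (simp add: x abs_mult)
  also have "\<dots> \<le> 2 * (1 * cmod (\<eta> - 1))"
    using r abs_Im_le_cmod[of "\<eta> - 1"] by (intro mult_left_mono mult_mono) auto
  finally have im: "cmod (cnj x - x) \<le> 2 * cmod (\<eta> - 1)" by simp
  have "cmod (cnj (x / (1 - x)\<^sup>2) - x / (1 - x)\<^sup>2) = cmod (cnj x - x) * (1 - r\<^sup>2) / (cmod (1 - x)) ^ 4"
  proof -
    have "x * cnj x = of_real (r\<^sup>2)" using xn by (simp add: complex_norm_square[symmetric])
    then have "1 - x * cnj x = of_real (1 - r\<^sup>2)" by simp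
    moreover have "\<bar>1 - r\<^sup>2\<bar> = 1 - r\<^sup>2" using r by (simp add: abs_square_le_1)
    ultimately have "cmod (1 - x * cnj x) = 1 - r\<^sup>2" by (simp only: norm_of_real)
    moreover have "cmod (1 - cnj x) = cmod (1 - x)"
      by (metis complex_cnj_diff complex_cnj_one complex_mod_cnj)
    ultimately show ?thesis
      unfolding eq by (simp add: norm_divide norm_mult norm_power power_add[symmetric])
  qed
  also have "\<dots> \<le> 2 * cmod (\<eta> - 1) * (1 - r\<^sup>2) / (cmod (1 - x)) ^ 4"
    using im r by (intro divide_right_mono mult_right_mono) (auto simp: abs_square_le_1)
  finally show "cmod (poisson_derivative_kernel (of_real r * \<omega>) \<zeta>)
           \<le> 2 * cmod (\<zeta> - \<omega>) * (1 - r\<^sup>2) / (cmod (1 - cnj (of_real r * \<omega>) * \<zeta>)) ^ 4"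
    unfolding \<eta>d poisson_derivative_kernel_def x_def .
  have "cmod (\<eta> - 1) \<le> cmod (\<eta> - x) + cmod (x - 1)"
    using norm_triangle_ineq[of "\<eta> - x" "x - 1"] by simp
  also have "cmod (\<eta> - x) = 1 - r"
  proof -
    have "\<eta> - x = of_real (1 - r) * \<eta>" by (simp add: x algebra_simps)
    then show ?thesis using r \<eta>1 by (simp add: norm_mult del: of_real_diff)
  qed
  also have "1 - r \<le> cmod (1 - x)"
    using norm_triangle_ineq2[of 1 x] xn by simp
  finally show "cmod (\<zeta> - \<omega>) \<le> 2 * cmod (1 - cnj (of_real r * \<omega>) * \<zeta>)"
    unfolding \<eta>d x_def[symmetric] by (simp add: norm_minus_commute)
qed

text \<open>
  If the boundary function vanishes to order o(|\<zeta> - \<omega>|) at \<omega>, then near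
  \<omega> its product with the kernel is a small multiple of the Poisson kernel, and away from
  \<omega> the kernel tends uniformly to 0 as r tends to 1.
\<close>

lemma antiderivative_small_imp_radial_limit:
  assumes b: "summable (\<lambda>n. cmod (b n))" and \<omega>: "cmod \<omega> = 1"
    and small: "\<And>\<epsilon>. \<epsilon> > 0 \<Longrightarrow> \<exists>\<delta>>0. \<forall>\<zeta>. cmod \<zeta> = 1 \<and> cmod (\<zeta> - \<omega>) < \<delta> \<longrightarrow>
          cmod (\<Sum>n. b n * \<zeta> ^ n) \<le> \<epsilon> * cmod (\<zeta> - \<omega>)"
  shows "((\<lambda>r. \<Sum>n. of_nat n * b n * (of_real r * \<omega>) ^ n) \<longlongrightarrow> 0) (at_left (1::real))"
proof (rule tendstoI)
  fix e :: real assume e: "e > 0"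
  define B where "B \<zeta> = (\<Sum>n. b n * \<zeta> ^ n)" for \<zeta>
  define M where "M = (\<Sum>n. cmod (b n))"
  obtain \<delta> where \<delta>: "\<delta> > 0"
    "\<And>\<zeta>. cmod \<zeta> = 1 \<Longrightarrow> cmod (\<zeta> - \<omega>) < \<delta> \<Longrightarrow> cmod (B \<zeta>) \<le> e / 16 * cmod (\<zeta> - \<omega>)"
    using small[of "e / 16"] e unfolding B_def by auto
  have M0: "0 \<le> M" unfolding M_def by (rule suminf_nonneg[OF b]) simp
  \<comment> \<open>The near part of the integral contributes 8 * (e / 16); this is the bound for the far part.\<close>
  have "((\<lambda>r. 32 * M * (1 - r\<^sup>2) / \<delta> ^ 3) \<longlongrightarrow> 0) (at_left 1)"
    using \<delta>(1) by (auto intro!: tendsto_eq_intros)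
  then have "\<forall>\<^sub>F r in at_left 1. 32 * M * (1 - r\<^sup>2) / \<delta> ^ 3 < e / 2"
    using e by (intro order_tendstoD(2)) auto
  moreover have "\<forall>\<^sub>F r in at_left (1::real). r \<in> {0<..<1}"
    by (rule eventually_at_left_real) simp
  ultimately show "\<forall>\<^sub>F r in at_left (1::real). dist (\<Sum>n. of_nat n * b n * (of_real r * \<omega>) ^ n) 0 < e"
  proof eventually_elim
    case (elim r)
    then have r: "0 \<le> r" "r < 1" by auto
    define z where "z = of_real r * \<omega>"
    have z: "cmod z = r" using r \<omega> by (simp add: z_def norm_mult)
    have r2: "0 \<le> 1 - r\<^sup>2" using r by (simp add: abs_square_le_1)
    define g where "g \<zeta> = e / 2 * ((1 - (cmod z)\<^sup>2) / (cmod (1 - cnj z * \<zeta>))\<^sup>2) + 32 * M * (1 - r\<^sup>2) / \<delta> ^ 3" for \<zeta>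
    have [measurable]: "B \<in> borel_measurable borel" "poisson_derivative_kernel z \<in> borel_measurable borel"
      "g \<in> borel_measurable borel"
      unfolding B_def poisson_derivative_kernel_def g_def by measurable
    have gint: "integrable circle_measure g"
      unfolding g_def using r z by (intro Bochner_Integration.integrable_add integrable_mult_right poisson_integral_one(2)) auto
    have le: "AE \<zeta> in circle_measure. cmod (B \<zeta> * poisson_derivative_kernel z \<zeta>) \<le> g \<zeta>"
      using AE_circle_norm AE_circle_series_bound[OF b]
    proof eventually_elim
      case (elim \<zeta>)
      then have \<zeta>: "cmod \<zeta> = 1" and BM: "cmod (B \<zeta>) \<le> M" by (auto simp: B_def M_def)
      define X d where "X = cmod (1 - cnj z * \<zeta>)" and "d = cmod (\<zeta> - \<omega>)"
      have k: "cmod (poisson_derivative_kernel z \<zeta>) \<le> 2 * d * (1 - r\<^sup>2) / X ^ 4" and dX: "d \<le> 2 * X"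
        using poisson_derivative_kernel_bound[OF r \<omega> \<zeta>] by (simp_all add: z_def X_def d_def)
      have d0: "0 \<le> d" by (simp add: d_def)
      have "cnj z * \<zeta> \<noteq> 1"
      proof
        assume "cnj z * \<zeta> = 1"
        then have "cmod (cnj z * \<zeta>) = 1" by simp
        then show False using z \<zeta> r by (simp add: norm_mult)
      qed
      then have X0: "X > 0" by (simp add: X_def)
      have g: "g \<zeta> = e / 2 * ((1 - r\<^sup>2) / X\<^sup>2) + 32 * M * (1 - r\<^sup>2) / \<delta> ^ 3"
        by (simp add: g_def X_def z)
      show ?case
      proof (cases "d < \<delta>")
        case True
        have "cmod (B \<zeta> * poisson_derivative_kernel z \<zeta>) \<le> (e / 16 * d) * (2 * d * (1 - r\<^sup>2) / X ^ 4)"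
          unfolding norm_mult using \<delta>(2)[OF \<zeta>] True k e d0 by (intro mult_mono) (auto simp: d_def)
        also have "\<dots> = e / 8 * (d * d) * ((1 - r\<^sup>2) / X ^ 4)" by simp
        also have "\<dots> \<le> e / 8 * ((2 * X) * (2 * X)) * ((1 - r\<^sup>2) / X ^ 4)"
          using e d0 dX X0 r2 by (intro mult_right_mono mult_left_mono mult_mono) auto
        also have "\<dots> = e / 2 * ((1 - r\<^sup>2) / X\<^sup>2)"
          using X0 by (simp add: field_simps eval_nat_numeral)
        also have "\<dots> \<le> g \<zeta>" unfolding g using M0 r2 \<delta>(1) by simp
        finally show ?thesis .
      next
        case False
        then have dl: "\<delta> \<le> 2 * X" using dX by simp
        have "cmod (B \<zeta> * poisson_derivative_kernel z \<zeta>) \<le> M * (2 * d * (1 - r\<^sup>2) / X ^ 4)"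
          unfolding norm_mult using BM k M0 by (intro mult_mono) auto
        also have "\<dots> \<le> M * (2 * (2 * X) * (1 - r\<^sup>2) / X ^ 4)"
          using M0 dX X0 r2 by (intro mult_left_mono divide_right_mono mult_right_mono) auto
        also have "\<dots> = 32 * M * (1 - r\<^sup>2) / (2 * X) ^ 3"
          using X0 by (simp add: field_simps eval_nat_numeral)
        also have "\<dots> \<le> 32 * M * (1 - r\<^sup>2) / \<delta> ^ 3"
          using \<delta>(1) dl M0 r2 X0 by (intro divide_left_mono power_mono mult_nonneg_nonneg mult_pos_pos) auto
        also have "\<dots> \<le> g \<zeta>" unfolding g using e r2 by simp
        finally show ?thesis .
      qed
    qed
    have int: "integrable circle_measure (\<lambda>\<zeta>. B \<zeta> * poisson_derivative_kernel z \<zeta>)"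
    proof (rule Bochner_Integration.integrable_bound[OF gint])
      show "AE \<zeta> in circle_measure. norm (B \<zeta> * poisson_derivative_kernel z \<zeta>) \<le> norm (g \<zeta>)"
        using le by eventually_elim auto
    qed measurable
    have "(\<Sum>n. of_nat n * b n * z ^ n) = (\<integral>\<zeta>. B \<zeta> * poisson_derivative_kernel z \<zeta> \<partial>circle_measure)"
      using poisson_derivative_kernel_reproduces[OF b, of z] z r by (simp add: B_def sums_iff)
    also have "cmod \<dots> \<le> (\<integral>\<zeta>. cmod (B \<zeta> * poisson_derivative_kernel z \<zeta>) \<partial>circle_measure)"
      by (rule integral_norm_bound)
    also have "\<dots> \<le> (\<integral>\<zeta>. g \<zeta> \<partial>circle_measure)"
      using int gint le by (intro integral_mono_AE integrable_norm)
    also have "\<dots> = e / 2 + 32 * M * (1 - r\<^sup>2) / \<delta> ^ 3"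
    proof -
      have "(\<integral>\<zeta>. g \<zeta> \<partial>circle_measure)
        = (\<integral>\<zeta>. e / 2 * ((1 - (cmod z)\<^sup>2) / (cmod (1 - cnj z * \<zeta>))\<^sup>2) \<partial>circle_measure)
          + (\<integral>\<zeta>. 32 * M * (1 - r\<^sup>2) / \<delta> ^ 3 \<partial>circle_measure)"
        unfolding g_def using r z
        by (intro Bochner_Integration.integral_add integrable_mult_right poisson_integral_one(2)) auto
      also have "(\<integral>\<zeta>. e / 2 * ((1 - (cmod z)\<^sup>2) / (cmod (1 - cnj z * \<zeta>))\<^sup>2) \<partial>circle_measure) = e / 2"
        using poisson_integral_one(1)[of z] r z by (subst integral_mult_right_zero) simp
      finally show ?thesis by (simp add: measure_circle_measure_UNIV)
    qed
    finally show ?case using elim(1) by (simp add: z_def dist_norm)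
  qed
qed

section \<open>Measurability of radial limits\<close>

text \<open>
  By continuity the Cauchy criterion for a left limit needs to be tested on rational points
  only. This writes the existence of the limit with countably many conditions.
\<close>

lemma real_Cauchy_at_left_rational:
  fixes g :: "real \<Rightarrow> complex"
  assumes cont: "continuous_on {d0<..<1} g" and d0: "d0 < 1"
  shows "(\<exists>L. (g \<longlongrightarrow> L) (at_left 1)) \<longleftrightarrow>
    (\<forall>k::nat. \<exists>m::nat. \<forall>p::rat. \<forall>q::rat. 1 - 1 / Suc m < real_of_rat p \<and> real_of_rat p < 1 \<and>
        1 - 1 / Suc m < real_of_rat q \<and> real_of_rat q < 1 \<longrightarrow>
        cmod (g (of_rat p) - g (of_rat q)) \<le> 1 / Suc k)" (is "?L \<longleftrightarrow> ?R")
proof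
  assume ?L
  then obtain L where L: "(g \<longlongrightarrow> L) (at_left 1)" by blast
  show ?R
  proof
    fix k :: nat
    have "\<forall>\<^sub>F r in at_left 1. dist (g r) L < 1 / (2 * Suc k)"
      using L by (rule tendstoD) simp
    then obtain c where c: "c < 1" "\<And>r. c < r \<Longrightarrow> r < 1 \<Longrightarrow> dist (g r) L < 1 / (2 * Suc k)"
      unfolding eventually_at_left[OF zero_less_one] by auto
    obtain m where m: "1 / Suc m < 1 - c" using reals_Archimedean[of "1 - c"] c(1) by (auto simp: inverse_eq_divide)
    show "\<exists>m::nat. \<forall>p q. 1 - 1 / Suc m < real_of_rat p \<and> real_of_rat p < 1 \<and>
        1 - 1 / Suc m < real_of_rat q \<and> real_of_rat q < 1 \<longrightarrow>
        cmod (g (of_rat p) - g (of_rat q)) \<le> 1 / Suc k"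
    proof (intro exI[of _ m] allI impI)
      fix p q assume pq: "1 - 1 / Suc m < real_of_rat p \<and> real_of_rat p < 1 \<and>
        1 - 1 / Suc m < real_of_rat q \<and> real_of_rat q < 1"
      have "dist (g (of_rat p)) L < 1 / (2 * Suc k)" "dist (g (of_rat q)) L < 1 / (2 * Suc k)"
        using pq m by (intro c(2); linarith)+
      then have "dist (g (of_rat p)) (g (of_rat q)) < 1 / (2 * Suc k) + 1 / (2 * Suc k)"
        using dist_triangle2[of "g (of_rat p)" "g (of_rat q)" L] by linarith
      also have "\<dots> = 1 / Suc k" by (simp add: field_simps)
      finally show "cmod (g (of_rat p) - g (of_rat q)) \<le> 1 / Suc k" by (simp add: dist_norm)
    qed
  qed
next
  assume R: ?R
  have near: "\<exists>c<1. \<forall>p q. c < p \<and> p < 1 \<and> c < q \<and> q < 1 \<longrightarrow> dist (g p) (g q) < e" if e: "e > 0" for e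
  proof -
    obtain k where k: "1 / Suc k < e / 3" using reals_Archimedean[of "e/3"] e by (auto simp: inverse_eq_divide)
    obtain m where m: "\<And>p q. 1 - 1 / Suc m < real_of_rat p \<Longrightarrow> real_of_rat p < 1 \<Longrightarrow>
        1 - 1 / Suc m < real_of_rat q \<Longrightarrow> real_of_rat q < 1 \<Longrightarrow>
        cmod (g (of_rat p) - g (of_rat q)) \<le> 1 / Suc k" using R by meson
    define c where "c = max d0 (1 - 1 / Suc m)"
    have c: "c < 1" using d0 by (simp add: c_def)
    have app: "\<exists>x::rat. c < of_rat x \<and> of_rat x < (1::real) \<and> dist (g (of_rat x)) (g p) < e / 3" if p: "c < p" "p < 1" for p
    proof -
      have "isCont g p" using cont p by (intro continuous_on_interior[OF cont]) (auto simp: c_def interior_open)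
      moreover have "e / 3 > 0" using e by simp
      ultimately have "\<exists>d>0. \<forall>y. dist y p < d \<longrightarrow> dist (g y) (g p) < e / 3"
        unfolding continuous_at_eps_delta by blast
      then obtain d where d: "d > 0" "\<And>y. dist y p < d \<Longrightarrow> dist (g y) (g p) < e / 3" by blast
      obtain x where "p < real_of_rat x" "real_of_rat x < min 1 (p + d)"
        using of_rat_dense[of p "min 1 (p + d)"] p d(1) by auto
      then show ?thesis using p d(2)[of "of_rat x"] by (intro exI[of _ x]) (auto simp: dist_real_def)
    qed
    show ?thesis
    proof (intro exI[of _ c] conjI allI impI c)
      fix p q assume pq: "c < p \<and> p < 1 \<and> c < q \<and> q < 1"
      obtain x y :: rat where x: "c < of_rat x" "of_rat x < (1::real)" "dist (g (of_rat x)) (g p) < e / 3"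
        and y: "c < of_rat y" "of_rat y < (1::real)" "dist (g (of_rat y)) (g q) < e / 3"
        using app[of p] app[of q] pq by blast
      have "dist (g (of_rat x)) (g (of_rat y)) \<le> 1 / Suc k"
        unfolding dist_norm using x y by (intro m) (auto simp: c_def)
      moreover have "dist (g p) (g q) \<le> dist (g (of_rat x)) (g p) + (dist (g (of_rat x)) (g (of_rat y)) + dist (g (of_rat y)) (g q))"
        by (metis add.commute dist_commute dist_triangle_le dist_triangle add_left_mono order_trans)
      ultimately show "dist (g p) (g q) < e" using k x(3) y(3) by linarith
    qed
  qed
  define s where "s n = 1 - 1 / real (Suc (Suc n))" for n
  have s1: "s n < 1" for n by (simp add: s_def)
  have slim: "s \<longlonglongrightarrow> 1" unfolding s_def by real_asymp
  have sev: "\<forall>\<^sub>F n in sequentially. c < s n" if "c < 1" for c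
    using order_tendstoD(1)[OF slim that] .
  have "Cauchy (\<lambda>n. g (s n))"
  proof (rule metric_CauchyI)
    fix e :: real assume "e > 0"
    then obtain c where c: "c < 1" "\<And>p q. c < p \<and> p < 1 \<and> c < q \<and> q < 1 \<Longrightarrow> dist (g p) (g q) < e"
      using near by blast
    then obtain n0 where "\<And>n. n \<ge> n0 \<Longrightarrow> c < s n" using sev[of c] by (auto simp: eventually_sequentially)
    then show "\<exists>M. \<forall>m\<ge>M. \<forall>n\<ge>M. dist (g (s m)) (g (s n)) < e"
      using c(2) s1 by (intro exI[of _ n0]) auto
  qed
  then obtain L where L: "(\<lambda>n. g (s n)) \<longlonglongrightarrow> L" using Cauchy_convergent_iff convergent_def by blast
  have "(g \<longlongrightarrow> L) (at_left 1)"
  proof (rule tendstoI)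
    fix e :: real assume e: "e > 0"
    then obtain c where c: "c < 1" "\<And>p q. c < p \<and> p < 1 \<and> c < q \<and> q < 1 \<Longrightarrow> dist (g p) (g q) < e / 2"
      using near[of "e / 2"] by auto
    have "\<forall>\<^sub>F n in sequentially. c < s n \<and> dist (g (s n)) L < e / 2"
      using sev[OF c(1)] tendstoD[OF L, of "e/2"] e by (auto elim: eventually_elim2)
    then obtain n where n: "c < s n" "dist (g (s n)) L < e / 2"
      using eventually_happens'[OF sequentially_bot] by blast
    have "dist (g r) L < e" if "c < r" "r < 1" for r
      using c(2)[of r "s n"] n s1[of n] that dist_triangle[of "g r" L "g (s n)"] by auto
    then show "\<forall>\<^sub>F r in at_left 1. dist (g r) L < e"
      unfolding eventually_at_left[OF zero_less_one] using c(1) by auto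
  qed
  then show ?L by blast
qed

text \<open>
  For \<zeta> outside the closed disc, f may jump where the ray leaves the open disc, at r = 1 /
  |\<zeta>|, and vanishes on the ray from there on. Restricting the claim to r close to 1 makes
  it true on the whole plane.
\<close>

lemma radial_continuity:
  assumes cont: "continuous_on (ball 0 1) f" and out: "\<And>z. z \<notin> ball 0 1 \<Longrightarrow> f z = 0"
  shows "\<exists>d0<1. continuous_on {d0<..<1::real} (\<lambda>r. f (of_real r * \<zeta> :: complex) :: complex)"
proof (cases "cmod \<zeta> \<le> 1")
  case True
  have "of_real r * \<zeta> \<in> ball 0 1" if "r \<in> {0<..<1}" for r :: real
    using that mult_le_one[of r "cmod \<zeta>"] True mult_strict_mono'[of r 1 "cmod \<zeta>" 1]
    by (cases "cmod \<zeta> = 1") (auto simp: norm_mult mult_less_le_imp_less)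
  then have "continuous_on {0<..<1::real} (\<lambda>r. f (of_real r * \<zeta>))"
    by (intro continuous_on_compose2[OF cont]) (auto intro!: continuous_intros)
  then show ?thesis by (intro exI[of _ 0]) simp
next
  case False
  then have "f (of_real r * \<zeta>) = 0" if "r \<in> {1 / cmod \<zeta><..<1}" for r :: real
  proof -
    have "0 < cmod \<zeta>" using False by linarith
    then have "0 < 1 / cmod \<zeta>" by simp
    moreover have "1 / cmod \<zeta> < r" using that by simp
    ultimately have "0 < r" by (rule less_trans)
    moreover have "1 < r * cmod \<zeta>"
      using \<open>1 / cmod \<zeta> < r\<close> \<open>0 < cmod \<zeta>\<close> by (simp add: divide_less_eq)
    ultimately show ?thesis by (intro out) (simp add: norm_mult)
  qed
  then have "continuous_on {1 / cmod \<zeta><..<1} (\<lambda>r::real. f (of_real r * \<zeta>))"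
    by (subst continuous_on_cong[OF refl, of _ _ "\<lambda>_. 0"]) auto
  moreover have "1 / cmod \<zeta> < 1"
    using False less_trans[of 0 1 "cmod \<zeta>"] by (simp add: divide_less_eq)
  ultimately show ?thesis by blast
qed

text \<open>
  The boundary function has to be Borel measurable on the whole plane for the integrals to have
  their usual meaning. Where the radial limit exists it is the limit of a sequence of measurable
  functions; elsewhere its value is one fixed unspecified constant.
\<close>

lemma radial_limit_measurable:
  assumes cont: "continuous_on (ball 0 1) f" and out: "\<And>z. z \<notin> ball 0 1 \<Longrightarrow> f z = 0"
  shows "{\<zeta>. \<exists>L. ((\<lambda>r. f (of_real r * \<zeta>)) \<longlongrightarrow> L) (at_left (1::real))} \<in> sets borel" (is "?C \<in> _")
    and "boundary f \<in> borel_measurable borel"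
proof -
  have "(\<lambda>x. indicator (ball 0 1) x *\<^sub>R f x) \<in> borel_measurable borel"
    using cont by (intro borel_measurable_continuous_on_indicator) auto
  also have "(\<lambda>x. indicator (ball 0 1) x *\<^sub>R f x) = f"
    using out by (auto simp: fun_eq_iff indicator_def)
  finally have [measurable]: "f \<in> borel_measurable borel" .
  have "?C = {\<zeta> \<in> space borel. \<forall>k::nat. \<exists>m::nat. \<forall>p::rat. \<forall>q::rat. 1 - 1 / Suc m < real_of_rat p \<and> real_of_rat p < 1 \<and>
        1 - 1 / Suc m < real_of_rat q \<and> real_of_rat q < 1 \<longrightarrow>
        cmod (f (of_real (of_rat p) * \<zeta>) - f (of_real (of_rat q) * \<zeta>)) \<le> 1 / Suc k}"
  proof -
    have "(\<exists>L. ((\<lambda>r. f (of_real r * \<zeta>)) \<longlongrightarrow> L) (at_left (1::real))) \<longleftrightarrow>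
      (\<forall>k::nat. \<exists>m::nat. \<forall>p::rat. \<forall>q::rat. 1 - 1 / Suc m < real_of_rat p \<and> real_of_rat p < 1 \<and>
        1 - 1 / Suc m < real_of_rat q \<and> real_of_rat q < 1 \<longrightarrow>
        cmod (f (of_real (of_rat p) * \<zeta>) - f (of_real (of_rat q) * \<zeta>)) \<le> 1 / Suc k)" for \<zeta>
      using radial_continuity[OF assms, of \<zeta>] real_Cauchy_at_left_rational by blast
    then show ?thesis by simp
  qed
  also have "\<dots> \<in> sets borel" by measurable
  finally show C [measurable]: "?C \<in> sets borel" .
  have eq: "boundary f \<zeta> = (if \<zeta> \<in> ?C then lim (\<lambda>n. f (of_real (1 - 1 / real (Suc (Suc n))) * \<zeta>)) else (THE l. False))" for \<zeta>
  proof (cases "\<zeta> \<in> ?C")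
    case True
    then obtain L where L: "((\<lambda>r. f (of_real r * \<zeta>)) \<longlongrightarrow> L) (at_left (1::real))" by blast
    have "filterlim (\<lambda>n. 1 - 1 / real (Suc (Suc n))) (at_left 1) sequentially"
      unfolding filterlim_at by (intro conjI) (simp, real_asymp)
    from filterlim_compose[OF L this] have "lim (\<lambda>n. f (of_real (1 - 1 / real (Suc (Suc n))) * \<zeta>)) = L"
      by (rule limI)
    moreover have "boundary f \<zeta> = L"
      unfolding boundary_def by (rule tendsto_Lim[OF _ L]) simp
    ultimately show ?thesis using True by simp
  next
    case False
    then have "(\<lambda>l. ((\<lambda>r. f (of_real r * \<zeta>)) \<longlongrightarrow> l) (at_left (1::real))) = (\<lambda>l. False)" by auto
    then have "boundary f \<zeta> = (THE l. False)" unfolding boundary_def Topological_Spaces.Lim_def by simp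
    then show ?thesis using False by simp
  qed
  show "boundary f \<in> borel_measurable borel"
    unfolding eq by measurable
qed

section \<open>Fatou's theorem\<close>

definition antiderivative_coeffs :: "(nat \<Rightarrow> complex) \<Rightarrow> nat \<Rightarrow> complex" where
  "antiderivative_coeffs a n = (case n of 0 \<Rightarrow> 0 | Suc m \<Rightarrow> a m / of_nat n)"

lemma antiderivative_coeffs_summable:
  assumes "square_summable a"
  shows "summable (\<lambda>n. cmod (antiderivative_coeffs a n))"
proof -
  have "summable (\<lambda>n. (1 / real (Suc n))\<^sup>2)"
    using inverse_power_summable[of 2, where 'a = real] summable_Suc_iff[of "\<lambda>n. inverse ((real n)\<^sup>2)"]
    by (simp add: power_divide inverse_eq_divide)
  from square_summable_mult_abs[OF assms this]
  have "summable (\<lambda>n. cmod (antiderivative_coeffs a (Suc n)))"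
    by (simp add: antiderivative_coeffs_def norm_divide abs_mult del: of_nat_Suc)
  then show ?thesis by (subst (asm) summable_Suc_iff)
qed

lemma antiderivative_arc_integral:
  assumes t: "0 \<le> t"
  shows "(\<Sum>n<Suc N. antiderivative_coeffs a n * cis t ^ n) - (\<Sum>n<Suc N. antiderivative_coeffs a n)
    = (\<integral>s. indicator {0..t} s *\<^sub>R (\<i> * cis s * (\<Sum>n<N. a n * cis s ^ n)) \<partial>lborel)"
proof -
  define F where "F s = (\<Sum>n<N. a n * cis s ^ Suc n / of_nat (Suc n))" for s
  have "(\<integral>s. indicator {0..t} s *\<^sub>R (\<i> * cis s * (\<Sum>n<N. a n * cis s ^ n)) \<partial>lborel) = F t - F 0"
  proof (rule integral_FTC_atLeastAtMost[OF t])
    fix s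
    have "((\<lambda>z. \<Sum>n<N. a n * exp (\<i> * z) ^ Suc n / of_nat (Suc n)) has_field_derivative
        (\<Sum>n<N. a n * (of_nat (Suc n) * exp (\<i> * of_real s) ^ n * (exp (\<i> * of_real s) * \<i>)) / of_nat (Suc n)))
        (at (of_real s))"
      by (intro derivative_eq_intros DERIV_sum refl | simp del: of_nat_Suc power_Suc)+
    also have "(\<Sum>n<N. a n * (of_nat (Suc n) * exp (\<i> * of_real s) ^ n * (exp (\<i> * of_real s) * \<i>)) / of_nat (Suc n))
       = \<i> * cis s * (\<Sum>n<N. a n * cis s ^ n)"
      unfolding sum_distrib_left
      by (intro sum.cong refl) (simp add: cis_conv_exp del: of_nat_Suc)
    finally have "((\<lambda>z. \<Sum>n<N. a n * exp (\<i> * z) ^ Suc n / of_nat (Suc n)) has_field_derivative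
        \<i> * cis s * (\<Sum>n<N. a n * cis s ^ n)) (at (of_real s))" .
    from has_vector_derivative_real_field[OF this, of "{0..t}"]
    show "(F has_vector_derivative \<i> * cis s * (\<Sum>n<N. a n * cis s ^ n)) (at s within {0..t})"
      by (simp add: F_def[abs_def] cis_conv_exp del: of_nat_Suc power_Suc)
  qed (auto intro!: continuous_intros)
  moreover have "(\<Sum>n<Suc N. antiderivative_coeffs a n * cis s ^ n) = F s" for s
    unfolding sum.lessThan_Suc_shift F_def
    by (simp add: antiderivative_coeffs_def del: of_nat_Suc power_Suc)
  from this[of t] this[of 0] have "F t - F 0 = (\<Sum>n<Suc N. antiderivative_coeffs a n * cis t ^ n) - (\<Sum>n<Suc N. antiderivative_coeffs a n)"
    by simp
  ultimately show ?thesis by simp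
qed

text \<open>
  The identity holds for polynomials by the fundamental theorem of calculus. Convergence in the
  mean of the partial sums carries it over to \<phi>, while the antiderivative converges
  absolutely.
\<close>

lemma antiderivative_is_indefinite_integral:
  fixes \<phi> :: "complex \<Rightarrow> complex"
  assumes a: "square_summable a" and N: "strict_mono N"
    and [measurable]: "\<phi> \<in> borel_measurable borel" and \<phi>: "integrable circle_measure \<phi>"
    and lim: "(\<lambda>k. \<integral>\<zeta>. cmod ((\<Sum>n<N k. a n * \<zeta> ^ n) - \<phi> \<zeta>) \<partial>circle_measure) \<longlonglongrightarrow> 0"
    and t: "0 \<le> t" "t < 2 * pi"
  shows "(\<Sum>n. antiderivative_coeffs a n * cis t ^ n) - (\<Sum>n. antiderivative_coeffs a n)
    = integral {0..t} (\<lambda>s. indicator {0..<2*pi} s *\<^sub>R (\<i> * cis s * \<phi> (cis s)))"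
proof -
  let ?g = "antiderivative_coeffs a"
  define s where "s k \<zeta> = (\<Sum>n<N k. a n * \<zeta> ^ n)" for k \<zeta>
  have sm [measurable]: "s k \<in> borel_measurable borel" for k
    unfolding s_def by measurable
  have sint: "integrable circle_measure (s k)" for k
    by (rule integrable_norm_cancel)
       (use integrable_trig_poly[of a "{..<N k}" 1] in \<open>simp_all add: s_def\<close>)
  have arc: "integrable lborel (\<lambda>x. indicator {0..<2*pi} x *\<^sub>R (\<i> * cis x * f (cis x)))"
    if [measurable]: "f \<in> borel_measurable borel" and "integrable circle_measure f" for f :: "complex \<Rightarrow> complex"
  proof -
    have "integrable lborel (\<lambda>x. indicator {0..<2*pi} x *\<^sub>R f (cis x))"
      using that(2) by (subst (asm) integrable_circle_measure_iff) auto
    then show ?thesis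
      by (rule Bochner_Integration.integrable_bound) (auto simp: norm_mult)
  qed
  have restrict: "integrable lborel (\<lambda>x. indicator {0..t} x *\<^sub>R (\<i> * cis x * f (cis x)))"
    if [measurable]: "f \<in> borel_measurable borel" and "integrable circle_measure f" for f :: "complex \<Rightarrow> complex"
    by (rule Bochner_Integration.integrable_bound[OF arc[OF that]])
       (use t in \<open>auto simp: norm_mult indicator_def\<close>)
  define I where "I f = (\<integral>x. indicator {0..t} x *\<^sub>R (\<i> * cis x * f (cis x)) \<partial>lborel)" for f :: "complex \<Rightarrow> complex"
  have "(\<lambda>k. I (s k)) \<longlonglongrightarrow> I \<phi>"
  proof (rule Lim_null[THEN iffD2], rule Lim_null_comparison)
    have "(\<lambda>k. 2 * pi * (\<integral>\<zeta>. cmod (s k \<zeta> - \<phi> \<zeta>) \<partial>circle_measure)) \<longlonglongrightarrow> 2 * pi * 0"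
      using lim unfolding s_def by (intro tendsto_mult tendsto_const)
    then show "(\<lambda>k. 2 * pi * (\<integral>\<zeta>. cmod (s k \<zeta> - \<phi> \<zeta>) \<partial>circle_measure)) \<longlonglongrightarrow> 0" by simp
    show "\<forall>\<^sub>F k in sequentially. norm (I (s k) - I \<phi>) \<le> 2 * pi * (\<integral>\<zeta>. cmod (s k \<zeta> - \<phi> \<zeta>) \<partial>circle_measure)"
    proof (intro always_eventually allI)
      fix k
      have "I (s k) - I \<phi> = (\<integral>x. indicator {0..t} x *\<^sub>R (\<i> * cis x * s k (cis x))
          - indicator {0..t} x *\<^sub>R (\<i> * cis x * \<phi> (cis x)) \<partial>lborel)"
        unfolding I_def
        by (rule Bochner_Integration.integral_diff[symmetric, OF restrict[OF sm sint] restrict[OF assms(3) \<phi>]])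
      also have "cmod \<dots> \<le> (\<integral>x. cmod (indicator {0..t} x *\<^sub>R (\<i> * cis x * s k (cis x))
          - indicator {0..t} x *\<^sub>R (\<i> * cis x * \<phi> (cis x))) \<partial>lborel)"
        by (rule integral_norm_bound)
      also have "\<dots> \<le> (\<integral>x. indicator {0..<2*pi} x *\<^sub>R cmod (s k (cis x) - \<phi> (cis x)) \<partial>lborel)"
      proof (rule integral_mono)
        show "integrable lborel (\<lambda>x. cmod (indicator {0..t} x *\<^sub>R (\<i> * cis x * s k (cis x))
          - indicator {0..t} x *\<^sub>R (\<i> * cis x * \<phi> (cis x))))"
          by (intro integrable_norm Bochner_Integration.integrable_diff restrict[OF sm sint] restrict[OF assms(3) \<phi>])
        show "integrable lborel (\<lambda>x. indicator {0..<2*pi} x *\<^sub>R cmod (s k (cis x) - \<phi> (cis x)))"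
          using integrable_circle_measure_iff[of "\<lambda>\<zeta>. cmod (s k \<zeta> - \<phi> \<zeta>)"] sint[of k] \<phi> by auto
        fix x
        have "cmod (\<i> * cis x * s k (cis x) - \<i> * cis x * \<phi> (cis x)) = cmod (s k (cis x) - \<phi> (cis x))"
          by (simp add: right_diff_distrib[symmetric] norm_mult)
        then show "cmod (indicator {0..t} x *\<^sub>R (\<i> * cis x * s k (cis x))
          - indicator {0..t} x *\<^sub>R (\<i> * cis x * \<phi> (cis x))) \<le> indicator {0..<2*pi} x *\<^sub>R cmod (s k (cis x) - \<phi> (cis x))"
          using t by (auto simp: indicator_def)
      qed
      also have "\<dots> = 2 * pi * (\<integral>\<zeta>. cmod (s k \<zeta> - \<phi> \<zeta>) \<partial>circle_measure)"
        by (subst integral_circle_measure) auto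
      finally show "norm (I (s k) - I \<phi>) \<le> 2 * pi * (\<integral>\<zeta>. cmod (s k \<zeta> - \<phi> \<zeta>) \<partial>circle_measure)" .
    qed
  qed
  moreover have "(\<lambda>k. I (s k)) \<longlonglongrightarrow> (\<Sum>n. ?g n * cis t ^ n) - (\<Sum>n. ?g n)"
  proof -
    have g: "summable (\<lambda>n. cmod (?g n))" by (rule antiderivative_coeffs_summable[OF a])
    have "summable (\<lambda>n. ?g n * cis t ^ n)"
      by (rule summable_norm_cancel) (use g in \<open>simp add: norm_monomial_on_circle\<close>)
    then have "(\<lambda>N. (\<Sum>n<N. ?g n * cis t ^ n) - (\<Sum>n<N. ?g n)) \<longlonglongrightarrow> (\<Sum>n. ?g n * cis t ^ n) - (\<Sum>n. ?g n)"
      by (rule tendsto_diff[OF summable_LIMSEQ summable_LIMSEQ[OF summable_norm_cancel[OF g]]])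
    moreover have "strict_mono (\<lambda>k. Suc (N k))"
      using N by (simp add: strict_mono_def)
    ultimately have "(\<lambda>k. (\<Sum>n<Suc (N k). ?g n * cis t ^ n) - (\<Sum>n<Suc (N k). ?g n)) \<longlonglongrightarrow> (\<Sum>n. ?g n * cis t ^ n) - (\<Sum>n. ?g n)"
      using LIMSEQ_subseq_LIMSEQ by (force simp: o_def)
    then show ?thesis
      unfolding antiderivative_arc_integral[OF t(1)] I_def s_def .
  qed
  ultimately have "(\<Sum>n. ?g n * cis t ^ n) - (\<Sum>n. ?g n) = I \<phi>"
    using LIMSEQ_unique by blast
  also have "I \<phi> = (LINT x:{0..t}|lborel. indicator {0..<2*pi} x *\<^sub>R (\<i> * cis x * \<phi> (cis x)))"
    unfolding I_def set_lebesgue_integral_def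
    by (rule Bochner_Integration.integral_cong) (use t in \<open>auto simp: indicator_def\<close>)
  also have "\<dots> = integral {0..t} (\<lambda>s. indicator {0..<2*pi} s *\<^sub>R (\<i> * cis s * \<phi> (cis s)))"
  proof (rule set_borel_integral_eq_integral)
    have "(\<lambda>x. indicator {0..t} x *\<^sub>R indicator {0..<2*pi} x *\<^sub>R (\<i> * cis x * \<phi> (cis x)))
       = (\<lambda>x. indicator {0..t} x *\<^sub>R (\<i> * cis x * \<phi> (cis x)))"
      using t by (auto simp: indicator_def fun_eq_iff)
    then show "set_integrable lborel {0..t} (\<lambda>s. indicator {0..<2*pi} s *\<^sub>R (\<i> * cis s * \<phi> (cis s)))"
      unfolding set_integrable_def using restrict[OF assms(3) \<phi>] by simp
  qed
  finally show ?thesis .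
qed

text \<open>
  The branch of the logarithm at 1 provides an arc parameter that is Lipschitz near \<open>cis
  t0\<close>.
\<close>

lemma arc_parameter_near:
  obtains d where "d > 0"
    "\<And>\<zeta>. cmod \<zeta> = 1 \<Longrightarrow> cmod (\<zeta> - cis t0) < d \<Longrightarrow> \<exists>t. \<zeta> = cis t \<and> \<bar>t - t0\<bar> \<le> 2 * cmod (\<zeta> - cis t0)"
proof -
  have "(Ln has_field_derivative 1) (at 1)"
    using has_field_derivative_Ln[of 1] by (simp add: nonpos_Reals_def)
  then have "(Ln has_derivative (\<lambda>h. h)) (at 1)"
    unfolding has_field_derivative_def by (rule has_derivative_eq_rhs) auto
  then have "\<forall>e>0. \<exists>d>0. \<forall>y. cmod (y - 1) < d \<longrightarrow> cmod (Ln y - Ln 1 - (y - 1)) \<le> e * cmod (y - 1)"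
    unfolding has_derivative_at_alt by blast
  from this[rule_format, OF zero_less_one]
  obtain d where d: "d > 0" "\<And>y. cmod (y - 1) < d \<Longrightarrow> cmod (Ln y - (y - 1)) \<le> cmod (y - 1)"
    by (auto simp: Ln_1)
  show ?thesis
  proof (rule that[OF d(1)])
    fix \<zeta> assume \<zeta>: "cmod \<zeta> = 1" "cmod (\<zeta> - cis t0) < d"
    define y where "y = \<zeta> * cnj (cis t0)"
    have "cis t0 * cnj (cis t0) = 1" by (simp add: complex_norm_square[symmetric])
    then have "y - 1 = (\<zeta> - cis t0) * cnj (cis t0)" by (simp add: y_def algebra_simps)
    then have yd: "cmod (y - 1) = cmod (\<zeta> - cis t0)" by (simp add: norm_mult)
    have y1: "cmod y = 1" using \<zeta> by (simp add: y_def norm_mult)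
    then have "y \<noteq> 0" by auto
    have "y = cis (Im (Ln y))"
    proof -
      have "Re (Ln y) = 0" using y1 \<open>y \<noteq> 0\<close> by simp
      then have "exp (Ln y) = cis (Im (Ln y))" by (subst exp_eq_polar) simp
      then show ?thesis using \<open>y \<noteq> 0\<close> by simp
    qed
    moreover have "\<zeta> = y * cis t0"
      using \<open>cis t0 * cnj (cis t0) = 1\<close> by (simp add: y_def mult_ac)
    ultimately have "\<zeta> = cis (t0 + Im (Ln y))"
      by (metis cis_mult mult.commute)
    moreover have "\<bar>Im (Ln y)\<bar> \<le> 2 * cmod (\<zeta> - cis t0)"
    proof -
      have "cmod (Ln y) \<le> cmod (Ln y - (y - 1)) + cmod (y - 1)"
        using norm_triangle_ineq[of "Ln y - (y - 1)" "y - 1"] by simp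
      also have "\<dots> \<le> 2 * cmod (y - 1)" using d(2)[of y] \<zeta>(2) yd by simp
      finally show ?thesis using abs_Im_le_cmod[of "Ln y"] yd by linarith
    qed
    ultimately show "\<exists>t. \<zeta> = cis t \<and> \<bar>t - t0\<bar> \<le> 2 * cmod (\<zeta> - cis t0)"
      by (intro exI[of _ "t0 + Im (Ln y)"]) auto
  qed
qed

text \<open>
  The antiderivative G is corrected in its coefficients of order 0 and 1 so that it vanishes
  together with its derivative at the boundary point. The corrected series, with coefficients b,
  satisfies the hypothesis of the preceding kernel estimate, and the sum of n b n z^n equals z
  (f z - D).
\<close>

lemma arc_derivative_imp_radial_limit:
  assumes a: "square_summable a"
    and der: "((\<lambda>t. \<Sum>n. antiderivative_coeffs a n * cis t ^ n) has_vector_derivative \<i> * cis t0 * D) (at t0)"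
  shows "((\<lambda>r. disc_series a (of_real r * cis t0)) \<longlongrightarrow> D) (at_left (1::real))"
proof -
  define G where "G \<zeta> = (\<Sum>n. antiderivative_coeffs a n * \<zeta> ^ n)" for \<zeta>
  \<comment> \<open>The series h is the tangent polynomial of G at the boundary point.\<close>
  define h where "h n = (if n = 1 then D else if n = 0 then G (cis t0) - D * cis t0 else 0)" for n :: nat
  define b where "b n = antiderivative_coeffs a n - h n" for n
  have g: "summable (\<lambda>n. cmod (antiderivative_coeffs a n))" by (rule antiderivative_coeffs_summable[OF a])
  have hs: "(\<lambda>n. h n * \<zeta> ^ n) sums (G (cis t0) + D * (\<zeta> - cis t0))" for \<zeta>
  proof -
    have "(\<lambda>n. h n * \<zeta> ^ n) sums (\<Sum>n\<in>{0,1}. h n * \<zeta> ^ n)"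
      by (rule sums_finite) (auto simp: h_def)
    then show ?thesis by (simp add: h_def algebra_simps)
  qed
  have b: "summable (\<lambda>n. cmod (b n))"
  proof (rule summable_comparison_test'[of "\<lambda>n. cmod (antiderivative_coeffs a n) + cmod (h n)" 0])
    show "summable (\<lambda>n. cmod (antiderivative_coeffs a n) + cmod (h n))"
      by (intro summable_add g summable_finite[of "{0,1}"]) (auto simp: h_def)
  qed (simp add: b_def norm_triangle_ineq4)
  have B: "(\<Sum>n. b n * \<zeta> ^ n) = G \<zeta> - G (cis t0) - D * (\<zeta> - cis t0)" if "cmod \<zeta> = 1" for \<zeta>
  proof -
    have "summable (\<lambda>n. antiderivative_coeffs a n * \<zeta> ^ n)"
      by (rule summable_norm_cancel) (use g that in \<open>simp add: norm_monomial_on_circle\<close>)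
    from sums_diff[OF summable_sums[OF this] hs[of \<zeta>]] show ?thesis
      by (simp add: b_def G_def left_diff_distrib sums_iff algebra_simps)
  qed
  have "((\<lambda>t. G (cis t) - D * cis t) has_vector_derivative (\<i> * cis t0 * D - D * (\<i> * cis t0))) (at t0)"
  proof -
    have "((\<lambda>z. D * exp (\<i> * z)) has_field_derivative D * (\<i> * exp (\<i> * of_real t0))) (at (of_real t0))"
      by (auto intro!: derivative_eq_intros)
    from has_vector_derivative_real_field[OF this, of UNIV]
    have "((\<lambda>t. D * cis t) has_vector_derivative D * (\<i> * cis t0)) (at t0)" by (simp add: cis_conv_exp)
    then show ?thesis using der unfolding G_def by (intro has_vector_derivative_diff)
  qed
  then have "((\<lambda>t. G (cis t) - D * cis t) has_derivative (\<lambda>_. 0)) (at t0)"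
    by (simp add: has_vector_derivative_def)
  then have flat: "\<exists>d>0. \<forall>t. \<bar>t - t0\<bar> < d \<longrightarrow> cmod (G (cis t) - G (cis t0) - D * (cis t - cis t0)) \<le> e * \<bar>t - t0\<bar>"
    if "e > 0" for e
    using that unfolding has_derivative_at_alt by (fastforce simp: algebra_simps)
  have "((\<lambda>r. \<Sum>n. of_nat n * b n * (of_real r * cis t0) ^ n) \<longlongrightarrow> 0) (at_left (1::real))"
  proof (rule antiderivative_small_imp_radial_limit[OF b])
    fix e :: real assume e: "e > 0"
    obtain d1 where d1: "d1 > 0"
      "\<And>t. \<bar>t - t0\<bar> < d1 \<Longrightarrow> cmod (G (cis t) - G (cis t0) - D * (cis t - cis t0)) \<le> e / 2 * \<bar>t - t0\<bar>"
      using flat[of "e / 2"] e by auto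
    obtain d2 where d2: "d2 > 0"
      "\<And>\<zeta>. cmod \<zeta> = 1 \<Longrightarrow> cmod (\<zeta> - cis t0) < d2 \<Longrightarrow> \<exists>t. \<zeta> = cis t \<and> \<bar>t - t0\<bar> \<le> 2 * cmod (\<zeta> - cis t0)"
      using arc_parameter_near[of t0] by blast
    show "\<exists>\<delta>>0. \<forall>\<zeta>. cmod \<zeta> = 1 \<and> cmod (\<zeta> - cis t0) < \<delta> \<longrightarrow>
          cmod (\<Sum>n. b n * \<zeta> ^ n) \<le> e * cmod (\<zeta> - cis t0)"
    proof (intro exI[of _ "min d2 (d1 / 2)"] conjI allI impI)
      fix \<zeta> assume \<zeta>: "cmod \<zeta> = 1 \<and> cmod (\<zeta> - cis t0) < min d2 (d1 / 2)"
      then obtain t where t: "\<zeta> = cis t" "\<bar>t - t0\<bar> \<le> 2 * cmod (\<zeta> - cis t0)" using d2(2) by auto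
      have "cmod (\<Sum>n. b n * \<zeta> ^ n) \<le> e / 2 * \<bar>t - t0\<bar>"
        using d1(2)[of t] t \<zeta> by (simp add: B)
      also have "\<dots> \<le> e / 2 * (2 * cmod (\<zeta> - cis t0))" using t(2) e by (intro mult_left_mono) auto
      finally show "cmod (\<Sum>n. b n * \<zeta> ^ n) \<le> e * cmod (\<zeta> - cis t0)" by simp
    qed (use d1 d2 in auto)
  qed simp
  then have "((\<lambda>r. (\<Sum>n. of_nat n * b n * (of_real r * cis t0) ^ n) / (of_real r * cis t0) + D) \<longlongrightarrow> 0 / (of_real 1 * cis t0) + D) (at_left (1::real))"
    by (intro tendsto_intros) auto
  then have "((\<lambda>r. (\<Sum>n. of_nat n * b n * (of_real r * cis t0) ^ n) / (of_real r * cis t0) + D) \<longlongrightarrow> D) (at_left (1::real))"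
    by simp
  then show ?thesis
  proof (rule Lim_transform_eventually)
    have "\<forall>\<^sub>F r in at_left (1::real). r \<in> {0<..<1}" by (rule eventually_at_left_real) simp
    then show "\<forall>\<^sub>F r in at_left (1::real). (\<Sum>n. of_nat n * b n * (of_real r * cis t0) ^ n) / (of_real r * cis t0) + D
        = disc_series a (of_real r * cis t0)"
    proof eventually_elim
      case (elim r)
      define z where "z = of_real r * cis t0"
      have z: "cmod z < 1" "z \<noteq> 0" using elim by (auto simp: z_def norm_mult)
      have "(\<lambda>n. (a n - (if n = 0 then D else 0)) * z ^ n) sums (disc_series a z - D)"
        using sums_diff[OF disc_series_sums[OF a z(1)] sums_single[of 0 "\<lambda>_. D"]]
        by (rule back_subst[of "\<lambda>f. f sums _"]) (auto simp: fun_eq_iff algebra_simps)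
      from sums_mult[OF this, of z]
      have "(\<lambda>n. of_nat (Suc n) * b (Suc n) * z ^ Suc n) sums (z * (disc_series a z - D))"
        by (rule back_subst[of "\<lambda>f. f sums _"])
           (auto simp: fun_eq_iff b_def h_def antiderivative_coeffs_def algebra_simps simp del: of_nat_Suc)
      then have "(\<lambda>n. of_nat n * b n * z ^ n) sums (z * (disc_series a z - D))"
        by (subst (asm) sums_Suc_iff) simp
      then show ?case using z by (simp add: sums_iff z_def[symmetric])
    qed
  qed
qed

lemma boundary_eqI:
  assumes "((\<lambda>r. f (of_real r * \<zeta>)) \<longlongrightarrow> L) (at_left (1::real))"
  shows "boundary f \<zeta> = L"
  unfolding boundary_def by (rule tendsto_Lim[OF _ assms]) simp

lemma disc_series_continuous:
  "square_summable a \<Longrightarrow> continuous_on (ball 0 1) (disc_series a)"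
  by (intro holomorphic_on_imp_continuous_on disc_series_holomorphic)

lemma boundary_disc_series_measurable:
  assumes "square_summable a"
  shows "boundary (disc_series a) \<in> borel_measurable borel"
  by (rule radial_limit_measurable(2)[OF disc_series_continuous[OF assms] disc_series_outside])

text \<open>
  By the Lebesgue differentiation theorem the antiderivative has derivative i \<zeta>
  \<phi>(\<zeta>) along the circle at almost every point, where \<phi> is the limit in the mean
  of a subsequence of the partial sums. At each such point the radial limit exists and equals
  \<phi>(\<zeta>), so that \<phi> may be replaced by the boundary function.
\<close>

lemma fatou_riesz_fischer:
  assumes a: "square_summable a"
  obtains N :: "nat \<Rightarrow> nat"
  where "AE \<zeta> in circle_measure.
      ((\<lambda>r. disc_series a (of_real r * \<zeta>)) \<longlongrightarrow> boundary (disc_series a) \<zeta>) (at_left (1::real))"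
    "integrable circle_measure (boundary (disc_series a))"
    "integrable circle_measure (\<lambda>\<zeta>. (cmod (boundary (disc_series a) \<zeta>))\<^sup>2)"
    "(\<integral>\<zeta>. (cmod (boundary (disc_series a) \<zeta>))\<^sup>2 \<partial>circle_measure) \<le> (\<Sum>n. (cmod (a n))\<^sup>2)"
    "strict_mono N"
    "(\<lambda>k. \<integral>\<zeta>. cmod ((\<Sum>n<N k. a n * \<zeta> ^ n) - boundary (disc_series a) \<zeta>) \<partial>circle_measure) \<longlonglongrightarrow> 0"
proof -
  let ?f = "disc_series a"
  note [measurable] = boundary_disc_series_measurable[OF a]
  obtain \<phi> :: "complex \<Rightarrow> complex" and N :: "nat \<Rightarrow> nat" where \<phi>m [measurable]: "\<phi> \<in> borel_measurable borel"
    and \<phi>1: "integrable circle_measure \<phi>" and \<phi>2: "integrable circle_measure (\<lambda>\<zeta>. (cmod (\<phi> \<zeta>))\<^sup>2)"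
    and \<phi>le: "(\<integral>\<zeta>. (cmod (\<phi> \<zeta>))\<^sup>2 \<partial>circle_measure) \<le> (\<Sum>n. (cmod (a n))\<^sup>2)"
    and N: "strict_mono N"
    and L1: "(\<lambda>k. \<integral>\<zeta>. cmod ((\<Sum>n<N k. a n * \<zeta> ^ n) - \<phi> \<zeta>) \<partial>circle_measure) \<longlonglongrightarrow> 0"
    by (rule riesz_fischer_circle[OF a])
  define \<psi> where "\<psi> s = indicator {0..<2*pi} s *\<^sub>R (\<i> * cis s * \<phi> (cis s))" for s :: real
  have "integrable lborel (\<lambda>x. indicator {0..<2*pi} x *\<^sub>R \<phi> (cis x))"
    using \<phi>1 by (subst (asm) integrable_circle_measure_iff) auto
  then have "integrable lborel \<psi>"
    unfolding \<psi>_def by (rule Bochner_Integration.integrable_bound) (auto simp: norm_mult)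
  then obtain E where E: "negligible E"
    "\<And>x. x \<notin> E \<Longrightarrow> 0 < x \<Longrightarrow> ((\<lambda>t. integral {0..t} \<psi>) has_vector_derivative \<psi> x) (at x)"
    by (rule integral_has_vector_derivative_AE) blast
  have rad: "((\<lambda>r. ?f (of_real r * cis t)) \<longlongrightarrow> \<phi> (cis t)) (at_left (1::real))"
    if t: "t \<notin> E" "0 < t" "t < 2 * pi" for t
  proof (rule arc_derivative_imp_radial_limit[OF a])
    have "((\<lambda>t. (\<Sum>n. antiderivative_coeffs a n) + integral {0..t} \<psi>) has_vector_derivative 0 + \<psi> t) (at t)"
      using E(2)[OF t(1,2)] by (intro has_vector_derivative_add has_vector_derivative_const)
    then have "((\<lambda>t. (\<Sum>n. antiderivative_coeffs a n) + integral {0..t} \<psi>) has_vector_derivative \<i> * cis t * \<phi> (cis t)) (at t)"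
      using t by (simp add: \<psi>_def)
    then show "((\<lambda>t. \<Sum>n. antiderivative_coeffs a n * cis t ^ n) has_vector_derivative \<i> * cis t * \<phi> (cis t)) (at t)"
    proof (rule has_vector_derivative_transform_within_open)
      show "open {0<..<2*pi}" "t \<in> {0<..<2*pi}" using t by auto
      show "(\<Sum>n. antiderivative_coeffs a n) + integral {0..s} \<psi> = (\<Sum>n. antiderivative_coeffs a n * cis s ^ n)"
        if "s \<in> {0<..<2*pi}" for s
        using antiderivative_is_indefinite_integral[OF a N \<phi>m \<phi>1 L1, of s] that
        by (simp add: \<psi>_def[abs_def] algebra_simps)
    qed
  qed
  \<comment> \<open>Phrased through the existence of the limit and a measurable equation, the good set is Borel.\<close>
  define P where "P \<zeta> \<longleftrightarrow> (\<exists>L. ((\<lambda>r. ?f (of_real r * \<zeta>)) \<longlongrightarrow> L) (at_left (1::real))) \<and> boundary ?f \<zeta> = \<phi> \<zeta>" for \<zeta>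
  have "{\<zeta>. P \<zeta>} \<in> sets borel"
  proof -
    have "{\<zeta>. \<exists>L. ((\<lambda>r. ?f (of_real r * \<zeta>)) \<longlongrightarrow> L) (at_left (1::real))} \<in> sets borel"
      by (rule radial_limit_measurable(1)[OF disc_series_continuous[OF a] disc_series_outside])
    moreover have "{\<zeta> \<in> space borel. boundary ?f \<zeta> = \<phi> \<zeta>} \<in> sets borel" by measurable
    ultimately have "{\<zeta>. \<exists>L. ((\<lambda>r. ?f (of_real r * \<zeta>)) \<longlongrightarrow> L) (at_left (1::real))} \<inter> {\<zeta> \<in> space borel. boundary ?f \<zeta> = \<phi> \<zeta>} \<in> sets borel"
      by (rule sets.Int)
    also have "{\<zeta>. \<exists>L. ((\<lambda>r. ?f (of_real r * \<zeta>)) \<longlongrightarrow> L) (at_left (1::real))} \<inter> {\<zeta> \<in> space borel. boundary ?f \<zeta> = \<phi> \<zeta>} = {\<zeta>. P \<zeta>}"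
      by (auto simp: P_def)
    finally show ?thesis .
  qed
  moreover have "AE t in lborel. t \<in> {0..<2*pi} \<longrightarrow> P (cis t)"
  proof -
    have "AE t in lebesgue. t \<notin> E" using E(1) by (simp add: negligible_iff_null_sets AE_not_in)
    then have "AE t in lborel. t \<notin> E" by (simp add: AE_completion_iff)
    moreover have "AE t in lborel. t \<noteq> (0::real)" by (rule AE_lborel_singleton)
    ultimately show ?thesis
    proof eventually_elim
      case (elim t)
      show ?case
      proof
        assume "t \<in> {0..<2*pi}"
        then have "((\<lambda>r. ?f (of_real r * cis t)) \<longlongrightarrow> \<phi> (cis t)) (at_left (1::real))"
          using elim by (intro rad) auto
        then show "P (cis t)" unfolding P_def using boundary_eqI by blast
      qed
    qed
  qed
  ultimately have AEP: "AE \<zeta> in circle_measure. P \<zeta>" by (subst AE_circle_measure_iff)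
  then have ae: "AE \<zeta> in circle_measure. \<phi> \<zeta> = boundary ?f \<zeta>" by eventually_elim (simp add: P_def)
  have "AE \<zeta> in circle_measure. ((\<lambda>r. ?f (of_real r * \<zeta>)) \<longlongrightarrow> boundary ?f \<zeta>) (at_left (1::real))"
    using AEP
  proof eventually_elim
    case (elim \<zeta>)
    then obtain L where "((\<lambda>r. ?f (of_real r * \<zeta>)) \<longlongrightarrow> L) (at_left (1::real))"
      by (auto simp: P_def)
    then show ?case using boundary_eqI by metis
  qed
  moreover have "integrable circle_measure (boundary ?f)"
    by (rule integrable_cong_AE_imp[OF \<phi>1 _ ae]) simp
  moreover have "integrable circle_measure (\<lambda>\<zeta>. (cmod (boundary ?f \<zeta>))\<^sup>2)"
    by (rule integrable_cong_AE_imp[OF \<phi>2]) (use ae in auto)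
  moreover have "(\<integral>\<zeta>. (cmod (boundary ?f \<zeta>))\<^sup>2 \<partial>circle_measure) = (\<integral>\<zeta>. (cmod (\<phi> \<zeta>))\<^sup>2 \<partial>circle_measure)"
    by (rule integral_cong_AE) (use ae in auto)
  moreover have "(\<integral>\<zeta>. cmod ((\<Sum>n<N k. a n * \<zeta> ^ n) - boundary ?f \<zeta>) \<partial>circle_measure)
      = (\<integral>\<zeta>. cmod ((\<Sum>n<N k. a n * \<zeta> ^ n) - \<phi> \<zeta>) \<partial>circle_measure)" for k
    by (rule integral_cong_AE) (use ae in auto)
  ultimately show ?thesis using that N \<phi>le L1 by simp
qed

lemma H2_boundary_measurable:
  assumes "f \<in> H2"
  shows "boundary f \<in> borel_measurable borel"
  using assms boundary_disc_series_measurable by (elim H2_disc_series) simp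

lemma H2_radial_limit:
  assumes "f \<in> H2"
  shows "AE \<zeta> in circle_measure. ((\<lambda>r. f (of_real r * \<zeta>)) \<longlongrightarrow> boundary f \<zeta>) (at_left (1::real))"
  using assms by (elim H2_disc_series) (auto elim: fatou_riesz_fischer)

lemma H2_boundary_square_integrable:
  assumes "f \<in> H2"
  shows "integrable circle_measure (\<lambda>\<zeta>. (cmod (boundary f \<zeta>))\<^sup>2)"
  using assms by (elim H2_disc_series) (auto elim: fatou_riesz_fischer)

lemma boundary_norm_le:
  assumes "square_summable a"
  shows "(\<integral>\<zeta>. (cmod (boundary (disc_series a) \<zeta>))\<^sup>2 \<partial>circle_measure) \<le> (\<Sum>n. (cmod (a n))\<^sup>2)"
  using assms by (rule fatou_riesz_fischer)

section \<open>Square integrable functions and the Riesz projection\<close>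

definition fourier_coeff :: "(complex \<Rightarrow> complex) \<Rightarrow> nat \<Rightarrow> complex" where
  "fourier_coeff h n = circle_inner h (\<lambda>\<zeta>. \<zeta> ^ n)"

text \<open>
  Convergence in the mean preserves Fourier coefficients, and the m-th coefficient of a partial
  sum is a m as soon as the sum contains the term of order m.
\<close>

lemma fourier_coeff_boundary:
  assumes a: "square_summable a"
  shows "fourier_coeff (boundary (disc_series a)) m = a m"
proof -
  let ?\<phi> = "boundary (disc_series a)"
  note [measurable] = boundary_disc_series_measurable[OF a]
  obtain N where N: "strict_mono N" and \<phi>: "integrable circle_measure ?\<phi>"
    and L1: "(\<lambda>k. \<integral>\<zeta>. cmod ((\<Sum>n<N k. a n * \<zeta> ^ n) - ?\<phi> \<zeta>) \<partial>circle_measure) \<longlonglongrightarrow> 0"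
    by (rule fatou_riesz_fischer[OF a])
  have mono: "integrable circle_measure (\<lambda>\<zeta>. g \<zeta> * cnj (\<zeta> ^ m))"
    if "integrable circle_measure g" for g :: "complex \<Rightarrow> complex"
  proof (rule Bochner_Integration.integrable_bound[OF that])
    show "AE \<zeta> in circle_measure. norm (g \<zeta> * cnj (\<zeta> ^ m)) \<le> norm (g \<zeta>)"
      using AE_circle_norm by eventually_elim (simp add: norm_mult norm_power)
    show "(\<lambda>\<zeta>. g \<zeta> * cnj (\<zeta> ^ m)) \<in> borel_measurable circle_measure"
      using borel_measurable_integrable[OF that] by measurable
  qed
  define s where "s k \<zeta> = (\<Sum>n<N k. a n * \<zeta> ^ n)" for k \<zeta>
  have sm [measurable]: "s k \<in> borel_measurable borel" for k
    unfolding s_def by measurable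
  have sint: "integrable circle_measure (s k)" for k
    by (rule integrable_norm_cancel)
       (use integrable_trig_poly[of a "{..<N k}" 1] in \<open>simp_all add: s_def\<close>)
  have "(\<lambda>k. (\<integral>\<zeta>. s k \<zeta> * cnj (\<zeta> ^ m) \<partial>circle_measure) - (\<integral>\<zeta>. ?\<phi> \<zeta> * cnj (\<zeta> ^ m) \<partial>circle_measure)) \<longlonglongrightarrow> 0"
  proof (rule Lim_null_comparison[OF _ L1[folded s_def]], intro always_eventually allI)
    fix k
    have d: "integrable circle_measure (\<lambda>\<zeta>. s k \<zeta> - ?\<phi> \<zeta>)" using sint \<phi> by simp
    have "(\<integral>\<zeta>. s k \<zeta> * cnj (\<zeta> ^ m) \<partial>circle_measure) - (\<integral>\<zeta>. ?\<phi> \<zeta> * cnj (\<zeta> ^ m) \<partial>circle_measure)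
        = (\<integral>\<zeta>. (s k \<zeta> - ?\<phi> \<zeta>) * cnj (\<zeta> ^ m) \<partial>circle_measure)"
      unfolding left_diff_distrib by (rule Bochner_Integration.integral_diff[symmetric, OF mono[OF sint] mono[OF \<phi>]])
    also have "cmod \<dots> \<le> (\<integral>\<zeta>. cmod ((s k \<zeta> - ?\<phi> \<zeta>) * cnj (\<zeta> ^ m)) \<partial>circle_measure)"
      by (rule integral_norm_bound)
    also have "\<dots> \<le> (\<integral>\<zeta>. cmod (s k \<zeta> - ?\<phi> \<zeta>) \<partial>circle_measure)"
    proof (rule integral_mono_AE)
      show "AE \<zeta> in circle_measure. cmod ((s k \<zeta> - ?\<phi> \<zeta>) * cnj (\<zeta> ^ m)) \<le> cmod (s k \<zeta> - ?\<phi> \<zeta>)"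
        using AE_circle_norm by eventually_elim (simp add: norm_mult norm_power)
    qed (use d mono[OF d] in \<open>auto intro!: integrable_norm simp del: complex_cnj_power\<close>)
    finally show "norm ((\<integral>\<zeta>. s k \<zeta> * cnj (\<zeta> ^ m) \<partial>circle_measure) - (\<integral>\<zeta>. ?\<phi> \<zeta> * cnj (\<zeta> ^ m) \<partial>circle_measure))
        \<le> (\<integral>\<zeta>. cmod (s k \<zeta> - ?\<phi> \<zeta>) \<partial>circle_measure)" .
  qed
  moreover have "\<forall>\<^sub>F k in sequentially. (\<integral>\<zeta>. s k \<zeta> * cnj (\<zeta> ^ m) \<partial>circle_measure) = a m"
  proof (rule eventually_sequentiallyI[of "Suc m"])
    fix k assume "Suc m \<le> k"
    also have "k \<le> N k" by (rule strict_mono_imp_increasing[OF N])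
    finally have m: "m < N k" by simp
    define b where "b n = (if n < N k then a n else 0)" for n
    have "(\<integral>\<zeta>. (\<Sum>n. b n * \<zeta> ^ n) * cnj (\<zeta> ^ m) \<partial>circle_measure) = b m"
      by (rule circle_series_coefficient[OF summable_finite[of "{..<N k}"]]) (auto simp: b_def)
    moreover have "(\<Sum>n. b n * \<zeta> ^ n) = s k \<zeta>" for \<zeta>
      by (subst suminf_finite[of "{..<N k}"]) (auto simp: b_def s_def)
    ultimately show "(\<integral>\<zeta>. s k \<zeta> * cnj (\<zeta> ^ m) \<partial>circle_measure) = a m" using m by (simp add: b_def)
  qed
  ultimately have "(\<lambda>k. a m - (\<integral>\<zeta>. ?\<phi> \<zeta> * cnj (\<zeta> ^ m) \<partial>circle_measure)) \<longlonglongrightarrow> 0"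
    by (rule Lim_transform_eventually[OF _ eventually_mono]) auto
  then show ?thesis
    by (simp add: fourier_coeff_def circle_inner_def LIMSEQ_const_iff del: complex_cnj_power)
qed

definition square_integrable :: "(complex \<Rightarrow> complex) \<Rightarrow> bool" where
  "square_integrable h \<longleftrightarrow> h \<in> borel_measurable borel \<and> integrable circle_measure (\<lambda>\<zeta>. (cmod (h \<zeta>))\<^sup>2)"

lemma square_integrable_measurable: "square_integrable h \<Longrightarrow> h \<in> borel_measurable borel"
  by (simp add: square_integrable_def)

lemma square_integrable_boundary: "f \<in> H2 \<Longrightarrow> square_integrable (boundary f)"
  by (simp add: square_integrable_def H2_boundary_measurable H2_boundary_square_integrable)

lemma square_integrable_power: "square_integrable (\<lambda>\<zeta>. \<zeta> ^ n)"
proof -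
  have "integrable circle_measure (\<lambda>\<zeta>. (cmod (\<zeta> ^ n))\<^sup>2)"
    by (rule circle.integrable_const_bound[where B = 1])
       (use AE_circle_norm in \<open>auto simp: norm_power\<close>)
  then show ?thesis by (simp add: square_integrable_def)
qed

lemma square_integrable_scale: "square_integrable h \<Longrightarrow> square_integrable (\<lambda>\<zeta>. c * h \<zeta>)"
  by (auto simp: square_integrable_def norm_mult power_mult_distrib)

lemma square_integrable_add:
  assumes "square_integrable h" "square_integrable k"
  shows "square_integrable (\<lambda>\<zeta>. h \<zeta> + k \<zeta>)"
proof -
  note [measurable] = assms[THEN square_integrable_measurable]
  have "integrable circle_measure (\<lambda>\<zeta>. 2 * (cmod (h \<zeta>))\<^sup>2 + 2 * (cmod (k \<zeta>))\<^sup>2)"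
    using assms by (simp add: square_integrable_def)
  then have "integrable circle_measure (\<lambda>\<zeta>. (cmod (h \<zeta> + k \<zeta>))\<^sup>2)"
  proof (rule Bochner_Integration.integrable_bound)
    have "norm ((cmod (x + y))\<^sup>2) \<le> norm (2 * (cmod x)\<^sup>2 + 2 * (cmod y)\<^sup>2)" for x y
    proof -
      have "(cmod (x + y))\<^sup>2 \<le> (cmod x + cmod y)\<^sup>2"
        by (intro power_mono norm_triangle_ineq) simp
      also have "\<dots> \<le> (cmod x + cmod y)\<^sup>2 + (cmod x - cmod y)\<^sup>2" by simp
      also have "\<dots> = 2 * (cmod x)\<^sup>2 + 2 * (cmod y)\<^sup>2"
        by (simp add: power2_eq_square algebra_simps)
      finally show ?thesis by simp
    qed
    then show "AE \<zeta> in circle_measure. norm ((cmod (h \<zeta> + k \<zeta>))\<^sup>2) \<le> norm (2 * (cmod (h \<zeta>))\<^sup>2 + 2 * (cmod (k \<zeta>))\<^sup>2)"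
      by blast
  qed measurable
  then show ?thesis by (simp add: square_integrable_def)
qed

lemma square_integrable_diff:
  assumes "square_integrable h" "square_integrable k"
  shows "square_integrable (\<lambda>\<zeta>. h \<zeta> - k \<zeta>)"
  using square_integrable_add[OF assms(1) square_integrable_scale[OF assms(2), of "-1"]] by simp

lemma square_integrable_sum:
  assumes "finite A" "\<And>i. i \<in> A \<Longrightarrow> square_integrable (h i)"
  shows "square_integrable (\<lambda>\<zeta>. \<Sum>i\<in>A. h i \<zeta>)"
  using assms
proof (induction A)
  case empty
  then show ?case by (simp add: square_integrable_def)
qed (simp add: square_integrable_add)

lemma square_integrable_product:
  assumes "square_integrable h" "square_integrable k"
  shows "integrable circle_measure (\<lambda>\<zeta>. h \<zeta> * cnj (k \<zeta>))"
proof -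
  note [measurable] = assms[THEN square_integrable_measurable]
  have "integrable circle_measure (\<lambda>\<zeta>. (cmod (h \<zeta>))\<^sup>2 + (cmod (k \<zeta>))\<^sup>2)"
    using assms by (simp add: square_integrable_def)
  then show ?thesis
  proof (rule Bochner_Integration.integrable_bound)
    have "norm (x * cnj y) \<le> norm ((cmod x)\<^sup>2 + (cmod y)\<^sup>2)" for x y
    proof -
      have "0 \<le> (cmod x - cmod y)\<^sup>2 + cmod x * cmod y" by simp
      then show ?thesis by (simp add: norm_mult power2_eq_square algebra_simps)
    qed
    then show "AE \<zeta> in circle_measure. norm (h \<zeta> * cnj (k \<zeta>)) \<le> norm ((cmod (h \<zeta>))\<^sup>2 + (cmod (k \<zeta>))\<^sup>2)"
      by blast
  qed measurable
qed

lemma square_integrable_AE_eq: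
  assumes "square_integrable h" "k \<in> borel_measurable borel"
    "AE \<zeta> in circle_measure. cmod (h \<zeta>) = cmod (k \<zeta>)"
  shows "square_integrable k"
proof -
  note [measurable] = assms(2)
  have "integrable circle_measure (\<lambda>\<zeta>. (cmod (k \<zeta>))\<^sup>2)"
    by (rule integrable_cong_AE_imp[of _ "\<lambda>\<zeta>. (cmod (h \<zeta>))\<^sup>2"])
       (use assms in \<open>auto simp: square_integrable_def\<close>)
  then show ?thesis using assms(2) by (simp add: square_integrable_def)
qed

lemma circle_inner_cong:
  assumes "AE \<zeta> in circle_measure. h \<zeta> = h' \<zeta>" "AE \<zeta> in circle_measure. k \<zeta> = k' \<zeta>"
    "h \<in> borel_measurable borel" "h' \<in> borel_measurable borel"
    "k \<in> borel_measurable borel" "k' \<in> borel_measurable borel"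
  shows "circle_inner h k = circle_inner h' k'"
proof -
  note [measurable] = assms(3-6)
  show ?thesis
    unfolding circle_inner_def
  proof (rule integral_cong_AE)
    show "AE \<zeta> in circle_measure. h \<zeta> * cnj (k \<zeta>) = h' \<zeta> * cnj (k' \<zeta>)"
      using assms(1,2) by eventually_elim simp
  qed measurable
qed

lemma circle_inner_add:
  assumes "square_integrable h" "square_integrable h'" "square_integrable k"
  shows "circle_inner (\<lambda>\<zeta>. h \<zeta> + h' \<zeta>) k = circle_inner h k + circle_inner h' k"
  unfolding circle_inner_def distrib_right
  by (rule Bochner_Integration.integral_add) (intro square_integrable_product assms)+

lemma circle_inner_diff:
  assumes "square_integrable h" "square_integrable h'" "square_integrable k"
  shows "circle_inner (\<lambda>\<zeta>. h \<zeta> - h' \<zeta>) k = circle_inner h k - circle_inner h' k"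
  unfolding circle_inner_def left_diff_distrib
  by (rule Bochner_Integration.integral_diff) (intro square_integrable_product assms)+

lemma circle_inner_add_right:
  assumes "square_integrable h" "square_integrable k" "square_integrable k'"
  shows "circle_inner h (\<lambda>\<zeta>. k \<zeta> + k' \<zeta>) = circle_inner h k + circle_inner h k'"
  unfolding circle_inner_def complex_cnj_add distrib_left
  by (rule Bochner_Integration.integral_add) (intro square_integrable_product assms)+

lemma circle_inner_scale: "circle_inner (\<lambda>\<zeta>. c * h \<zeta>) k = c * circle_inner h k"
  by (simp add: circle_inner_def mult.assoc)

lemma circle_inner_trig_poly:
  assumes "square_integrable h" "finite A"
  shows "circle_inner h (\<lambda>\<zeta>. \<Sum>n\<in>A. b n * \<zeta> ^ n) = (\<Sum>n\<in>A. cnj (b n) * fourier_coeff h n)"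
proof -
  have i: "integrable circle_measure (\<lambda>\<zeta>. cnj (b n) * (h \<zeta> * cnj (\<zeta> ^ n)))" for n
    by (intro integrable_mult_right square_integrable_product assms square_integrable_power)
  have "circle_inner h (\<lambda>\<zeta>. \<Sum>n\<in>A. b n * \<zeta> ^ n) = (\<integral>\<zeta>. (\<Sum>n\<in>A. cnj (b n) * (h \<zeta> * cnj (\<zeta> ^ n))) \<partial>circle_measure)"
    unfolding circle_inner_def by (simp add: sum_distrib_left mult_ac)
  also have "\<dots> = (\<Sum>n\<in>A. \<integral>\<zeta>. cnj (b n) * (h \<zeta> * cnj (\<zeta> ^ n)) \<partial>circle_measure)"
    by (rule Bochner_Integration.integral_sum) (rule i)
  also have "\<dots> = (\<Sum>n\<in>A. cnj (b n) * fourier_coeff h n)"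
    by (simp add: fourier_coeff_def circle_inner_def del: complex_cnj_power)
  finally show ?thesis .
qed

text \<open>
  Bessel's inequality: expand the nonnegative square norm of h - s, where s is the Fourier
  polynomial of h.
\<close>

lemma square_summable_fourier_coeff:
  assumes h: "square_integrable h"
  shows "square_summable (fourier_coeff h)"
proof (rule bounded_imp_summable)
  note [measurable] = square_integrable_measurable[OF h]
  fix m
  define s where "s \<zeta> = (\<Sum>n\<le>m. fourier_coeff h n * \<zeta> ^ n)" for \<zeta>
  define S where "S = (\<Sum>n\<le>m. (cmod (fourier_coeff h n))\<^sup>2)"
  have s: "square_integrable s"
    unfolding s_def by (intro square_integrable_sum square_integrable_scale square_integrable_power) simp
  have hs: "circle_inner h s = of_real S"
    unfolding s_def circle_inner_trig_poly[OF h finite_atMost] S_def of_real_sum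
    by (intro sum.cong refl) (simp only: complex_norm_square mult.commute)
  have ss: "(\<integral>\<zeta>. (cmod (s \<zeta>))\<^sup>2 \<partial>circle_measure) = S"
    unfolding s_def S_def by (rule circle_norm_trig_poly) simp
  have i1: "integrable circle_measure (\<lambda>\<zeta>. (cmod (h \<zeta>))\<^sup>2)" and i2: "integrable circle_measure (\<lambda>\<zeta>. (cmod (s \<zeta>))\<^sup>2)"
    using h s by (auto simp: square_integrable_def)
  have i3: "integrable circle_measure (\<lambda>\<zeta>. h \<zeta> * cnj (s \<zeta>))" by (rule square_integrable_product[OF h s])
  define q where "q \<zeta> = Re (h \<zeta> * cnj (s \<zeta>))" for \<zeta>
  have q: "integrable circle_measure q" "(\<integral>\<zeta>. q \<zeta> \<partial>circle_measure) = S"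
    using integrable_Re[OF i3] integral_Re[OF i3] hs by (simp_all add: q_def[abs_def] circle_inner_def)
  have "0 \<le> (\<integral>\<zeta>. (cmod (h \<zeta>))\<^sup>2 - 2 * q \<zeta> + (cmod (s \<zeta>))\<^sup>2 \<partial>circle_measure)"
  proof (rule Bochner_Integration.integral_nonneg)
    fix \<zeta>
    have "(cmod (h \<zeta>))\<^sup>2 - 2 * q \<zeta> + (cmod (s \<zeta>))\<^sup>2 = (cmod (h \<zeta> - s \<zeta>))\<^sup>2"
      unfolding cmod_power2 q_def by (simp add: power2_eq_square algebra_simps)
    then show "0 \<le> (cmod (h \<zeta>))\<^sup>2 - 2 * q \<zeta> + (cmod (s \<zeta>))\<^sup>2" by simp
  qed
  also have "\<dots> = (\<integral>\<zeta>. (cmod (h \<zeta>))\<^sup>2 \<partial>circle_measure) - 2 * S + S"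
    using i1 i2 q ss by simp
  finally show "(\<Sum>n\<le>m. (cmod (fourier_coeff h n))\<^sup>2) \<le> (\<integral>\<zeta>. (cmod (h \<zeta>))\<^sup>2 \<partial>circle_measure)"
    by (simp add: S_def)
qed simp

lemma H2_boundary_add:
  assumes "f \<in> H2" "g \<in> H2"
  shows "AE \<zeta> in circle_measure. boundary (f + g) \<zeta> = boundary f \<zeta> + boundary g \<zeta>"
  using H2_radial_limit[OF assms(1)] H2_radial_limit[OF assms(2)]
  by eventually_elim (auto intro!: boundary_eqI tendsto_add)

lemma H2_boundary_scale:
  assumes "f \<in> H2"
  shows "AE \<zeta> in circle_measure. boundary (cscale c f) \<zeta> = c * boundary f \<zeta>"
  using H2_radial_limit[OF assms]
  by eventually_elim (auto intro!: boundary_eqI tendsto_mult simp: cscale_def)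

lemma boundary_polynomial:
  assumes "finite A" "cmod \<zeta> = 1" "\<And>n. n \<notin> A \<Longrightarrow> b n = 0"
  shows "boundary (disc_series b) \<zeta> = (\<Sum>n\<in>A. b n * \<zeta> ^ n)"
proof (rule boundary_eqI)
  have "((\<lambda>r. \<Sum>n\<in>A. b n * (of_real r * \<zeta>) ^ n) \<longlongrightarrow> (\<Sum>n\<in>A. b n * (of_real 1 * \<zeta>) ^ n)) (at_left (1::real))"
    by (intro tendsto_intros)
  then have "((\<lambda>r. \<Sum>n\<in>A. b n * (of_real r * \<zeta>) ^ n) \<longlongrightarrow> (\<Sum>n\<in>A. b n * \<zeta> ^ n)) (at_left (1::real))" by simp
  then show "((\<lambda>r. disc_series b (of_real r * \<zeta>)) \<longlongrightarrow> (\<Sum>n\<in>A. b n * \<zeta> ^ n)) (at_left (1::real))"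
  proof (rule Lim_transform_eventually)
    have "\<forall>\<^sub>F r in at_left (1::real). r \<in> {0<..<1}" by (rule eventually_at_left_real) simp
    then show "\<forall>\<^sub>F r in at_left (1::real). (\<Sum>n\<in>A. b n * (of_real r * \<zeta>) ^ n) = disc_series b (of_real r * \<zeta>)"
    proof eventually_elim
      case (elim r)
      have "(\<Sum>n. b n * (of_real r * \<zeta>) ^ n) = (\<Sum>n\<in>A. b n * (of_real r * \<zeta>) ^ n)"
        by (rule suminf_finite) (use assms in auto)
      then show ?case using elim assms(2) by (simp add: disc_series_circle)
    qed
  qed
qed

text \<open>
  Vanishing Fourier coefficients give orthogonality to polynomials. A function in the Hardy
  space is a polynomial plus the series of its tail, and the boundary function of the tail has
  small square norm.
\<close>

lemma circle_inner_analytic_zero: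
  assumes g: "square_integrable g" and zero: "\<And>m. fourier_coeff g m = 0" and w: "w \<in> H2"
  shows "circle_inner g (boundary w) = 0"
proof -
  obtain b where b: "square_summable b" and wb: "w = disc_series b" by (rule H2_disc_series[OF w])
  define A where "A = (\<integral>\<zeta>. (cmod (g \<zeta>))\<^sup>2 \<partial>circle_measure)"
  have A0: "0 \<le> A" unfolding A_def by (rule Bochner_Integration.integral_nonneg) simp
  have "cmod (circle_inner g (boundary w)) \<le> e" if e: "e > 0" for e
  proof -
    \<comment> \<open>The weight for which both terms of the arithmetic-geometric mean estimate are at most e.\<close>
    define l where "l = e / (A + 1)"
    have l: "l > 0" using e A0 by (simp add: l_def)
    obtain N where N: "(\<Sum>n. (cmod (b (n + N)))\<^sup>2) < e * l"
    proof -
      have "(\<lambda>N. \<Sum>n. (cmod (b (n + N)))\<^sup>2) \<longlonglongrightarrow> 0" by (rule suminf_exist_split2[OF b])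
      then have "\<forall>\<^sub>F N in sequentially. (\<Sum>n. (cmod (b (n + N)))\<^sup>2) < e * l"
        using e l by (intro order_tendstoD(2)) auto
      then show ?thesis using that eventually_happens'[OF sequentially_bot] by blast
    qed
    define b1 b2 where "b1 n = (if n < N then b n else 0)" and "b2 n = (if n < N then 0 else b n)" for n
    have b1: "square_summable b1" by (rule summable_finite[of "{..<N}"]) (auto simp: b1_def)
    have b2: "square_summable b2"
      by (rule summable_comparison_test'[OF b, of 0]) (auto simp: b2_def)
    have "(\<lambda>n. b1 n + b2 n) = b" by (auto simp: b1_def b2_def)
    then have "w = disc_series b1 + disc_series b2"
      using disc_series_add[OF b1 b2] unfolding wb by simp
    then have split: "AE \<zeta> in circle_measure. boundary w \<zeta> = boundary (disc_series b1) \<zeta> + boundary (disc_series b2) \<zeta>"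
      using H2_boundary_add[OF disc_series_in_H2[OF b1] disc_series_in_H2[OF b2]] by simp
    define t where "t = boundary (disc_series b2)"
    define p where "p \<zeta> = (\<Sum>n<N. b1 n * \<zeta> ^ n)" for \<zeta>
    have t: "square_integrable t" unfolding t_def by (intro square_integrable_boundary disc_series_in_H2 b2)
    have p: "square_integrable p"
      unfolding p_def by (intro square_integrable_sum square_integrable_scale square_integrable_power) simp
    have "AE \<zeta> in circle_measure. boundary w \<zeta> = p \<zeta> + t \<zeta>"
      using split AE_circle_norm
    proof eventually_elim
      case (elim \<zeta>)
      have "boundary (disc_series b1) \<zeta> = (\<Sum>n\<in>{..<N}. b1 n * \<zeta> ^ n)"
        by (rule boundary_polynomial) (use elim in \<open>auto simp: b1_def\<close>)
      then show ?case using elim by (simp add: p_def t_def)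
    qed
    then have "circle_inner g (boundary w) = circle_inner g (\<lambda>\<zeta>. p \<zeta> + t \<zeta>)"
      using g p t H2_boundary_measurable[OF w]
      by (intro circle_inner_cong) (auto simp: square_integrable_def)
    also have "\<dots> = circle_inner g p + circle_inner g t" by (rule circle_inner_add_right[OF g p t])
    also have "circle_inner g p = 0"
      unfolding p_def circle_inner_trig_poly[OF g finite_lessThan] by (simp add: zero)
    finally have "cmod (circle_inner g (boundary w)) = cmod (circle_inner g t)" by simp
    also have "\<dots> \<le> (\<integral>\<zeta>. cmod (g \<zeta> * cnj (t \<zeta>)) \<partial>circle_measure)"
      unfolding circle_inner_def by (rule integral_norm_bound)
    also have "\<dots> \<le> (\<integral>\<zeta>. (l * (cmod (g \<zeta>))\<^sup>2 + (cmod (t \<zeta>))\<^sup>2 / l) / 2 \<partial>circle_measure)"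
    proof (rule integral_mono)
      show "integrable circle_measure (\<lambda>\<zeta>. cmod (g \<zeta> * cnj (t \<zeta>)))"
        by (intro integrable_norm square_integrable_product g t)
      show "integrable circle_measure (\<lambda>\<zeta>. (l * (cmod (g \<zeta>))\<^sup>2 + (cmod (t \<zeta>))\<^sup>2 / l) / 2)"
        using g t by (simp add: square_integrable_def)
      fix \<zeta>
      have "0 \<le> (l * cmod (g \<zeta>) - cmod (t \<zeta>))\<^sup>2 / l" using l by simp
      also have "(l * x - y)\<^sup>2 / l = l * x\<^sup>2 + y\<^sup>2 / l - 2 * (x * y)" for x y
      proof -
        have "(l * x - y)\<^sup>2 = l * (l * x\<^sup>2 - 2 * (x * y)) + y\<^sup>2"
          by (simp add: power2_eq_square algebra_simps)
        then show ?thesis using l by (simp add: add_divide_distrib)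
      qed
      finally show "cmod (g \<zeta> * cnj (t \<zeta>)) \<le> (l * (cmod (g \<zeta>))\<^sup>2 + (cmod (t \<zeta>))\<^sup>2 / l) / 2"
        by (simp add: norm_mult)
    qed
    also have "\<dots> = (l * A + (\<integral>\<zeta>. (cmod (t \<zeta>))\<^sup>2 \<partial>circle_measure) / l) / 2"
      using g t by (simp add: square_integrable_def A_def)
    also have "\<dots> \<le> (e + e) / 2"
    proof -
      have "l * (A + 1) = e" using A0 by (simp add: l_def)
      then have "l * A \<le> e" using l by (simp add: distrib_left)
      moreover have "(\<integral>\<zeta>. (cmod (t \<zeta>))\<^sup>2 \<partial>circle_measure) / l \<le> e"
      proof -
        have "(\<integral>\<zeta>. (cmod (t \<zeta>))\<^sup>2 \<partial>circle_measure) \<le> (\<Sum>n. (cmod (b2 n))\<^sup>2)"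
          unfolding t_def by (rule boundary_norm_le[OF b2])
        also have "\<dots> = (\<Sum>n. (cmod (b2 (n + N)))\<^sup>2)"
          using suminf_split_initial_segment[OF b2, of N] by (simp add: b2_def)
        also have "\<dots> \<le> e * l" using N by (simp add: b2_def)
        finally show ?thesis using l by (simp add: pos_divide_le_eq)
      qed
      ultimately show ?thesis by simp
    qed
    finally show ?thesis by simp
  qed
  then have "cmod (circle_inner g (boundary w)) \<le> 0 + e" if "e > 0" for e using that by simp
  then have "cmod (circle_inner g (boundary w)) \<le> 0" by (rule field_le_epsilon)
  then show ?thesis by simp
qed

text \<open>
  The projection discards the negative frequencies. This formula shows existence and uniqueness
  at once and makes the linearity of the projection evident.
\<close>

lemma riesz_projection_eq:
  assumes h: "square_integrable h"
  shows "riesz_projection h = disc_series (fourier_coeff h)"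
  unfolding riesz_projection_def
proof (rule the_equality)
  have c: "square_summable (fourier_coeff h)" by (rule square_summable_fourier_coeff[OF h])
  have k: "disc_series (fourier_coeff h) \<in> H2" by (rule disc_series_in_H2[OF c])
  have coeff: "fourier_coeff (\<lambda>\<zeta>. h \<zeta> - boundary (disc_series b) \<zeta>) m = fourier_coeff h m - b m"
    if "square_summable b" for b m
    using fourier_coeff_boundary[OF that, of m] unfolding fourier_coeff_def
    by (simp add: circle_inner_diff[OF h square_integrable_boundary[OF disc_series_in_H2[OF that]] square_integrable_power])
  show "disc_series (fourier_coeff h) \<in> H2 \<and>
    (\<forall>w\<in>H2. circle_inner (\<lambda>\<zeta>. h \<zeta> - boundary (disc_series (fourier_coeff h)) \<zeta>) (boundary w) = 0)"
  proof (intro conjI ballI k)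
    show "circle_inner (\<lambda>\<zeta>. h \<zeta> - boundary (disc_series (fourier_coeff h)) \<zeta>) (boundary w) = 0" if "w \<in> H2" for w
    proof (rule circle_inner_analytic_zero[OF _ _ that])
      show "square_integrable (\<lambda>\<zeta>. h \<zeta> - boundary (disc_series (fourier_coeff h)) \<zeta>)"
        by (rule square_integrable_diff[OF h square_integrable_boundary[OF k]])
    qed (simp add: coeff[OF c])
  qed
  fix f assume f: "f \<in> H2 \<and> (\<forall>w\<in>H2. circle_inner (\<lambda>\<zeta>. h \<zeta> - boundary f \<zeta>) (boundary w) = 0)"
  then have "f \<in> H2" by simp
  then obtain b where b: "square_summable b" and fb: "f = disc_series b" by (rule H2_disc_series)
  have "b m = fourier_coeff h m" for m
  proof -
    define e where "e n = (if n = m then 1 else 0 :: complex)" for n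
    have e: "square_summable e" by (rule summable_finite[of "{m}"]) (auto simp: e_def)
    have "0 = circle_inner (\<lambda>\<zeta>. h \<zeta> - boundary f \<zeta>) (boundary (disc_series e))"
      using f disc_series_in_H2[OF e] by auto
    also have "\<dots> = fourier_coeff (\<lambda>\<zeta>. h \<zeta> - boundary f \<zeta>) m"
      unfolding fourier_coeff_def
    proof (rule circle_inner_cong)
      show "AE \<zeta> in circle_measure. boundary (disc_series e) \<zeta> = \<zeta> ^ m"
        using AE_circle_norm
      proof eventually_elim
        case (elim \<zeta>)
        have "boundary (disc_series e) \<zeta> = (\<Sum>n\<in>{m}. e n * \<zeta> ^ n)"
          by (rule boundary_polynomial) (use elim in \<open>auto simp: e_def\<close>)
        then show ?case by (simp add: e_def)
      qed
      show "(\<lambda>\<zeta>. h \<zeta> - boundary f \<zeta>) \<in> borel_measurable borel"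
        using f by (intro square_integrable_measurable square_integrable_diff h square_integrable_boundary) simp
      then show "(\<lambda>\<zeta>. h \<zeta> - boundary f \<zeta>) \<in> borel_measurable borel" .
      show "boundary (disc_series e) \<in> borel_measurable borel"
        by (rule boundary_disc_series_measurable[OF e])
    qed simp_all
    also have "\<dots> = fourier_coeff h m - b m" unfolding fb by (rule coeff[OF b])
    finally show ?thesis by simp
  qed
  then have "b = fourier_coeff h" by (rule ext)
  then show "f = disc_series (fourier_coeff h)" by (simp add: fb)
qed

lemma fourier_coeff_cong:
  assumes "AE \<zeta> in circle_measure. h \<zeta> = k \<zeta>" "h \<in> borel_measurable borel" "k \<in> borel_measurable borel"
  shows "fourier_coeff h = fourier_coeff k"
  unfolding fourier_coeff_def
  by (intro ext circle_inner_cong) (use assms in auto)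

lemma riesz_projection_in_H2: "square_integrable h \<Longrightarrow> riesz_projection h \<in> H2"
  by (simp add: riesz_projection_eq disc_series_in_H2 square_summable_fourier_coeff)

lemma riesz_projection_cong:
  assumes "square_integrable h" "square_integrable k" "AE \<zeta> in circle_measure. h \<zeta> = k \<zeta>"
  shows "riesz_projection h = riesz_projection k"
  using fourier_coeff_cong[OF assms(3)] assms(1,2)
  by (simp add: riesz_projection_eq square_integrable_measurable)

lemma riesz_projection_boundary:
  assumes "f \<in> H2"
  shows "riesz_projection (boundary f) = f"
proof -
  obtain a where a: "square_summable a" "f = disc_series a" by (rule H2_disc_series[OF assms])
  have "fourier_coeff (boundary f) = a" using fourier_coeff_boundary[OF a(1)] a(2) by (intro ext) simp
  then show ?thesis using riesz_projection_eq[OF square_integrable_boundary[OF assms]] a(2) by simp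
qed

lemma riesz_projection_add:
  assumes h: "square_integrable h" and k: "square_integrable k"
  shows "riesz_projection (\<lambda>\<zeta>. h \<zeta> + k \<zeta>) = riesz_projection h + riesz_projection k"
proof -
  have "fourier_coeff (\<lambda>\<zeta>. h \<zeta> + k \<zeta>) = (\<lambda>n. fourier_coeff h n + fourier_coeff k n)"
    unfolding fourier_coeff_def by (intro ext circle_inner_add h k square_integrable_power)
  then show ?thesis
    by (simp add: riesz_projection_eq h k square_integrable_add disc_series_add square_summable_fourier_coeff)
qed

lemma riesz_projection_scale:
  assumes h: "square_integrable h"
  shows "riesz_projection (\<lambda>\<zeta>. c * h \<zeta>) = cscale c (riesz_projection h)"
proof -
  have "fourier_coeff (\<lambda>\<zeta>. c * h \<zeta>) = (\<lambda>n. c * fourier_coeff h n)"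
    unfolding fourier_coeff_def by (intro ext circle_inner_scale)
  then show ?thesis
    by (simp add: riesz_projection_eq h square_integrable_scale disc_series_scale square_summable_fourier_coeff)
qed

lemma H2_inner_add:
  assumes "f \<in> H2" "g \<in> H2" "w \<in> H2"
  shows "H2_inner (f + g) w = H2_inner f w + H2_inner g w"
proof -
  have "H2_inner (f + g) w = circle_inner (\<lambda>\<zeta>. boundary f \<zeta> + boundary g \<zeta>) (boundary w)"
    unfolding H2_inner_def
    by (rule circle_inner_cong)
       (use H2_boundary_add[OF assms(1,2)] cfun.subspace_add[OF H2_subspace assms(1,2)] assms
        in \<open>auto intro!: borel_measurable_add H2_boundary_measurable\<close>)
  also have "\<dots> = H2_inner f w + H2_inner g w"
    unfolding H2_inner_def by (intro circle_inner_add square_integrable_boundary assms)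
  finally show ?thesis .
qed

lemma H2_inner_scale:
  assumes "f \<in> H2" "w \<in> H2"
  shows "H2_inner (cscale c f) w = c * H2_inner f w"
proof -
  have "H2_inner (cscale c f) w = circle_inner (\<lambda>\<zeta>. c * boundary f \<zeta>) (boundary w)"
    unfolding H2_inner_def
    by (rule circle_inner_cong)
       (use H2_boundary_scale[OF assms(1)] cfun.subspace_scale[OF H2_subspace assms(1)] assms
        in \<open>auto intro!: borel_measurable_times H2_boundary_measurable\<close>)
  also have "\<dots> = c * H2_inner f w"
    unfolding H2_inner_def by (rule circle_inner_scale)
  finally show ?thesis .
qed

lemma H2_outside: "f \<in> H2 \<Longrightarrow> z \<notin> ball 0 1 \<Longrightarrow> f z = 0"
  by (simp add: H2_def)

lemma H2_holomorphic: "f \<in> H2 \<Longrightarrow> f holomorphic_on ball 0 1"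
  by (simp add: H2_def)

section \<open>The backward shift\<close>

lemma backward_shift_disc_series:
  assumes a: "square_summable a"
  shows "backward_shift (disc_series a) = disc_series (\<lambda>n. a (Suc n))"
proof
  fix z
  have a': "square_summable (\<lambda>n. a (Suc n))" using a by (subst summable_Suc_iff)
  have split: "disc_series a z = a 0 + z * disc_series (\<lambda>n. a (Suc n)) z" if "cmod z < 1" for z
  proof -
    have "(\<lambda>n. a (Suc n) * z ^ Suc n) sums (z * disc_series (\<lambda>n. a (Suc n)) z)"
      using sums_mult[OF disc_series_sums[OF a' that], of z] by (simp add: mult_ac)
    then have "(\<lambda>n. a n * z ^ n) sums (z * disc_series (\<lambda>n. a (Suc n)) z + a 0)"
      by (subst (asm) sums_Suc_iff) simp
    then show ?thesis using disc_series_sums[OF a that] sums_unique2 by (force simp: add.commute)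
  qed
  have at0: "disc_series b 0 = b 0" if "square_summable b" for b
    using disc_series_sums[OF that, of 0] powser_sums_zero[of b] sums_unique2 by force
  let ?g = "disc_series (\<lambda>n. a (Suc n))"
  have "(disc_series a has_field_derivative ?g 0) (at 0)"
  proof -
    have "(?g has_field_derivative deriv ?g 0) (at 0)"
      by (rule holomorphic_derivI[OF disc_series_holomorphic[OF a'] open_ball]) simp
    then have "((\<lambda>z. a 0 + z * ?g z) has_field_derivative ?g 0) (at 0)"
      by (auto intro!: derivative_eq_intros)
    then show ?thesis
      by (rule has_field_derivative_transform_within_open[where S = "ball 0 1"]) (auto simp: split)
  qed
  then have "deriv (disc_series a) 0 = ?g 0" by (rule DERIV_imp_deriv)
  then show "backward_shift (disc_series a) z = ?g z"
    using split[of z] at0[OF a] by (auto simp: backward_shift_def disc_series_outside)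
qed

lemma backward_shift_in_H2:
  assumes "f \<in> H2"
  shows "backward_shift f \<in> H2"
proof -
  obtain a where a: "square_summable a" "f = disc_series a" by (rule H2_disc_series[OF assms])
  then show ?thesis
    using disc_series_in_H2[of "\<lambda>n. a (Suc n)"] summable_Suc_iff[of "\<lambda>n. (cmod (a n))\<^sup>2"]
    by (simp add: backward_shift_disc_series)
qed

lemma H2_differentiable_0: "f \<in> H2 \<Longrightarrow> f field_differentiable at 0"
  by (rule holomorphic_on_imp_differentiable_at[OF H2_holomorphic open_ball]) auto

lemma backward_shift_add:
  assumes "f \<in> H2" "g \<in> H2"
  shows "backward_shift (f + g) = backward_shift f + backward_shift g"
proof -
  have "deriv (\<lambda>z. f z + g z) 0 = deriv f 0 + deriv g 0"
    by (intro deriv_add H2_differentiable_0 assms)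
  then show ?thesis by (auto simp: backward_shift_def fun_eq_iff plus_fun_def divide_simps)
qed

lemma backward_shift_scale:
  assumes "f \<in> H2"
  shows "backward_shift (cscale c f) = cscale c (backward_shift f)"
proof -
  have "deriv (\<lambda>z. c * f z) 0 = c * deriv f 0"
    by (intro deriv_cmult H2_differentiable_0 assms)
  then show ?thesis by (auto simp: backward_shift_def fun_eq_iff cscale_def right_diff_distrib)
qed

text \<open>
  For h 0 = 0 the quotient of \<theta> h by z can be taken in the factor h.
\<close>

lemma backward_shift_mult:
  assumes "\<theta> holomorphic_on ball 0 1" "h \<in> H2" "h 0 = 0"
  shows "backward_shift (\<lambda>z. \<theta> z * h z) = (\<lambda>z. \<theta> z * backward_shift h z)"
proof -
  have "\<theta> field_differentiable at 0"
    by (rule holomorphic_on_imp_differentiable_at[OF assms(1) open_ball]) simp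
  then have "deriv (\<lambda>z. \<theta> z * h z) 0 = \<theta> 0 * deriv h 0"
    using assms by (subst deriv_mult) (auto intro: H2_differentiable_0)
  then show ?thesis using assms(3) by (auto simp: backward_shift_def fun_eq_iff)
qed

section \<open>Toeplitz operators with inner symbol\<close>

text \<open>
  An inner function is arbitrary outside the disc, so its boundary function need not be
  measurable on the plane. The cut-off repairs this without changing the values on the circle.
\<close>

definition restrict_disc :: "(complex \<Rightarrow> complex) \<Rightarrow> complex \<Rightarrow> complex" where
  "restrict_disc \<theta> z = (if z \<in> ball 0 1 then \<theta> z else 0)"

lemma restrict_disc_holomorphic:
  assumes "\<theta> holomorphic_on ball 0 1"
  shows "restrict_disc \<theta> holomorphic_on ball 0 1"
  by (rule holomorphic_transform[OF assms]) (simp add: restrict_disc_def)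

lemma boundary_restrict_disc:
  assumes "cmod \<zeta> \<le> 1"
  shows "boundary (restrict_disc \<theta>) \<zeta> = boundary \<theta> \<zeta>"
    and "((\<lambda>r. restrict_disc \<theta> (of_real r * \<zeta>)) \<longlongrightarrow> L) (at_left (1::real)) \<longleftrightarrow>
         ((\<lambda>r. \<theta> (of_real r * \<zeta>)) \<longlongrightarrow> L) (at_left (1::real))"
proof -
  have "\<forall>\<^sub>F r in at_left (1::real). r \<in> {0<..<1}" by (rule eventually_at_left_real) simp
  then have ev: "\<forall>\<^sub>F r in at_left (1::real). restrict_disc \<theta> (of_real r * \<zeta>) = \<theta> (of_real r * \<zeta>)"
  proof eventually_elim
    case (elim r)
    have "r * cmod \<zeta> \<le> r * 1" using elim assms by (intro mult_left_mono) auto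
    moreover have "r < 1" using elim by simp
    ultimately have "r * cmod \<zeta> < 1" by linarith
    then have "cmod (of_real r * \<zeta>) < 1" using elim by (simp add: norm_mult)
    then show ?case by (simp add: restrict_disc_def)
  qed
  have *: "((\<lambda>r. restrict_disc \<theta> (of_real r * \<zeta>)) \<longlongrightarrow> L) (at_left (1::real)) \<longleftrightarrow>
         ((\<lambda>r. \<theta> (of_real r * \<zeta>)) \<longlongrightarrow> L) (at_left (1::real))" for L
    by (rule tendsto_cong[OF ev])
  show "((\<lambda>r. restrict_disc \<theta> (of_real r * \<zeta>)) \<longlongrightarrow> L) (at_left (1::real)) \<longleftrightarrow>
         ((\<lambda>r. \<theta> (of_real r * \<zeta>)) \<longlongrightarrow> L) (at_left (1::real))" by (rule *)
  show "boundary (restrict_disc \<theta>) \<zeta> = boundary \<theta> \<zeta>"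
    unfolding boundary_def Topological_Spaces.Lim_def * ..
qed

lemma boundary_outside:
  assumes "f \<in> H2" "\<not> cmod \<zeta> \<le> 1"
  shows "boundary f \<zeta> = 0"
proof (rule boundary_eqI)
  have z: "1 < cmod \<zeta>" using assms(2) by simp
  then have "1 / cmod \<zeta> < 1" by (subst divide_less_eq) auto
  then have "\<forall>\<^sub>F r in at_left (1::real). r \<in> {1 / cmod \<zeta><..<1}" by (rule eventually_at_left_real)
  then have "\<forall>\<^sub>F r in at_left (1::real). 0 = f (of_real r * \<zeta>)"
  proof eventually_elim
    case (elim r)
    have "0 < 1 / cmod \<zeta>" using z by (intro divide_pos_pos) auto
    moreover have *: "1 / cmod \<zeta> < r" using elim by simp
    ultimately have "0 < r" by (rule less_trans)
    have "0 < cmod \<zeta>" using z by linarith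
    have "1 < r * cmod \<zeta>" using * \<open>0 < cmod \<zeta>\<close> by (simp add: divide_less_eq)
    then show ?case using \<open>0 < r\<close> by (intro H2_outside[OF assms(1), symmetric]) (simp add: norm_mult)
  qed
  then show "((\<lambda>r. f (of_real r * \<zeta>)) \<longlongrightarrow> 0) (at_left (1::real))"
    by (rule Lim_transform_eventually[OF tendsto_const])
qed

text \<open>
  Boundary functions of elements of the Hardy space vanish outside the closed disc, so the
  uncontrolled values of the symbol never enter a product with them.
\<close>

lemma boundary_symbol_eq:
  assumes "f \<in> H2"
  shows "boundary \<theta> \<zeta> * boundary f \<zeta> = boundary (restrict_disc \<theta>) \<zeta> * boundary f \<zeta>"
    and "cnj (boundary \<theta> \<zeta>) * boundary f \<zeta> = cnj (boundary (restrict_disc \<theta>) \<zeta>) * boundary f \<zeta>"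
  using boundary_outside[OF assms, of \<zeta>] boundary_restrict_disc(1)[of \<zeta> \<theta>] by (cases "cmod \<zeta> \<le> 1"; simp)+

lemma inner_function_boundary:
  assumes "inner_function \<theta>"
  shows "boundary (restrict_disc \<theta>) \<in> borel_measurable borel"
    and "AE \<zeta> in circle_measure.
      ((\<lambda>r. restrict_disc \<theta> (of_real r * \<zeta>)) \<longlongrightarrow> boundary (restrict_disc \<theta>) \<zeta>) (at_left (1::real)) \<and>
      cmod (boundary (restrict_disc \<theta>) \<zeta>) = 1"
proof -
  have hol: "\<theta> holomorphic_on ball 0 1" using assms by (simp add: inner_function_def)
  show "boundary (restrict_disc \<theta>) \<in> borel_measurable borel"
  proof (rule radial_limit_measurable(2))
    show "continuous_on (ball 0 1) (restrict_disc \<theta>)"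
      by (intro holomorphic_on_imp_continuous_on restrict_disc_holomorphic hol)
  qed (auto simp: restrict_disc_def)
  have "AE \<zeta> in circle_measure.
        \<exists>L. ((\<lambda>r. \<theta> (of_real r * \<zeta>)) \<longlongrightarrow> L) (at_left (1::real)) \<and> cmod L = 1"
    using assms by (simp add: inner_function_def)
  then show "AE \<zeta> in circle_measure.
      ((\<lambda>r. restrict_disc \<theta> (of_real r * \<zeta>)) \<longlongrightarrow> boundary (restrict_disc \<theta>) \<zeta>) (at_left (1::real)) \<and>
      cmod (boundary (restrict_disc \<theta>) \<zeta>) = 1"
    using AE_circle_norm
  proof eventually_elim
    case (elim \<zeta>)
    then obtain L where "((\<lambda>r. \<theta> (of_real r * \<zeta>)) \<longlongrightarrow> L) (at_left (1::real))" "cmod L = 1" by blast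
    then have "((\<lambda>r. restrict_disc \<theta> (of_real r * \<zeta>)) \<longlongrightarrow> L) (at_left (1::real))" "cmod L = 1"
      using elim boundary_restrict_disc(2)[of \<zeta> \<theta> L] by auto
    then show ?case using boundary_eqI[of "restrict_disc \<theta>" \<zeta> L] by simp
  qed
qed

lemma inner_mult_in_H2:
  assumes \<theta>: "inner_function \<theta>" and f: "f \<in> H2"
  shows "(\<lambda>z. restrict_disc \<theta> z * f z) \<in> H2"
proof -
  have hol: "\<theta> holomorphic_on ball 0 1" using \<theta> by (simp add: inner_function_def)
  obtain M where M: "\<And>z. z \<in> ball 0 1 \<Longrightarrow> cmod (\<theta> z) \<le> M"
    using \<theta> unfolding inner_function_def bounded_iff by blast
  have M': "cmod (restrict_disc \<theta> z) \<le> max M 0" for z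
    using M[of z] by (auto simp: restrict_disc_def)
  obtain C where C: "\<And>r. r \<in> {0..<1} \<Longrightarrow> (\<integral>\<zeta>. (cmod (f (of_real r * \<zeta>)))\<^sup>2 \<partial>circle_measure) \<le> C"
    using f unfolding H2_def bdd_above_def by blast
  have hol2: "(\<lambda>z. restrict_disc \<theta> z * f z) holomorphic_on ball 0 1"
    by (intro holomorphic_on_mult restrict_disc_holomorphic hol H2_holomorphic f)
  note [measurable] = disc_function_measurable[OF H2_holomorphic[OF f] H2_outside[OF f]]
  obtain a where a: "square_summable a" "f = disc_series a" by (rule H2_disc_series[OF f])
  have "bdd_above ((\<lambda>r::real. \<integral>\<zeta>. (cmod (restrict_disc \<theta> (of_real r * \<zeta>) * f (of_real r * \<zeta>)))\<^sup>2 \<partial>circle_measure) ` {0..<1})"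
  proof (rule bdd_aboveI2)
    fix r :: real assume r: "r \<in> {0..<1}"
    have int: "integrable circle_measure (\<lambda>\<zeta>. (cmod (f (of_real r * \<zeta>)))\<^sup>2)"
    proof (rule circle.integrable_const_bound)
      have s: "summable (\<lambda>n. cmod (a n * of_real r ^ n))"
        by (rule square_summable_powser_abs[OF a(1)]) (use r in auto)
      show "AE \<zeta> in circle_measure. norm ((cmod (f (of_real r * \<zeta>)))\<^sup>2) \<le> (\<Sum>n. cmod (a n * of_real r ^ n))\<^sup>2"
        using AE_circle_norm AE_circle_series_bound[OF s]
      proof eventually_elim
        case (elim \<zeta>)
        then have "f (of_real r * \<zeta>) = (\<Sum>n. a n * of_real r ^ n * \<zeta> ^ n)"
          using r by (simp add: a(2) disc_series_circle power_mult_distrib mult.assoc)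
        then show ?case using elim by (simp add: power_mono)
      qed
    qed measurable
    have "(\<integral>\<zeta>. (cmod (restrict_disc \<theta> (of_real r * \<zeta>) * f (of_real r * \<zeta>)))\<^sup>2 \<partial>circle_measure)
        \<le> (\<integral>\<zeta>. (max M 0)\<^sup>2 * (cmod (f (of_real r * \<zeta>)))\<^sup>2 \<partial>circle_measure)"
    proof (rule integral_mono')
      show "(cmod (restrict_disc \<theta> (of_real r * \<zeta>) * f (of_real r * \<zeta>)))\<^sup>2 \<le> (max M 0)\<^sup>2 * (cmod (f (of_real r * \<zeta>)))\<^sup>2" for \<zeta>
        unfolding norm_mult power_mult_distrib by (intro mult_right_mono power_mono M') auto
    qed (use int in auto)
    also have "\<dots> = (max M 0)\<^sup>2 * (\<integral>\<zeta>. (cmod (f (of_real r * \<zeta>)))\<^sup>2 \<partial>circle_measure)" by simp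
    also have "\<dots> \<le> (max M 0)\<^sup>2 * C" by (intro mult_left_mono C r) simp
    finally show "(\<integral>\<zeta>. (cmod (restrict_disc \<theta> (of_real r * \<zeta>) * f (of_real r * \<zeta>)))\<^sup>2 \<partial>circle_measure) \<le> (max M 0)\<^sup>2 * C" .
  qed
  then show ?thesis using hol2 H2_outside[OF f] by (simp add: H2_def)
qed

lemma inner_mult_boundary:
  assumes \<theta>: "inner_function \<theta>" and f: "f \<in> H2"
  shows "AE \<zeta> in circle_measure. boundary (\<lambda>z. restrict_disc \<theta> z * f z) \<zeta> = boundary (restrict_disc \<theta>) \<zeta> * boundary f \<zeta>"
  using inner_function_boundary(2)[OF \<theta>] H2_radial_limit[OF f]
  by eventually_elim (auto intro!: boundary_eqI tendsto_mult)

text \<open>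
  The product with an inner function is already in the Hardy space, so the projection acts as
  the identity.
\<close>

lemma toeplitz_inner:
  assumes \<theta>: "inner_function \<theta>" and f: "f \<in> H2"
  shows "toeplitz (boundary \<theta>) f = (\<lambda>z. restrict_disc \<theta> z * f z)"
proof -
  let ?g = "\<lambda>z. restrict_disc \<theta> z * f z"
  let ?h = "\<lambda>\<zeta>. boundary (restrict_disc \<theta>) \<zeta> * boundary f \<zeta>"
  have g: "?g \<in> H2" by (rule inner_mult_in_H2[OF assms])
  have ae: "AE \<zeta> in circle_measure. boundary ?g \<zeta> = ?h \<zeta>" by (rule inner_mult_boundary[OF assms])
  have h: "square_integrable ?h"
  proof (rule square_integrable_AE_eq[OF square_integrable_boundary[OF g]])
    show "?h \<in> borel_measurable borel"
      by (intro borel_measurable_times inner_function_boundary(1)[OF \<theta>] H2_boundary_measurable[OF f])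
    show "AE \<zeta> in circle_measure. cmod (boundary ?g \<zeta>) = cmod (?h \<zeta>)"
      using ae by eventually_elim (rule arg_cong)
  qed
  have "toeplitz (boundary \<theta>) f = riesz_projection ?h"
    unfolding toeplitz_def boundary_symbol_eq(1)[OF f, of \<theta>] ..
  also have "\<dots> = riesz_projection (boundary ?g)"
  proof (rule riesz_projection_cong[OF h square_integrable_boundary[OF g]])
    show "AE \<zeta> in circle_measure. ?h \<zeta> = boundary ?g \<zeta>"
      using ae by eventually_elim (rule sym)
  qed
  also have "\<dots> = ?g" by (rule riesz_projection_boundary[OF g])
  finally show ?thesis .
qed

lemma conjugate_symbol_square_integrable:
  assumes \<theta>: "inner_function \<theta>" and f: "f \<in> H2"
  shows "square_integrable (\<lambda>\<zeta>. cnj (boundary \<theta> \<zeta>) * boundary f \<zeta>)"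
proof (rule square_integrable_AE_eq[OF square_integrable_boundary[OF f]])
  note [measurable] = inner_function_boundary(1)[OF \<theta>] H2_boundary_measurable[OF f]
  show "(\<lambda>\<zeta>. cnj (boundary \<theta> \<zeta>) * boundary f \<zeta>) \<in> borel_measurable borel"
    unfolding boundary_symbol_eq(2)[OF f, of \<theta>] by measurable
  show "AE \<zeta> in circle_measure. cmod (boundary f \<zeta>) = cmod (cnj (boundary \<theta> \<zeta>) * boundary f \<zeta>)"
    unfolding boundary_symbol_eq(2)[OF f, of \<theta>]
    using inner_function_boundary(2)[OF \<theta>] by eventually_elim (simp add: norm_mult)
qed

lemma conjugate_toeplitz_in_H2:
  assumes "inner_function \<theta>" "f \<in> H2"
  shows "toeplitz (\<lambda>\<zeta>. cnj (boundary \<theta> \<zeta>)) f \<in> H2"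
  unfolding toeplitz_def by (intro riesz_projection_in_H2 conjugate_symbol_square_integrable assms)

lemma conjugate_toeplitz_add:
  assumes \<theta>: "inner_function \<theta>" and f: "f \<in> H2" and g: "g \<in> H2"
  shows "toeplitz (\<lambda>\<zeta>. cnj (boundary \<theta> \<zeta>)) (f + g)
    = toeplitz (\<lambda>\<zeta>. cnj (boundary \<theta> \<zeta>)) f + toeplitz (\<lambda>\<zeta>. cnj (boundary \<theta> \<zeta>)) g"
proof -
  have fg: "f + g \<in> H2" by (rule cfun.subspace_add[OF H2_subspace f g])
  note sq = conjugate_symbol_square_integrable[OF \<theta>]
  have "toeplitz (\<lambda>\<zeta>. cnj (boundary \<theta> \<zeta>)) (f + g)
     = riesz_projection (\<lambda>\<zeta>. cnj (boundary \<theta> \<zeta>) * boundary f \<zeta> + cnj (boundary \<theta> \<zeta>) * boundary g \<zeta>)"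
    unfolding toeplitz_def
  proof (rule riesz_projection_cong[OF sq[OF fg] square_integrable_add[OF sq[OF f] sq[OF g]]])
    show "AE \<zeta> in circle_measure. cnj (boundary \<theta> \<zeta>) * boundary (f + g) \<zeta>
        = cnj (boundary \<theta> \<zeta>) * boundary f \<zeta> + cnj (boundary \<theta> \<zeta>) * boundary g \<zeta>"
      using H2_boundary_add[OF f g] by eventually_elim (simp add: distrib_left)
  qed
  then show ?thesis
    unfolding toeplitz_def by (simp add: riesz_projection_add[OF sq[OF f] sq[OF g]])
qed

lemma conjugate_toeplitz_scale:
  assumes \<theta>: "inner_function \<theta>" and f: "f \<in> H2"
  shows "toeplitz (\<lambda>\<zeta>. cnj (boundary \<theta> \<zeta>)) (cscale c f) = cscale c (toeplitz (\<lambda>\<zeta>. cnj (boundary \<theta> \<zeta>)) f)"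
proof -
  have cf: "cscale c f \<in> H2" by (rule cfun.subspace_scale[OF H2_subspace f])
  note sq = conjugate_symbol_square_integrable[OF \<theta>]
  have "toeplitz (\<lambda>\<zeta>. cnj (boundary \<theta> \<zeta>)) (cscale c f)
     = riesz_projection (\<lambda>\<zeta>. c * (cnj (boundary \<theta> \<zeta>) * boundary f \<zeta>))"
    unfolding toeplitz_def
  proof (rule riesz_projection_cong[OF sq[OF cf] square_integrable_scale[OF sq[OF f]]])
    show "AE \<zeta> in circle_measure. cnj (boundary \<theta> \<zeta>) * boundary (cscale c f) \<zeta>
        = c * (cnj (boundary \<theta> \<zeta>) * boundary f \<zeta>)"
      using H2_boundary_scale[OF f, of c] by eventually_elim simp
  qed
  then show ?thesis
    unfolding toeplitz_def by (simp add: riesz_projection_scale[OF sq[OF f]])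
qed

text \<open>
  On the circle the conjugate of \<theta> is its inverse, so the conjugate symbol undoes
  multiplication by \<theta>.
\<close>

lemma conjugate_toeplitz_left_inverse:
  assumes \<theta>: "inner_function \<theta>" and f: "f \<in> H2"
  shows "toeplitz (\<lambda>\<zeta>. cnj (boundary \<theta> \<zeta>)) (\<lambda>z. restrict_disc \<theta> z * f z) = f"
proof -
  let ?g = "\<lambda>z. restrict_disc \<theta> z * f z"
  have g: "?g \<in> H2" by (rule inner_mult_in_H2[OF assms])
  have "toeplitz (\<lambda>\<zeta>. cnj (boundary \<theta> \<zeta>)) ?g = riesz_projection (boundary f)"
    unfolding toeplitz_def
  proof (rule riesz_projection_cong[OF conjugate_symbol_square_integrable[OF \<theta> g] square_integrable_boundary[OF f]])
    show "AE \<zeta> in circle_measure. cnj (boundary \<theta> \<zeta>) * boundary ?g \<zeta> = boundary f \<zeta>"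
      unfolding boundary_symbol_eq(2)[OF g, of \<theta>]
      using inner_function_boundary(2)[OF \<theta>] inner_mult_boundary[OF assms]
    proof eventually_elim
      case (elim \<zeta>)
      then have "cnj (boundary (restrict_disc \<theta>) \<zeta>) * boundary (restrict_disc \<theta>) \<zeta> = 1"
        using complex_norm_square[of "boundary (restrict_disc \<theta>) \<zeta>"] by (simp add: mult.commute)
      then show ?case using elim by (simp add: mult.assoc[symmetric])
    qed
  qed
  also have "\<dots> = f" by (rule riesz_projection_boundary[OF f])
  finally show ?thesis .
qed

section \<open>The kernel of the perturbed operator\<close>

text \<open>
  Linearity only on a subspace, because the operators here are linear on the Hardy space alone.
\<close>

lemma linear_on_subspace_sum:
  assumes V: "cfun.subspace V" and A: "finite A" "\<And>i. i \<in> A \<Longrightarrow> v i \<in> V"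
    and add: "\<And>f g. f \<in> V \<Longrightarrow> g \<in> V \<Longrightarrow> L (f + g) = L f + L g"
    and scale: "\<And>c f. f \<in> V \<Longrightarrow> L (cscale c f) = cscale c (L f)"
  shows "L (\<Sum>i\<in>A. cscale (c i) (v i)) = (\<Sum>i\<in>A. cscale (c i) (L (v i)))"
  using A
proof (induction A)
  case empty
  have "L (cscale 0 0) = cscale 0 (L 0)" by (rule scale[OF cfun.subspace_0[OF V]])
  then have "L 0 = 0" by (simp only: cfun.scale_zero_left)
  then show ?case by (simp only: sum.empty)
next
  case (insert i A)
  have "(\<Sum>i\<in>A. cscale (c i) (v i)) \<in> V"
    using insert.prems by (intro cfun.subspace_sum[OF V] cfun.subspace_scale[OF V]) auto
  moreover have vi: "v i \<in> V" using insert.prems by simp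
  ultimately have "L (cscale (c i) (v i) + (\<Sum>i\<in>A. cscale (c i) (v i)))
      = L (cscale (c i) (v i)) + L (\<Sum>i\<in>A. cscale (c i) (v i))"
    by (intro add cfun.subspace_scale[OF V])
  moreover have "L (\<Sum>i\<in>A. cscale (c i) (v i)) = (\<Sum>i\<in>A. cscale (c i) (L (v i)))"
    using insert by blast
  ultimately show ?case
    by (simp only: sum.insert[OF insert.hyps] scale[OF vi])
qed

theorem theorem2p3:
  fixes n :: nat
    and u v :: "nat \<Rightarrow> complex \<Rightarrow> complex"
    and \<theta> :: "complex \<Rightarrow> complex"
    and R :: "(complex \<Rightarrow> complex) \<Rightarrow> complex \<Rightarrow> complex"
  assumes "n \<ge> 1"
    and "\<And>i. i \<in> {1..n} \<Longrightarrow> u i \<in> H2"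
    and "\<And>i j. i \<in> {1..n} \<Longrightarrow> j \<in> {1..n} \<Longrightarrow> H2_inner (u i) (u j) = (if i = j then 1 else 0)"
    and "\<And>i. i \<in> {1..n} \<Longrightarrow> v i \<in> H2 \<and> v i \<noteq> 0"
    and "\<And>i j. i \<in> {1..n} \<Longrightarrow> j \<in> {1..n} \<Longrightarrow> i \<noteq> j \<Longrightarrow> H2_inner (v i) (v j) = 0"
    and "inner_function \<theta>"
    and "\<And>h. h \<in> H2 \<Longrightarrow>
           R h = toeplitz (boundary \<theta>) h + (\<Sum>i=1..n. cscale (H2_inner h (u i)) (v i))"
  shows "nearly_backward_shift_invariant {h \<in> H2. R h = 0} n
           (cfun.span ((\<lambda>i. toeplitz (\<lambda>\<zeta>. cnj (boundary \<theta> \<zeta>)) (backward_shift (v i))) ` {1..n}))"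
proof -
  note u = assms(2) and \<theta> = assms(6)
  have v: "\<And>i. i \<in> {1..n} \<Longrightarrow> v i \<in> H2" using assms(4) by blast
  define T where "T f = toeplitz (\<lambda>\<zeta>. cnj (boundary \<theta> \<zeta>)) (backward_shift f)" for f
  let ?M = "{h \<in> H2. R h = 0}" 
  have R: "R h = (\<lambda>z. restrict_disc \<theta> z * h z) + (\<Sum>i=1..n. cscale (H2_inner h (u i)) (v i))" if "h \<in> H2" for h
    using assms(7)[OF that] by (simp add: toeplitz_inner[OF \<theta> that])
  have R_add: "R (f + g) = R f + R g" if "f \<in> H2" "g \<in> H2" for f g
    using that
    by (simp add: R cfun.subspace_add[OF H2_subspace] H2_inner_add u cfun.scale_left_distrib sum.distrib)
       (simp add: fun_eq_iff algebra_simps)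
  have R_scale: "R (cscale c f) = cscale c (R f)" if "f \<in> H2" for c f
    using that
    by (simp add: R cfun.subspace_scale[OF H2_subspace] H2_inner_scale u cfun.scale_right_distrib cfun.scale_sum_right)
       (simp add: fun_eq_iff cscale_def algebra_simps)
  have M: "cfun.subspace ?M"
  proof (rule cfun.subspaceI)
    have "R (cscale 0 0) = cscale 0 (R 0)" by (rule R_scale[OF cfun.subspace_0[OF H2_subspace]])
    then show "0 \<in> ?M" using cfun.subspace_0[OF H2_subspace] by simp
  qed (auto simp: R_add R_scale cfun.subspace_add[OF H2_subspace] cfun.subspace_scale[OF H2_subspace])
  define F where "F = cfun.span ((\<lambda>i. T (v i)) ` {1..n})"
  have T_H2: "T f \<in> H2" if "f \<in> H2" for f
    unfolding T_def by (intro conjugate_toeplitz_in_H2[OF \<theta>] backward_shift_in_H2 that)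
  have T_add: "T (f + g) = T f + T g" if "f \<in> H2" "g \<in> H2" for f g
    unfolding T_def backward_shift_add[OF that]
    by (intro conjugate_toeplitz_add[OF \<theta>] backward_shift_in_H2 that)
  have T_scale: "T (cscale c f) = cscale c (T f)" if "f \<in> H2" for c f
    unfolding T_def backward_shift_scale[OF that]
    by (intro conjugate_toeplitz_scale[OF \<theta>] backward_shift_in_H2 that)
  have F: "F \<subseteq> H2"
    unfolding F_def using T_H2 v by (intro cfun.span_minimal H2_subspace) auto
  have dim: "cfun.dim F \<le> n"
  proof -
    have "cfun.dim F \<le> card ((\<lambda>i. T (v i)) ` {1..n})"
      unfolding F_def by (rule cfun.dim_le_card) auto
    also have "\<dots> \<le> card {1..n}" by (rule card_image_le) simp
    finally show ?thesis by simp
  qed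
  have shift: "backward_shift h \<in> F" if h: "h \<in> H2" "R h = 0" "h 0 = 0" for h
  proof -
    have hol: "restrict_disc \<theta> holomorphic_on ball 0 1"
      using \<theta> by (intro restrict_disc_holomorphic) (simp add: inner_function_def)
    \<comment> \<open>This is the equation R h = 0 solved for \<theta> h.\<close>
    have S: "(\<Sum>i=1..n. cscale (- H2_inner h (u i)) (v i)) = (\<lambda>z. restrict_disc \<theta> z * h z)"
    proof -
      have "(\<lambda>z. restrict_disc \<theta> z * h z) + (\<Sum>i=1..n. cscale (H2_inner h (u i)) (v i)) = 0"
        using R[OF h(1)] h(2) by (simp only:)
      then have "(\<Sum>i=1..n. cscale (H2_inner h (u i)) (v i)) = - (\<lambda>z. restrict_disc \<theta> z * h z)"
        by (simp only: add_eq_0_iff)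
      then show ?thesis by (simp only: cfun.scale_minus_left sum_negf minus_minus)
    qed
    have "backward_shift h = toeplitz (\<lambda>\<zeta>. cnj (boundary \<theta> \<zeta>)) (\<lambda>z. restrict_disc \<theta> z * backward_shift h z)"
      by (rule conjugate_toeplitz_left_inverse[OF \<theta> backward_shift_in_H2[OF h(1)], symmetric])
    also have "\<dots> = T (\<lambda>z. restrict_disc \<theta> z * h z)"
      unfolding T_def backward_shift_mult[OF hol h(1,3)] ..
    also have "\<dots> = (\<Sum>i=1..n. cscale (- H2_inner h (u i)) (T (v i)))"
      unfolding S[symmetric]
      by (rule linear_on_subspace_sum[OF H2_subspace _ v T_add T_scale]) auto
    also have "\<dots> \<in> F"
      unfolding F_def by (intro cfun.span_sum cfun.span_scale cfun.span_base) auto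
    finally show ?thesis .
  qed
  show ?thesis
    unfolding nearly_backward_shift_invariant_def T_def[symmetric] F_def[symmetric]
  proof (intro conjI ballI impI)
    show "\<exists>B. finite B \<and> F = cfun.span B" unfolding F_def by blast
    show "cfun.subspace F" unfolding F_def by (rule cfun.subspace_span)
    \<comment> \<open>The shifted function lies in F itself, so the component in the kernel is 0.\<close>
    show "\<exists>p\<in>?M. \<exists>q\<in>F. backward_shift h = p + q" if "h \<in> ?M" "h 0 = 0" for h
      using shift[of h] that cfun.subspace_0[OF M] by (intro bexI[of _ 0] bexI[of _ "backward_shift h"]) auto
  qed (use M F dim in auto)
qed

end
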